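(* Let $n\ge 0$ be an integer and let $E=\{e_1,\dots,e_n\}$, $T=\{t_{ij}:1\le i<j\le n\}$, $O=\{o_1,\dots,o_n\}$ be alphabets, with the convention $t_{ji}=t_{ij}$. Let $\Phi:(E\cup T\cup O)^+\to\mathcal{RP}_n\setminus\mathcal S_n$ be the semigroup homomorphism determined by $e_i\mapsto\overline e_i$, $t_{ij}\mapsto\overline t_{ij}$, $o_i\mapsto\overline o_i$. Then the singular part $\mathcal{RP}_n\setminus\mathcal S_n$ of the rook partition monoid has semigroup presentation $\langle E\cup T\cup O : R\rangle$ via $\Phi$, where $R$ consists of the following relations (all subscripts in $[n]$; $t_{ij}$ only occurs with $i\neq j$): $e_i^2=e_i$ for all $i$; $e_ie_j=e_je_i$ for distinct $i,j$; $t_{ij}^2=t_{ij}$ for all $i,j$; $t_{ij}t_{kl}=t_{kl}t_{ij}$ for all $i,j,k,l$; $t_{ij}t_{jk}=t_{jk}t_{ki}$ for distinct $i,j,k$; $t_{ij}e_k=e_kt_{ij}$ if $k\notin\{i,j\}$; $t_{ij}e_kt_{ij}=t_{ij}$ if $k\in\{i,j\}$; $e_kt_{ij}e_k=e_k$ if $k\in\{i,j\}$; $e_kt_{ki}e_it_{ij}e_jt_{jk}e_k=e_kt_{kj}e_jt_{ji}e_it_{ik}e_k$ for distinct $i,j,k$; $e_kt_{ki}e_it_{ij}e_jt_{jl}e_lt_{lk}e_k=e_kt_{kl}e_lt_{li}e_it_{ij}e_jt_{jk}e_k$ for distinct $i,j,k,l$; $o_i^2=o_i$ for all $i$; $o_io_j=o_jo_i$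 for distinct $i,j$; $o_ie_j=e_jo_i$ for distinct $i,j$; $o_ie_io_i=o_i$ for all $i$; $e_io_ie_i=e_i$ for all $i$; $t_{ij}o_k=o_kt_{ij}$ for any $i,j,k$; $t_{ij}o_i=t_{ij}o_j=o_io_j$ for all $i,j$ (with $i\ne j$).
   Context: Write $[n]=\{1,\dots,n\}$, $[n]'=\{1',\dots,n'\}$, $[n]''=\{1'',\dots,n''\}$. A rook partition of degree $n$ is a collection of pairwise disjoint non-empty subsets (called blocks) of $[n]\cup[n]'$; elements of $[n]\cup[n]'$ lying in no block are its rook dots. $\mathcal{RP}_n$ is the set of all rook partitions of degree $n$. Product: for $\alpha,\beta\in\mathcal{RP}_n$, relabel each $i'$ of $\alpha$ as $i''$ to get $\alpha_\vee$, and relabel each $i$ of $\beta$ as $i''$ to get $\beta^\wedge$. Let $\Gamma(\alpha,\beta)$ be the graph on $[n]\cup[n]'\cup[n]''$ in which two vertices are adjacent if they lie in a common block of $\alpha_\vee$ or a common block of $\beta^\wedge$; a vertex is white if it is a rook dot of $\alpha_\vee$ or of $\beta^\wedge$, and black otherwise. Then $\alpha\beta$ is the rook partition such that $x\in[n]\cup[n]'$ is a rook dot of $\alpha\beta$ iff $x$ is connected by a (possibly empty) path to a white vertex in $\Gamma(\alpha,\beta)$, and two elements of $[n]\cup[n]'$ that are not rook dots of $\alpha\beta$ are in the same block iff they are connected by a path in $\Gamma(\alpha,\beta)$. This makes $\mathcal{RP}_n$ a monoid with identity $\{\{1,1'\},\dots,\{n,n'\}\}$. A transversal block is one meeting both $[n]$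 and $[n]'$; $\mathcal S_n$ is the set of elements with exactly $n$ transversal blocks (the group of units, isomorphic to the symmetric group), and $\mathcal{RP}_n\setminus\mathcal S_n$ is an ideal (for $n=0$ it is empty). Elements: $\overline e_i$ has blocks $\{i\},\{i'\}$ and $\{j,j'\}$ for $j\ne i$; $\overline t_{ij}$ has blocks $\{i,j,i',j'\}$ and $\{k,k'\}$ for $k\notin\{i,j\}$; $\overline o_i$ has blocks $\{j,j'\}$ for $j\neq i$ and rook dots $i,i'$. $X^+$ is the free semigroup on $X$. A semigroup $S$ has semigroup presentation $\langle X:R\rangle$ via $\phi$ if $\phi:X^+\to S$ is a surjective homomorphism whose kernel $\{(u,v):u\phi=v\phi\}$ is the congruence on $X^+$ generated by $R$. *)

theory Defs
  imports "HOL-Library.Disjoint_Sets"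
begin

section \<open>Semigroup presentations\<close>

text \<open>A semigroup is given by a carrier set and a binary operation; the carrier may be empty.\<close>

definition is_semigroup :: "'a set \<Rightarrow> ('a \<Rightarrow> 'a \<Rightarrow> 'a) \<Rightarrow> bool" where
  "is_semigroup S m \<longleftrightarrow>
     (\<forall>x\<in>S. \<forall>y\<in>S. m x y \<in> S) \<and>
     (\<forall>x\<in>S. \<forall>y\<in>S. \<forall>z\<in>S. m (m x y) z = m x (m y z))"

definition semigroup_hom ::
  "'a set \<Rightarrow> ('a \<Rightarrow> 'a \<Rightarrow> 'a) \<Rightarrow> 'b set \<Rightarrow> ('b \<Rightarrow> 'b \<Rightarrow> 'b) \<Rightarrow> ('a \<Rightarrow> 'b) \<Rightarrow> bool" where
  "semigroup_hom S m S' m' f \<longleftrightarrow>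
     (\<forall>x\<in>S. f x \<in> S') \<and> (\<forall>x\<in>S. \<forall>y\<in>S. f (m x y) = m' (f x) (f y))"

definition is_congruence :: "'a set \<Rightarrow> ('a \<Rightarrow> 'a \<Rightarrow> 'a) \<Rightarrow> ('a \<times> 'a) set \<Rightarrow> bool" where
  "is_congruence S m r \<longleftrightarrow>
     equiv S r \<and> (\<forall>(x, y)\<in>r. \<forall>z\<in>S. (m z x, m z y) \<in> r \<and> (m x z, m y z) \<in> r)"

definition generated_congruence ::
  "'a set \<Rightarrow> ('a \<Rightarrow> 'a \<Rightarrow> 'a) \<Rightarrow> ('a \<times> 'a) set \<Rightarrow> ('a \<times> 'a) set" where
  "generated_congruence S m R = \<Inter>{r. is_congruence S m r \<and> R \<subseteq> r}"

text \<open>The free semigroup on \<open>X\<close>: non-empty words over \<open>X\<close>, under concatenation.\<close>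

definition free_semigroup :: "'x set \<Rightarrow> 'x list set" where
  "free_semigroup X = {w. w \<noteq> [] \<and> set w \<subseteq> X}"

text \<open>The value of the homomorphic extension of \<open>f\<close> at a non-empty word
  (the empty word is not in the free semigroup).\<close>

fun word_eval :: "('a \<Rightarrow> 'a \<Rightarrow> 'a) \<Rightarrow> ('x \<Rightarrow> 'a) \<Rightarrow> 'x list \<Rightarrow> 'a" where
  "word_eval m f [] = undefined"
| "word_eval m f [x] = f x"
| "word_eval m f (x # y # w) = m (f x) (word_eval m f (y # w))"

text \<open>The condition on \<open>R\<close> is needed because
  \<^const>\<open>generated_congruence\<close> is only meaningful for relations on the given carrier.\<close>

definition semigroup_presentation ::
  "'a set \<Rightarrow> ('a \<Rightarrow> 'a \<Rightarrow> 'a) \<Rightarrow> 'x set \<Rightarrow> ('x list \<times> 'x list) set \<Rightarrow> ('x list \<Rightarrow> 'a) \<Rightarrow> bool" where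
  "semigroup_presentation S m X R \<phi> \<longleftrightarrow>
     is_semigroup S m \<and>
     R \<subseteq> free_semigroup X \<times> free_semigroup X \<and>
     semigroup_hom (free_semigroup X) (@) S m \<phi> \<and>
     \<phi> ` free_semigroup X = S \<and>
     {(u, v). u \<in> free_semigroup X \<and> v \<in> free_semigroup X \<and> \<phi> u = \<phi> v} =
       generated_congruence (free_semigroup X) (@) R"


section \<open>The rook partition monoid\<close>

text \<open>\<open>Upper i\<close>, \<open>Lower i\<close> and \<open>Mid i\<close> stand for \<open>i\<close>, \<open>i'\<close> and \<open>i''\<close>.\<close>

datatype vertex = Upper nat | Lower nat | Mid nat

definition points :: "nat \<Rightarrow> vertex set" where
  "points n = Upper ` {1..n} \<union> Lower ` {1..n}"

definition rook_partitions :: "nat \<Rightarrow> vertex set set set" where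
  "rook_partitions n = {A. A \<subseteq> Pow (points n) \<and> {} \<notin> A \<and> disjoint A}"

definition rook_dots :: "nat \<Rightarrow> vertex set set \<Rightarrow> vertex set" where
  "rook_dots n A = points n - \<Union>A"

fun lower_to_mid :: "vertex \<Rightarrow> vertex" where
  "lower_to_mid (Upper i) = Upper i"
| "lower_to_mid (Lower i) = Mid i"
| "lower_to_mid (Mid i) = Mid i"

fun upper_to_mid :: "vertex \<Rightarrow> vertex" where
  "upper_to_mid (Upper i) = Mid i"
| "upper_to_mid (Lower i) = Lower i"
| "upper_to_mid (Mid i) = Mid i"

text \<open>Adjacency in the product graph of \<open>A\<close> and \<open>B\<close>; loops are included,
  which does not affect connectedness.\<close>

definition product_adj :: "vertex set set \<Rightarrow> vertex set set \<Rightarrow> (vertex \<times> vertex) set" where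
  "product_adj A B =
     {(x, y). (\<exists>C\<in>A. x \<in> lower_to_mid ` C \<and> y \<in> lower_to_mid ` C) \<or>
              (\<exists>C\<in>B. x \<in> upper_to_mid ` C \<and> y \<in> upper_to_mid ` C)}"

definition white_vertices :: "nat \<Rightarrow> vertex set set \<Rightarrow> vertex set set \<Rightarrow> vertex set" where
  "white_vertices n A B = lower_to_mid ` rook_dots n A \<union> upper_to_mid ` rook_dots n B"

definition product_dots :: "nat \<Rightarrow> vertex set set \<Rightarrow> vertex set set \<Rightarrow> vertex set" where
  "product_dots n A B =
     {x \<in> points n. \<exists>w\<in>white_vertices n A B. (x, w) \<in> (product_adj A B)\<^sup>*}"

definition rp_mult :: "nat \<Rightarrow> vertex set set \<Rightarrow> vertex set set \<Rightarrow> vertex set set" where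
  "rp_mult n A B =
     {{y \<in> points n - product_dots n A B. (x, y) \<in> (product_adj A B)\<^sup>*} | x.
        x \<in> points n - product_dots n A B}"

definition transversal :: "vertex set \<Rightarrow> bool" where
  "transversal C \<longleftrightarrow> (\<exists>i. Upper i \<in> C) \<and> (\<exists>i. Lower i \<in> C)"

definition rp_units :: "nat \<Rightarrow> vertex set set set" where
  "rp_units n = {A \<in> rook_partitions n. card {C \<in> A. transversal C} = n}"

definition e_bar :: "nat \<Rightarrow> nat \<Rightarrow> vertex set set" where
  "e_bar n i = {{Upper i}, {Lower i}} \<union> {{Upper j, Lower j} | j. j \<in> {1..n} - {i}}"

definition t_bar :: "nat \<Rightarrow> nat \<Rightarrow> nat \<Rightarrow> vertex set set" where
  "t_bar n i j =
     {{Upper i, Upper j, Lower i, Lower j}} \<union> {{Upper k, Lower k} | k. k \<in> {1..n} - {i, j}}"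

definition o_bar :: "nat \<Rightarrow> nat \<Rightarrow> vertex set set" where
  "o_bar n i = {{Upper j, Lower j} | j. j \<in> {1..n} - {i}}"


section \<open>Generators and relations\<close>

datatype letter = gE nat | gT nat nat | gO nat

definition alphabet :: "nat \<Rightarrow> letter set" where
  "alphabet n =
     gE ` {1..n} \<union> {gT i j | i j. 1 \<le> i \<and> i < j \<and> j \<le> n} \<union> gO ` {1..n}"

text \<open>This realises the convention that \<open>t\<^sub>j\<^sub>i\<close> is \<open>t\<^sub>i\<^sub>j\<close>.\<close>

definition gt :: "nat \<Rightarrow> nat \<Rightarrow> letter" where
  "gt i j = gT (min i j) (max i j)"

fun letter_value :: "nat \<Rightarrow> letter \<Rightarrow> vertex set set" where
  "letter_value n (gE i) = e_bar n i"
| "letter_value n (gT i j) = t_bar n i j"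
| "letter_value n (gO i) = o_bar n i"

definition Phi :: "nat \<Rightarrow> letter list \<Rightarrow> vertex set set" where
  "Phi n = word_eval (rp_mult n) (letter_value n)"

inductive_set relations :: "nat \<Rightarrow> (letter list \<times> letter list) set" for n :: nat where
  ee_idem: "i \<in> {1..n} \<Longrightarrow> ([gE i, gE i], [gE i]) \<in> relations n"
| ee_comm: "{i, j} \<subseteq> {1..n} \<Longrightarrow> i \<noteq> j \<Longrightarrow> ([gE i, gE j], [gE j, gE i]) \<in> relations n"
| tt_idem: "{i, j} \<subseteq> {1..n} \<Longrightarrow> i \<noteq> j \<Longrightarrow> ([gt i j, gt i j], [gt i j]) \<in> relations n"
| tt_comm: "{i, j, k, l} \<subseteq> {1..n} \<Longrightarrow> i \<noteq> j \<Longrightarrow> k \<noteq> l \<Longrightarrow>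
    ([gt i j, gt k l], [gt k l, gt i j]) \<in> relations n"
| tt_chain: "{i, j, k} \<subseteq> {1..n} \<Longrightarrow> distinct [i, j, k] \<Longrightarrow>
    ([gt i j, gt j k], [gt j k, gt k i]) \<in> relations n"
| te_comm: "{i, j, k} \<subseteq> {1..n} \<Longrightarrow> i \<noteq> j \<Longrightarrow> k \<notin> {i, j} \<Longrightarrow>
    ([gt i j, gE k], [gE k, gt i j]) \<in> relations n"
| tet: "{i, j} \<subseteq> {1..n} \<Longrightarrow> i \<noteq> j \<Longrightarrow> k \<in> {i, j} \<Longrightarrow>
    ([gt i j, gE k, gt i j], [gt i j]) \<in> relations n"
| ete: "{i, j} \<subseteq> {1..n} \<Longrightarrow> i \<noteq> j \<Longrightarrow> k \<in> {i, j} \<Longrightarrow>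
    ([gE k, gt i j, gE k], [gE k]) \<in> relations n"
| cycle3: "{i, j, k} \<subseteq> {1..n} \<Longrightarrow> distinct [i, j, k] \<Longrightarrow>
    ([gE k, gt k i, gE i, gt i j, gE j, gt j k, gE k],
     [gE k, gt k j, gE j, gt j i, gE i, gt i k, gE k]) \<in> relations n"
| cycle4: "{i, j, k, l} \<subseteq> {1..n} \<Longrightarrow> distinct [i, j, k, l] \<Longrightarrow>
    ([gE k, gt k i, gE i, gt i j, gE j, gt j l, gE l, gt l k, gE k],
     [gE k, gt k l, gE l, gt l i, gE i, gt i j, gE j, gt j k, gE k]) \<in> relations n"
| oo_idem: "i \<in> {1..n} \<Longrightarrow> ([gO i, gO i], [gO i]) \<in> relations n"
| oo_comm: "{i, j} \<subseteq> {1..n} \<Longrightarrow> i \<noteq> j \<Longrightarrow> ([gO i, gO j], [gO j, gO i]) \<in> relations n"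
| oe_comm: "{i, j} \<subseteq> {1..n} \<Longrightarrow> i \<noteq> j \<Longrightarrow> ([gO i, gE j], [gE j, gO i]) \<in> relations n"
| oeo: "i \<in> {1..n} \<Longrightarrow> ([gO i, gE i, gO i], [gO i]) \<in> relations n"
| eoe: "i \<in> {1..n} \<Longrightarrow> ([gE i, gO i, gE i], [gE i]) \<in> relations n"
| to_comm: "{i, j, k} \<subseteq> {1..n} \<Longrightarrow> i \<noteq> j \<Longrightarrow>
    ([gt i j, gO k], [gO k, gt i j]) \<in> relations n"
| to_absorb1: "{i, j} \<subseteq> {1..n} \<Longrightarrow> i \<noteq> j \<Longrightarrow>
    ([gt i j, gO i], [gt i j, gO j]) \<in> relations n"
| to_absorb2: "{i, j} \<subseteq> {1..n} \<Longrightarrow> i \<noteq> j \<Longrightarrow>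
    ([gt i j, gO j], [gO i, gO j]) \<in> relations n"

end

theory Submission
  imports Defs "HOL-Combinatorics.Permutations"
begin

text \<open>
  A rook partition \<open>A\<close> is encoded by the relation of all pairs \<open>(X, Y)\<close> of subsets of \<open>[n]\<close> such that
  \<open>X \<union> Y'\<close> is a union of blocks. This encoding is injective and turns the product into relational
  composition, so the soundness of the relations and associativity become routine.

  For completeness, treat \<open>o\<^sub>i\<close> as \<open>t\<^sub>0\<^sub>i\<close>; the relations become uniform in \<open>t\<^sub>i\<^sub>j\<close> with \<open>0 \<le> i, j \<le> n\<close>.
  The words \<open>e\<^sub>i t\<^sub>i\<^sub>j e\<^sub>j\<close> move a hole from \<open>i\<close> to \<open>j\<close>. They form a groupoid whose triangles at a fixed
  base point satisfy the relations of transpositions in a symmetric group, so a walk of the hole is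
  determined by its permutation. Restricting to smaller domains by further letters \<open>e\<^sub>i\<close> gives
  elements \<open>w\<close> depending only on a non-total partial permutation, and every word equals some
  \<open>T w T'\<close> with \<open>T, T'\<close> products of letters \<open>t\<^sub>i\<^sub>j\<close>. Once \<open>w\<close> uses at most one point of each class of the
  equivalences generated by \<open>T\<close> and \<open>T'\<close>, and none in the class of \<open>0\<close>, the equivalences are
  determined by the associated relation, and \<open>w\<close> is determined up to a change of representatives,
  which the relations permit.
\<close>

text \<open>The obstacle is that the singular part contains no invertible element, so transpositions
  have to be found inside local subgroups: with a hole at d, the closed walks of the hole form a
  group with identity \<open>e d\<close> that permutes the other n-1 points. The cycle relations of
  lengths three and four are what presents this group by all its transpositions. No subset of [n]
  contains 0, so being joined to 0 forces a point out of every admissible set, which is the effect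
  of a rook dot. There is no \<open>e 0\<close>: joins may end at 0 but the hole never sits there,
  hence the different index ranges. The argument runs in any monoid with a homomorphism
  \<open>sem\<close> to relations. It is applied to a monoid that remembers both the class of a word
  in the presented semigroup and its rook partition; there, injectivity of \<open>sem\<close> on
  products of letters says that words with equal rook partitions are congruent. The same normal
  forms, read in the other direction, give surjectivity. The identity of the monoid gives a meaning
  to \<open>t i i\<close> and to empty products; the elements compared are non-empty products of
  letters.\<close>

abbreviation sw :: "'a \<Rightarrow> 'a \<Rightarrow> 'a \<Rightarrow> 'a" where
  "sw \<equiv> Transposition.transpose"

section \<open>Products of commuting elements of a monoid\<close>

lemma mult_eq_assoc: "a * b = c \<Longrightarrow> a * (b * z) = c * (z::'m::monoid_mult)"
  by (simp flip: mult.assoc)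

lemma prod_list_commute:
  "(\<And>y. y \<in> set ys \<Longrightarrow> x * y = y * x) \<Longrightarrow> x * prod_list ys = prod_list ys * (x::'m::monoid_mult)"
proof (induction ys)
  case (Cons y ys)
  then have "x * y = y * x" "x * prod_list ys = prod_list ys * x" by simp_all
  then show ?case by (simp add: mult.assoc mult_eq_assoc[of x y])
qed simp

lemma prod_list_absorb:
  "(\<And>y. y \<in> set ys \<Longrightarrow> x * y = x) \<Longrightarrow> x * prod_list ys = (x::'m::monoid_mult)"
  by (induction ys) (simp_all flip: mult.assoc)

text \<open>Each product absorbs the other and the two commute, so both equal their common product;
  this is antisymmetry of the usual order on commuting idempotents.\<close>

lemma prod_list_eqI:
  fixes xs ys :: "'m::monoid_mult list"
  assumes "\<And>x y. x \<in> set xs \<Longrightarrow> y \<in> set ys \<Longrightarrow> x * y = y * x"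
    and "\<And>y. y \<in> set ys \<Longrightarrow> prod_list xs * y = prod_list xs"
    and "\<And>x. x \<in> set xs \<Longrightarrow> prod_list ys * x = prod_list ys"
  shows "prod_list xs = prod_list ys"
proof -
  have "prod_list xs = prod_list xs * prod_list ys"
    using assms(2) by (simp add: prod_list_absorb)
  also have "\<dots> = prod_list ys * prod_list xs"
    by (intro prod_list_commute prod_list_commute[symmetric]) (simp add: assms(1))
  also have "\<dots> = prod_list ys"
    using assms(3) by (simp add: prod_list_absorb)
  finally show ?thesis .
qed

lemma prod_list_member_absorb:
  fixes xs :: "'m::monoid_mult list"
  assumes "\<And>y z. y \<in> set xs \<Longrightarrow> z \<in> set xs \<Longrightarrow> y * z = z * y" "x \<in> set xs" "x * x = x"
  shows "prod_list xs * x = prod_list xs"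
  using assms
proof (induction xs)
  case (Cons y ys)
  show ?case
  proof (cases "x \<in> set ys")
    case True
    then show ?thesis using Cons by (simp add: mult.assoc)
  next
    case False
    then have "x = y" using Cons by simp
    moreover have "y * prod_list ys = prod_list ys * y"
      using Cons.prems by (intro prod_list_commute) simp
    ultimately show ?thesis using Cons.prems by (simp add: mult.assoc)
  qed
qed simp

section \<open>Transposition relations and the symmetric group\<close>

text \<open>The presentation of the symmetric group on X by all transpositions. The identity is an
  idempotent u and not 1, because the group will sit inside the monoid as a local subgroup with
  identity \<open>e d\<close>. Commutation of disjoint transpositions is not assumed but derived
  from \<open>triple\<close>.\<close>

locale transposition_relations =
  fixes u :: "'m::monoid_mult" and x :: "'i \<Rightarrow> 'i \<Rightarrow> 'm" and X :: "'i set"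
  assumes unit: "u * u = u"
    and left_unit: "\<lbrakk>i \<in> X; j \<in> X; i \<noteq> j\<rbrakk> \<Longrightarrow> u * x i j = x i j"
    and right_unit: "\<lbrakk>i \<in> X; j \<in> X; i \<noteq> j\<rbrakk> \<Longrightarrow> x i j * u = x i j"
    and sym: "\<lbrakk>i \<in> X; j \<in> X; i \<noteq> j\<rbrakk> \<Longrightarrow> x i j = x j i"
    and invol: "\<lbrakk>i \<in> X; j \<in> X; i \<noteq> j\<rbrakk> \<Longrightarrow> x i j * x i j = u"
    and triple: "\<lbrakk>i \<in> X; j \<in> X; l \<in> X; distinct [i, j, l]\<rbrakk> \<Longrightarrow> x i j * x j l = x l i * x i j"
begin

text \<open>A factor appended to the word acts last, so its transposition is composed on the left of
  F. A predicate relating words and permutations does not presuppose that either determines the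
  other.\<close>

inductive product_for :: "'i set \<Rightarrow> ('i \<Rightarrow> 'i) \<Rightarrow> 'm \<Rightarrow> bool" for P where
  empty: "product_for P id u"
| step: "product_for P F w \<Longrightarrow> a \<in> P \<Longrightarrow> b \<in> P \<Longrightarrow> a \<noteq> b \<Longrightarrow>
    product_for P (sw a b \<circ> F) (w * x a b)"

lemma product_for_right_unit: "product_for P F w \<Longrightarrow> P \<subseteq> X \<Longrightarrow> w * u = w"
  by (induction rule: product_for.induct) (auto simp: unit right_unit subset_iff mult.assoc)

lemma product_for_fixes: "product_for P F w \<Longrightarrow> z \<notin> P \<Longrightarrow> F z = z"
  by (induction rule: product_for.induct) (auto simp: Transposition.transpose_def)

lemma conjugate_triple:
  assumes "i \<in> X" "j \<in> X" "l \<in> X" "distinct [i, j, l]"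
  shows "x i j * x j l * x i j = x i l"
proof -
  have "x i j * x j l * x i j = x l i * (x i j * x i j)"
    using triple[OF assms] by (simp add: mult.assoc)
  also have "\<dots> = x i l"
    using assms right_unit[of i l] sym[of i l] by (simp add: invol)
  finally show ?thesis .
qed

text \<open>The element \<open>x l m\<close> is the conjugate of \<open>x i m\<close> by
  \<open>x l i\<close>. Passing \<open>x i j\<close> through this product replaces every i by j, and
  the result is again a conjugate equal to \<open>x l m\<close>.\<close>

lemma commute_disjoint:
  assumes "i \<in> X" "j \<in> X" "l \<in> X" "m \<in> X" "distinct [i, j, l, m]"
  shows "x i j * x l m = x l m * x i j"
proof -
  have "j \<noteq> i" "l \<noteq> i" "l \<noteq> j" using assms by auto
  have 1: "x i j * x l i = x l j * x i j"
    using \<open>j \<noteq> i\<close> triple[of j i l] sym[of i j] sym[of i l] assms by simp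
  have 2: "x i j * x i m = x j m * x i j"
    using \<open>j \<noteq> i\<close> triple[of j i m] sym[of i j] sym[of j m] assms by simp
  have "x i j * x l m = x i j * (x l i * x i m * x l i)"
    using conjugate_triple[of l i m] \<open>l \<noteq> i\<close> assms by simp
  also have "\<dots> = x l j * x j m * x l j * x i j"
    using mult_eq_assoc[OF 1] mult_eq_assoc[OF 2] by (simp add: mult.assoc 1)
  also have "\<dots> = x l m * x i j"
    using conjugate_triple[of l j m] \<open>l \<noteq> j\<close> assms by simp
  finally show ?thesis .
qed

lemma conjugate:
  assumes "a \<in> X" "b \<in> X" "z \<in> X" "k \<in> X" "a \<noteq> b" "z \<noteq> a" "z \<noteq> b" "z \<noteq> k"
  shows "x z k * x a b = x a b * x z (sw a b k)"
proof -
  consider "k = a" | "k = b" | "k \<noteq> a" "k \<noteq> b" by blast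
  then show ?thesis
  proof cases
    case 1
    then show ?thesis using triple[of a b z] sym[of z b] assms by auto
  next
    case 2
    then show ?thesis using triple[of b a z] sym[of a b] sym[of z a] assms by auto
  next
    case 3
    then show ?thesis using commute_disjoint[of z k a b] assms by simp
  qed
qed

text \<open>Coset decomposition with respect to the stabiliser of z: the representatives are u and
  the \<open>x z k\<close>. The induction shows that right multiplication by a generator leads from
  one representative to another, up to a left factor over P.\<close>

lemma product_for_insert:
  assumes "product_for (insert z P) F w" "z \<notin> P" "insert z P \<subseteq> X"
  shows "product_for P F w \<or>
    (\<exists>k F' w'. k \<in> P \<and> product_for P F' w' \<and> F = sw z k \<circ> F' \<and> w = w' * x z k)"
  using assms(1)
proof (induction rule: product_for.induct)
  case empty
  show ?case using product_for.empty by blast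
next
  case (step F w a b)
  let ?Q = "\<lambda>F w. product_for P F w \<or>
    (\<exists>k F' w'. k \<in> P \<and> product_for P F' w' \<and> F = sw z k \<circ> F' \<and> w = w' * x z k)"
  \<comment> \<open>Generators that involve z: such a factor creates a representative, cancels the
    present one, or by \<open>triple\<close> keeps it and emits a factor over P.\<close>
  have star: "?Q (sw z j \<circ> F) (w * x z j)" if j: "j \<in> P" for j
    using step.IH
  proof (elim disjE exE conjE)
    assume "product_for P F w"
    then show ?thesis using j by blast
  next
    fix k F' w'
    assume k: "k \<in> P" "product_for P F' w'" "F = sw z k \<circ> F'" "w = w' * x z k"
    show ?thesis
    proof (cases "j = k")
      case True
      have "w * x z j = w'"
        using k True assms product_for_right_unit[OF k(2)] invol[of z k] by (auto simp: mult.assoc)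
      moreover have "sw z j \<circ> F = F'"
        using k True by (simp add: fun_eq_iff)
      ultimately show ?thesis using k by simp
    next
      case False
      have "k \<noteq> z" "z \<noteq> j" "k \<in> X" "j \<in> X" "z \<in> X" using k j assms by auto
      then have "x z k * x z j = x j k * x z k"
        using triple[of k z j] sym[of k z] False by auto
      then have "w * x z j = w' * x j k * x z k"
        using k(4) by (simp add: mult.assoc)
      moreover have "sw z j \<circ> F = sw z k \<circ> (sw j k \<circ> F')"
        using k(1,3) j False assms(2) by (auto simp: fun_eq_iff Transposition.transpose_def)
      moreover have "product_for P (sw j k \<circ> F') (w' * x j k)"
        using k j False by (intro product_for.step) auto
      ultimately show ?thesis using k(1) by blast
    qed
  qed
  consider "a = z" "b \<in> P" | "b = z" "a \<in> P" | "a \<in> P" "b \<in> P" using step.hyps by blast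
  then show ?case
  proof cases
    case 1
    show ?thesis unfolding \<open>a = z\<close> by (rule star[OF \<open>b \<in> P\<close>])
  next
    case 2
    have "x a b = x z a" using 2 sym[of a b] step.hyps assms by auto
    moreover have "sw a b = sw z a"
      using 2 by (simp add: transpose_commute)
    ultimately show ?thesis using star[OF \<open>a \<in> P\<close>] by (simp only:)
  next
    case 3
    show ?thesis using step.IH
    proof (elim disjE exE conjE)
      assume "product_for P F w"
      then show ?thesis using 3 step.hyps product_for.step by blast
    next
      fix k F' w'
      assume k: "k \<in> P" "product_for P F' w'" "F = sw z k \<circ> F'" "w = w' * x z k"
      let ?k = "sw a b k"
      have "?k \<in> P" using 3 k by (auto simp: Transposition.transpose_def)
      moreover have "w * x a b = w' * x a b * x z ?k"
        unfolding k(4) mult.assoc using 3 k step.hyps assms by (subst conjugate) auto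
      moreover have "sw a b \<circ> F =
          sw z ?k \<circ> (sw a b \<circ> F')"
        using k(1,3) 3 step.hyps assms(2) by (auto simp: fun_eq_iff Transposition.transpose_def)
      ultimately show ?thesis using 3 step.hyps product_for.step k by blast
    qed
  qed
qed

text \<open>Points are peeled off one at a time: in a non-trivial coset z would be sent to k, which
  the identity does not do.\<close>

lemma product_for_id:
  assumes "finite P" "P \<subseteq> X" "product_for P id w"
  shows "w = u"
  using assms
proof (induction arbitrary: w rule: finite_induct)
  case empty
  then show ?case by (auto elim: product_for.cases)
next
  case (insert z P)
  have "product_for P id w"
    using product_for_insert[OF insert.prems(2) insert.hyps(2) insert.prems(1)]
  proof (elim disjE exE conjE)
    fix k F' w'
    assume k: "k \<in> P" "product_for P F' w'" "id = sw z k \<circ> F'"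
    have "z = sw z k (F' z)" using k(3) by (metis comp_apply id_apply)
    then show ?thesis using product_for_fixes[OF k(2) insert.hyps(2)] k(1) insert.hyps(2) by auto
  qed
  then show ?case using insert by blast
qed

end

section \<open>Partial permutations with a hole\<close>

text \<open>The instances of \<open>tet\<close> and \<open>ete\<close> with j = 0 are the relations
  o e o = o and e o e = e, and \<open>t_chain\<close> with one index 0 carries the absorption of
  joins by the letters o. Setting \<open>t i i\<close> to 1 admits degenerate indices and spares
  case distinctions.\<close>

locale rook_relations =
  fixes n :: nat and e :: "nat \<Rightarrow> 'm::monoid_mult" and t :: "nat \<Rightarrow> nat \<Rightarrow> 'm"
  assumes e_idem: "i \<in> {1..n} \<Longrightarrow> e i * e i = e i"
    and e_comm: "i \<in> {1..n} \<Longrightarrow> j \<in> {1..n} \<Longrightarrow> e i * e j = e j * e i"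
    and t_sym: "i \<le> n \<Longrightarrow> j \<le> n \<Longrightarrow> t i j = t j i"
    and t_refl: "i \<le> n \<Longrightarrow> t i i = 1"
    and t_idem: "i \<le> n \<Longrightarrow> j \<le> n \<Longrightarrow> t i j * t i j = t i j"
    and t_comm: "i \<le> n \<Longrightarrow> j \<le> n \<Longrightarrow> k \<le> n \<Longrightarrow> l \<le> n \<Longrightarrow> t i j * t k l = t k l * t i j"
    and t_chain: "i \<le> n \<Longrightarrow> j \<le> n \<Longrightarrow> k \<le> n \<Longrightarrow> t i j * t j k = t j k * t k i"
    and e_t_comm: "i \<le> n \<Longrightarrow> j \<le> n \<Longrightarrow> k \<in> {1..n} \<Longrightarrow> k \<noteq> i \<Longrightarrow> k \<noteq> j \<Longrightarrow> e k * t i j = t i j * e k"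
    and tet: "i \<in> {1..n} \<Longrightarrow> j \<le> n \<Longrightarrow> i \<noteq> j \<Longrightarrow> t i j * e i * t i j = t i j"
    and ete: "i \<in> {1..n} \<Longrightarrow> j \<le> n \<Longrightarrow> i \<noteq> j \<Longrightarrow> e i * t i j * e i = e i"
    and cycle3: "{i, j, k} \<subseteq> {1..n} \<Longrightarrow> distinct [i, j, k] \<Longrightarrow>
      e k * t k i * e i * t i j * e j * t j k * e k = e k * t k j * e j * t j i * e i * t i k * e k"
    and cycle4: "{i, j, k, l} \<subseteq> {1..n} \<Longrightarrow> distinct [i, j, k, l] \<Longrightarrow>
      e k * t k i * e i * t i j * e j * t j l * e l * t l k * e k =
      e k * t k l * e l * t l i * e i * t i j * e j * t j k * e k"
begin

section \<open>Elementary moves of the hole\<close>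

definition mv :: "nat \<Rightarrow> nat \<Rightarrow> 'm" where
  "mv i j = e i * t i j * e j"

lemma mv_self: "i \<in> {1..n} \<Longrightarrow> mv i i = e i"
  by (simp add: mv_def t_refl e_idem)

lemma e_mv: "i \<in> {1..n} \<Longrightarrow> e i * mv i j = mv i j"
  by (simp add: mv_def mult_eq_assoc[OF e_idem] mult.assoc)

lemma mv_e: "j \<in> {1..n} \<Longrightarrow> mv i j * e j = mv i j"
  by (simp add: mv_def e_idem mult.assoc)

lemma mv_inv:
  assumes "i \<in> {1..n}" "j \<in> {1..n}"
  shows "mv i j * mv j i = e i"
proof (cases "i = j")
  case True
  then show ?thesis using assms by (simp add: mv_self e_idem)
next
  case False
  have "mv i j * mv j i = e i * (t j i * e j * t j i) * e i"
    using assms by (simp add: mv_def mult.assoc mult_eq_assoc[OF e_idem] t_sym[of i j])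
  also have "\<dots> = e i * t i j * e i"
    using assms False tet[of j i] t_sym[of i j] by simp
  also have "\<dots> = e i" using assms False ete[of i j] by simp
  finally show ?thesis .
qed

lemma mv_inv_assoc: "i \<in> {1..n} \<Longrightarrow> j \<in> {1..n} \<Longrightarrow> mv i j * (mv j i * z) = e i * z"
  by (rule mult_eq_assoc[OF mv_inv])

lemma e_mv_cross:
  assumes "i \<in> {1..n}" "j \<in> {1..n}" "i \<noteq> j"
  shows "e j * mv i j = e i * e j"
proof -
  have "e j * mv i j = e i * (e j * t j i * e j)"
    using assms by (simp add: mv_def mult.assoc mult_eq_assoc[OF e_comm[of j i]] t_sym[of i j])
  then show ?thesis using assms ete[of j i] by simp
qed

lemma mv_e_cross:
  assumes "i \<in> {1..n}" "j \<in> {1..n}" "i \<noteq> j"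
  shows "mv i j * e i = e i * e j"
proof -
  have "mv i j * e i = (e i * t i j * e i) * e j"
    using assms by (simp add: mv_def mult.assoc e_comm[of j i])
  then show ?thesis using assms ete[of i j] by simp
qed

text \<open>A move acts on indices as the transposition of its end points. At the end points
  themselves the absorption laws and the crossing laws yield the same rule.\<close>

lemma e_mv_conj:
  assumes "c \<in> {1..n}" "k \<in> {1..n}" "y \<in> {1..n}"
  shows "e y * mv c k = mv c k * e (sw c k y)"
proof -
  consider "c = k" | "c \<noteq> k" "y = c" | "c \<noteq> k" "y = k" | "c \<noteq> k" "y \<noteq> c" "y \<noteq> k" by blast
  then show ?thesis
  proof cases
    case 1 then show ?thesis using assms by (simp add: mv_self e_comm)
  next
    case 2 then show ?thesis using assms by (simp add: e_mv mv_e)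
  next
    case 3 then show ?thesis using assms by (simp add: e_mv_cross mv_e_cross)
  next
    case 4
    then show ?thesis using assms
      by (simp add: mv_def mult.assoc mult_eq_assoc[OF e_comm[of y c]]
          mult_eq_assoc[OF e_t_comm[of c k y]] e_comm[of y k])
  qed
qed

text \<open>Again a move transposes indices, now for a join that does not touch the initial hole c.
  The substantial case is a join at k, whose end is transported to c.\<close>

lemma t_mv_conj:
  assumes "c \<in> {1..n}" "k \<in> {1..n}" "y \<le> n" "z \<le> n" "c \<noteq> y" "c \<noteq> z"
  shows "t y z * mv c k = mv c k * t (sw c k y) (sw c k z)"
proof -
  have ec: "t y z * (e c * w) = e c * (t y z * w)" for w
    using mult_eq_assoc[OF e_t_comm[of y z c, symmetric]] assms by (simp add: mult.assoc)
  \<comment> \<open>The points c, k, z are joined into one class; \<open>t_chain\<close> trades the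
    edge k z for c z, which passes \<open>e k\<close> because both of its ends differ from
    k.\<close>
  have move: "t k z * mv c k = mv c k * t c z" if "z \<le> n" "c \<noteq> z" "k \<noteq> z" "c \<noteq> k" for z
  proof -
    have "t k z * mv c k = t k z * e c * t c k * e k" by (simp add: mv_def mult.assoc)
    also have "\<dots> = e c * (t k z * t c k) * e k"
      using mult_eq_assoc[OF e_t_comm[of k z c, symmetric]] assms that by (simp add: mult.assoc)
    also have "t k z * t c k = t c k * t c z"
      using t_chain[of z k c] t_sym[of k z] t_sym[of c k] assms that by simp
    also have "e c * (t c k * t c z) * e k = mv c k * t c z"
      using e_t_comm[of c z k] assms that by (simp add: mv_def mult.assoc)
    finally show ?thesis .
  qed
  consider "c = k" | "c \<noteq> k" "y = k" "z = k" | "c \<noteq> k" "y = k" "k \<noteq> z" | "c \<noteq> k" "k \<noteq> y" "z = k"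
    | "c \<noteq> k" "k \<noteq> y" "k \<noteq> z" by blast
  then show ?thesis
  proof cases
    case 1 then show ?thesis using assms by (simp add: mv_self e_t_comm)
  next
    case 2 then show ?thesis using assms by (simp add: t_refl)
  next
    case 3 then show ?thesis using assms move[of z] by simp
  next
    case 4 then show ?thesis
      using assms move[of y] t_sym[of k y] t_sym[of c y] by simp
  next
    case 5
    have "t y z * (t c k * e k) = t c k * (e k * t y z)"
      using mult_eq_assoc[OF t_comm[of y z c k]] e_t_comm[of y z k] assms 5 by (simp add: mult.assoc)
    then have "t y z * mv c k = mv c k * t y z"
      by (simp add: mv_def mult.assoc ec)
    then show ?thesis using 5 assms by simp
  qed
qed

text \<open>The closed walk of the hole through d, i, j. It returns the hole to d with the contents
  of i and j exchanged, and so acts as the transposition of i and j in the group with identity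
  \<open>e d\<close>.\<close>

definition triangle :: "nat \<Rightarrow> nat \<Rightarrow> nat \<Rightarrow> 'm" where
  "triangle d i j = mv d i * mv i j * mv j d"

text \<open>Here the cycle relations enter. By \<open>cycle3\<close> a triangle may be traversed in
  either direction. In a product of two triangles the consecutive moves from j to d and back cancel,
  leaving a closed walk of length four, which \<open>cycle4\<close> turns into the one for the other
  product.\<close>

lemma triangle_relations:
  assumes d: "d \<in> {1..n}"
  shows "transposition_relations (e d) (triangle d) ({1..n} - {d})"
proof
  show "e d * e d = e d" using d by (rule e_idem)
next
  fix i j assume ij: "i \<in> {1..n} - {d}" "j \<in> {1..n} - {d}" "i \<noteq> j"
  show "e d * triangle d i j = triangle d i j"
    using d by (simp add: triangle_def mult_eq_assoc[OF e_mv] mult.assoc)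
  show "triangle d i j * e d = triangle d i j"
    using d by (simp add: triangle_def mv_e mult.assoc)
  show s: "triangle d i j = triangle d j i"
    using cycle3[of i j d] d ij
    by (simp add: triangle_def mv_def mult.assoc mult_eq_assoc[OF e_idem])
  have "triangle d i j * triangle d j i = e d"
    using d ij by (simp add: triangle_def mult.assoc mv_inv_assoc mult_eq_assoc[OF e_mv] mv_inv e_mv)
  then show "triangle d i j * triangle d i j = e d" using s by simp
next
  fix i j l assume ij: "i \<in> {1..n} - {d}" "j \<in> {1..n} - {d}" "l \<in> {1..n} - {d}" "distinct [i, j, l]"
  have "triangle d i j * triangle d j l = mv d i * mv i j * mv j l * mv l d"
    using d ij by (simp add: triangle_def mult.assoc mv_inv_assoc mult_eq_assoc[OF e_mv])
  also have "\<dots> = mv d l * mv l i * mv i j * mv j d"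
    using cycle4[of i j d l] d ij
    by (auto simp add: mv_def mult.assoc mult_eq_assoc[OF e_idem])
  also have "\<dots> = triangle d l i * triangle d i j"
    using d ij by (simp add: triangle_def mult.assoc mv_inv_assoc mult_eq_assoc[OF e_mv])
  finally show "triangle d i j * triangle d j l = triangle d l i * triangle d i j" .
qed

subsection \<open>Paths of a hole\<close>

text \<open>The hole starts at d and currently sits at \<open>F d\<close>; V bounds the places to
  which it may step. A step with k = \<open>F d\<close> is allowed and amounts to a factor
  \<open>e k\<close>.\<close>

inductive path :: "nat set \<Rightarrow> nat \<Rightarrow> (nat \<Rightarrow> nat) \<Rightarrow> 'm \<Rightarrow> bool" for V d where
  start: "path V d id (e d)"
| step: "path V d F w \<Longrightarrow> k \<in> V \<Longrightarrow> path V d (sw (F d) k \<circ> F) (w * mv (F d) k)"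

lemma path_permutes: "path V d F w \<Longrightarrow> d \<in> V \<Longrightarrow> F permutes V"
proof (induction rule: path.induct)
  case (step F w k)
  then show ?case by (intro permutes_compose permutes_swap_id) (auto simp: permutes_in_image)
qed (simp add: permutes_id)

lemma path_mono: "path V d F w \<Longrightarrow> V \<subseteq> V' \<Longrightarrow> path V' d F w"
  by (induction rule: path.induct) (auto intro: path.intros)

lemma path_absorb:
  assumes "path V d F w" "d \<in> V" "V \<subseteq> {1..n}"
  shows "e d * w = w" "w * e (F d) = w"
proof -
  have "e d * w = w \<and> w * e (F d) = w" using assms
  proof (induction rule: path.induct)
    case start
    then show ?case by (auto simp: e_idem)
  next
    case (step F w k)
    then show ?case by (auto simp: mult.assoc mv_e simp flip: mult.assoc[of "e d"])
  qed
  then show "e d * w = w" "w * e (F d) = w" by auto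
qed

text \<open>The edges from d to all other points are a spanning tree of the complete graph. Relative
  to it, a walk becomes a product of triangles at d followed by the single edge from d to its end
  point.\<close>

lemma path_decomposition:
  assumes "path {1..n} d F w" "d \<in> {1..n}"
  shows "\<exists>G X. transposition_relations.product_for (e d) (triangle d) ({1..n} - {d}) G X \<and>
    w = X * mv d (F d) \<and> F = sw d (F d) \<circ> G"
proof -
  interpret T: transposition_relations "e d" "triangle d" "{1..n} - {d}"
    using assms(2) by (rule triangle_relations)
  show ?thesis using assms(1)
  proof (induction rule: path.induct)
    case start
    have "e d = e d * mv d (id d)" "id = sw d (id d) \<circ> id"
      using assms(2) by (simp_all add: mv_self e_idem)
    then show ?case using T.product_for.empty by blast
  next
    case (step F w k)
    then obtain G X where GX: "T.product_for ({1..n} - {d}) G X" "w = X * mv d (F d)" "F = sw d (F d) \<circ> G"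
      by blast
    have c: "F d \<in> {1..n}"
      using path_permutes[OF step.hyps(1) assms(2)] assms(2) by (simp only: permutes_in_image)
    define c where "c = F d"
    have c: "c \<in> {1..n}" and w: "w = X * mv d c" and F: "F = sw d c \<circ> G" using c GX c_def by auto
    have d': "(sw c k \<circ> F) d = k" by (simp add: c_def)
    note X = T.product_for_right_unit[OF GX(1)]
    consider "c = k" | "c = d" | "k = d" | "c \<noteq> k" "c \<noteq> d" "k \<noteq> d" by blast
    then have "\<exists>G X. T.product_for ({1..n} - {d}) G X \<and>
      w * mv c k = X * mv d k \<and> sw c k \<circ> F = sw d k \<circ> G"
    proof cases
      case 1
      then show ?thesis using GX(1) w F c by (auto simp: mv_self mult.assoc mv_e)
    next
      case 2
      then show ?thesis using GX(1) w F assms(2) by (auto simp: mv_self mult.assoc e_mv)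
    next
      case 3
      have "w * mv c k = X * mv d k"
        using w 3 c assms(2) X by (simp add: mult.assoc mv_inv mv_self)
      moreover have "sw c k \<circ> F = sw d k \<circ> G"
        using 3 F by (simp add: fun_eq_iff transpose_commute)
      ultimately show ?thesis using GX(1) by blast
    next
      case 4
      \<comment> \<open>Going from k to d and back is free, so the new edge c k completes a triangle
        at d and leaves the tree edge d k.\<close>
      have "triangle d c k * mv d k = mv d c * mv c k"
        using 4 c assms(2) step.hyps(2) by (simp add: triangle_def mult.assoc mv_inv mv_e)
      then have "w * mv c k = X * triangle d c k * mv d k" using w by (simp add: mult.assoc)
      moreover have "sw c k \<circ> F = sw d k \<circ> (sw c k \<circ> G)"
        using 4 F by (auto simp: fun_eq_iff Transposition.transpose_def)
      moreover have "T.product_for ({1..n} - {d}) (sw c k \<circ> G) (X * triangle d c k)"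
        using 4 c step.hyps(2) GX(1) by (intro T.product_for.step) auto
      ultimately show ?thesis by blast
    qed
    then show ?case using d' by (simp add: c_def comp_def)
  qed
qed

lemma path_id:
  assumes "path {1..n} d id w" "d \<in> {1..n}"
  shows "w = e d"
proof -
  interpret T: transposition_relations "e d" "triangle d" "{1..n} - {d}"
    using assms(2) by (rule triangle_relations)
  obtain G X where "T.product_for ({1..n} - {d}) G X" "w = X * mv d d" "id = sw d d \<circ> G"
    using path_decomposition[OF assms] by auto
  moreover from this have "X = e d" using T.product_for_id[of "{1..n} - {d}" X] by simp
  ultimately show ?thesis using assms(2) by (simp add: mv_self e_idem)
qed

lemma path_comp:
  assumes "path V (F d) G v" "path V d F w" "d \<in> V" "V \<subseteq> {1..n}"
  shows "path V d (G \<circ> F) (w * v)"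
  using assms(1)
proof (induction rule: path.induct)
  case start
  then show ?case using assms path_absorb by auto
next
  case (step G v k)
  show ?case using path.step[OF step.IH step.hyps(2)] by (simp add: mult.assoc comp_def)
qed

lemma path_single:
  assumes "c \<in> {1..n}" "k \<in> V"
  shows "path V c (sw c k) (mv c k)"
  using path.step[OF path.start[of V c] assms(2)] assms(1) by (simp add: e_mv)

lemma path_inverse:
  assumes "path V d F w" "d \<in> V" "V \<subseteq> {1..n}"
  shows "\<exists>v. path V (F d) (inv F) v \<and> w * v = e d \<and> v * w = e (F d)"
  using assms
proof (induction rule: path.induct)
  case start
  then have "e d * e d = e d" by (auto simp: e_idem)
  then show ?case using path.start[of V d] by (metis id_apply inv_id)
next
  case (step F w k)
  then obtain v where v: "path V (F d) (inv F) v" "w * v = e d" "v * w = e (F d)" by auto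
  have F: "F permutes V" using step.hyps(1) step.prems(1) by (rule path_permutes)
  have FV: "F d \<in> V" using F step.prems by (simp add: permutes_in_image)
  have FI: "F d \<in> {1..n}" and k: "k \<in> {1..n}"
    using FV step by blast+
  have "path V k (sw k (F d)) (mv k (F d))" using FV k by (intro path_single)
  then have "path V k (inv F \<circ> sw k (F d)) (mv k (F d) * v)"
    using v(1) step by (intro path_comp) auto
  moreover have "inv (sw (F d) k \<circ> F) = inv F \<circ> sw k (F d)"
    using permutes_bij[OF F] by (simp add: o_inv_distrib transpose_commute)
  moreover have "w * mv (F d) k * (mv k (F d) * v) = e d"
    using FI k path_absorb[OF step.hyps(1) step.prems] v(2)
    by (simp add: mult.assoc mv_inv_assoc) (simp flip: mult.assoc)
  moreover have "mv k (F d) * v * (w * mv (F d) k) = e k"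
    using FI k v(3) by (simp add: mult.assoc mult_eq_assoc[OF v(3)] e_mv mv_inv)
  ultimately show ?case by (intro exI[of _ "mv k (F d) * v"]) (simp add: comp_def)
qed

text \<open>The first walk followed by the inverse of the second is closed with trivial permutation,
  and \<open>path_id\<close> applies to it.\<close>

lemma path_unique:
  assumes "path {1..n} d F w" "path {1..n} d F w'" "d \<in> {1..n}"
  shows "w = w'"
proof -
  obtain v where v: "path {1..n} (F d) (inv F) v" "w' * v = e d" "v * w' = e (F d)"
    using path_inverse[OF assms(2)] assms(3) by auto
  have "inv F \<circ> F = id"
    using path_permutes[OF assms(1,3)] by (rule permutes_inv_o)
  then have "w * v = e d"
    using path_comp[OF v(1) assms(1)] assms(3) path_id by auto
  then have "w * v * w' = w'" using path_absorb[OF assms(2)] assms(3) by auto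
  then show ?thesis using v(3) path_absorb[OF assms(1)] assms(3) by (auto simp: mult.assoc)
qed

lemma path_exists:
  assumes "F permutes V" "d \<in> V" "V \<subseteq> {1..n}"
  shows "\<exists>w. path V d F w"
proof -
  have "finite V" using assms(3) finite_subset by blast
  from assms(1) this show ?thesis
  proof (induction rule: permutes_induct)
    case id
    then show ?case using path.start by blast
  next
    case (swap a b p)
    then obtain w where w: "path V d p w" by blast
    consider "p d = a" | "p d = b" | "p d \<noteq> a" "p d \<noteq> b" by blast
    then show ?case
    proof cases
      case 1
      then show ?thesis using path.step[OF w] swap by blast
    next
      case 2
      then show ?thesis using path.step[OF w, of a] swap by (metis transpose_commute)
    next
      case 3
      have pd: "p d \<in> V" using swap assms by (simp add: permutes_in_image)
      \<comment> \<open>The hole is at neither a nor b. It is carried once around p d, a, b and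
        back, which exchanges a and b.\<close>
      have 1: "path V d (sw (p d) a \<circ> p) (w * mv (p d) a)"
        using path.step[OF w, of a] swap by simp
      have 2: "path V d (sw a b \<circ> (sw (p d) a \<circ> p)) (w * mv (p d) a * mv a b)"
        using path.step[OF 1, of b] swap by simp
      have 4: "path V d (sw b (p d) \<circ> (sw a b \<circ> (sw (p d) a \<circ> p))) (w * mv (p d) a * mv a b * mv b (p d))"
        using path.step[OF 2 pd] by simp
      moreover have "sw b (p d) \<circ> (sw a b \<circ> (sw (p d) a \<circ> p)) = sw a b \<circ> p"
        using 3 swap by (auto simp: fun_eq_iff Transposition.transpose_def)
      ultimately have "path V d (sw a b \<circ> p) (w * mv (p d) a * mv a b * mv b (p d))" by simp
      then show ?thesis by blast
    qed
  qed
qed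

lemma path_e:
  assumes "path V d F w" "d \<in> V" "V \<subseteq> {1..n}" "a \<in> {1..n}"
  shows "e a * w = w * e (F a)"
  using assms
proof (induction rule: path.induct)
  case start
  then show ?case by (auto simp: e_comm)
next
  case (step F w k)
  have F: "F permutes {1..n}" using step path_permutes permutes_subset by blast
  then have "F d \<in> {1..n}" "F a \<in> {1..n}" "k \<in> {1..n}"
    using step by (simp_all only: permutes_in_image subset_iff)
  then have "e (F a) * mv (F d) k = mv (F d) k * e (sw (F d) k (F a))" by (intro e_mv_conj)
  then show ?case using step by (metis comp_apply mult.assoc)
qed

lemma path_t:
  assumes "path V d F w" "d \<in> V" "V \<subseteq> {1..n}" "a \<le> n" "b \<le> n" "a \<noteq> d" "b \<noteq> d"
  shows "t a b * w = w * t (F a) (F b)"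
  using assms
proof (induction rule: path.induct)
  case start
  then show ?case by (auto simp: e_t_comm subset_iff)
next
  case (step F w k)
  have F: "F permutes {..n}" using step path_permutes permutes_subset
    by (metis atLeastAtMost_iff atMost_iff subset_iff)
  then have Fn: "F a \<le> n" "F b \<le> n" using step permutes_in_image[OF F] by (simp_all add: atMost_def)
  have "F d \<in> V" using path_permutes[OF step.hyps(1)] step.prems by (simp add: permutes_in_image)
  then have Fd: "F d \<in> {1..n}" "k \<in> {1..n}" using step by blast+
  have "F d \<noteq> F a" "F d \<noteq> F b" using step.prems permutes_inj[OF F] by (auto dest: injD)
  then have "t (F a) (F b) * mv (F d) k = mv (F d) k * t (sw (F d) k (F a)) (sw (F d) k (F b))"
    using Fn Fd by (intro t_mv_conj)
  then show ?case using step by (metis comp_apply mult.assoc)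
qed

section \<open>Several holes: products of the idempotents\<close>

definition e_prod :: "nat list \<Rightarrow> 'm" where
  "e_prod ds = prod_list (map e ds)"

lemma e_prod_simps [simp]:
  "e_prod [] = 1" "e_prod (d # ds) = e d * e_prod ds" "e_prod (ds @ ds') = e_prod ds * e_prod ds'"
  by (simp_all add: e_prod_def)

lemma e_prod_commute: "set ds \<subseteq> {1..n} \<Longrightarrow> a \<in> {1..n} \<Longrightarrow> e a * e_prod ds = e_prod ds * e a"
  unfolding e_prod_def by (rule prod_list_commute) (auto simp: e_comm subset_iff)

lemma e_prod_absorb: "set ds \<subseteq> {1..n} \<Longrightarrow> a \<in> set ds \<Longrightarrow> e_prod ds * e a = e_prod ds"
  unfolding e_prod_def by (rule prod_list_member_absorb) (auto simp: e_comm e_idem subset_iff)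

lemma e_prod_cong: "set ds = set ds' \<Longrightarrow> set ds \<subseteq> {1..n} \<Longrightarrow> e_prod ds = e_prod ds'"
  unfolding e_prod_def
  by (rule prod_list_eqI) (use e_prod_absorb[unfolded e_prod_def] in \<open>auto simp: e_comm subset_iff\<close>)

lemma e_prod_t:
  assumes "set ds \<subseteq> {1..n}" "a \<le> n" "b \<le> n" "a \<notin> set ds" "b \<notin> set ds"
  shows "t a b * e_prod ds = e_prod ds * t a b"
  unfolding e_prod_def
proof (rule prod_list_commute)
  fix y assume "y \<in> set (map e ds)"
  then obtain d where "y = e d" "d \<in> set ds" by auto
  moreover from this have "d \<in> {1..n}" "d \<noteq> a" "d \<noteq> b" using assms by blast+
  ultimately show "t a b * y = y * t a b" using assms e_t_comm[of a b d] by simp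
qed

text \<open>Both ends are holes, so the move carries nothing: a factor \<open>e k\<close> borrowed
  from the product turns the move into \<open>e c * e k\<close>.\<close>

lemma e_prod_mv_absorb:
  assumes "set ds \<subseteq> {1..n}" "c \<in> set ds" "k \<in> set ds"
  shows "e_prod ds * mv c k = e_prod ds"
proof (cases "c = k")
  case True
  then show ?thesis using assms by (auto simp: mv_self e_prod_absorb subset_iff)
next
  case False
  have "e_prod ds * mv c k = e_prod ds * (e k * mv c k)"
    using assms by (simp add: e_prod_absorb flip: mult.assoc)
  also have "\<dots> = e_prod ds * (e c * e k)"
    using assms False by (auto simp: e_mv_cross subset_iff)
  also have "\<dots> = e_prod ds"
    using assms by (simp add: e_prod_absorb flip: mult.assoc)
  finally show ?thesis .
qed

lemma e_prod_path_absorb: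
  assumes "path D d F w" "d \<in> D" "set ds = D" "D \<subseteq> {1..n}"
  shows "e_prod ds * w = e_prod ds"
  using assms
proof (induction rule: path.induct)
  case start
  then show ?case by (simp add: e_prod_absorb)
next
  case (step F w k)
  have "F d \<in> D"
    using path_permutes[OF step.hyps(1)] step.prems by (simp add: permutes_in_image)
  then show ?case using step by (simp add: e_prod_mv_absorb flip: mult.assoc)
qed

text \<open>\<open>partial_perm D F w\<close>: \<open>w\<close> represents the restriction of the permutation \<open>F\<close>
  to the complement of the non-empty set \<open>D\<close>.\<close>

definition partial_perm :: "nat set \<Rightarrow> (nat \<Rightarrow> nat) \<Rightarrow> 'm \<Rightarrow> bool" where
  "partial_perm D F w \<longleftrightarrow>
     (\<exists>ds d q. path {1..n} d F q \<and> d \<in> D \<and> D \<subseteq> {1..n} \<and> set ds = D \<and> w = e_prod ds * q)"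

lemma partial_perm_permutes: "partial_perm D F w \<Longrightarrow> F permutes {1..n}"
  unfolding partial_perm_def using path_permutes by blast

lemma partial_perm_subset: "partial_perm D F w \<Longrightarrow> D \<subseteq> {1..n}"
  unfolding partial_perm_def by blast

lemma e_prod_path_e:
  assumes "path {1..n} d F q" "d \<in> {1..n}" "set ds \<subseteq> {1..n}" "a \<in> set ds"
  shows "e_prod ds * q * e (F a) = e_prod ds * q"
proof -
  have "e_prod ds * (q * e (F a)) = e_prod ds * e a * q"
    using path_e[OF assms(1,2), of a] assms by (auto simp: mult.assoc)
  then show ?thesis using assms by (simp add: mult_eq_assoc[OF e_prod_absorb] mult.assoc)
qed

text \<open>The two walks may start at different holes, and their permutations may differ on D. One
  more move between two values of F on D makes the end points agree. After that the permutations
  differ by a permutation of D, realised by a walk through holes only, which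
  \<open>e_prod ds\<close> absorbs.\<close>

lemma partial_perm_unique:
  assumes "partial_perm D F w" "partial_perm D F' w'" "\<And>a. a \<in> {1..n} - D \<Longrightarrow> F a = F' a"
  shows "w = w'"
proof -
  obtain ds d q where q: "path {1..n} d F q" "d \<in> D" "D \<subseteq> {1..n}" "set ds = D" "w = e_prod ds * q"
    using assms(1) unfolding partial_perm_def by blast
  obtain ds' d' q' where q': "path {1..n} d' F' q'" "d' \<in> D" "set ds' = D" "w' = e_prod ds' * q'"
    using assms(2) unfolding partial_perm_def by blast
  have ds: "e_prod ds' = e_prod ds" using q q' by (intro e_prod_cong) auto
  have d: "d \<in> {1..n}" "d' \<in> {1..n}" using q q' by auto
  have F: "F permutes {1..n}" and F': "F' permutes {1..n}"
    using partial_perm_permutes[OF assms(1)] partial_perm_permutes[OF assms(2)] by auto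
  have eq: "F a = F' a" if "a \<notin> D" for a
    using that assms(3) F F' by (metis DiffI permutes_not_in)
  have img: "F x \<in> F ` D \<longleftrightarrow> x \<in> D" for x using permutes_inj[OF F] by (auto dest: injD)
  have img': "F' x \<in> F ` D \<longleftrightarrow> x \<in> D" for x
  proof -
    have "F' x \<in> F ` D \<longleftrightarrow> F (inv F (F' x)) \<in> F ` D"
      using permutes_inverses[OF F] by simp
    also have "\<dots> \<longleftrightarrow> inv F (F' x) \<in> D" by (rule img)
    also have "\<dots> \<longleftrightarrow> x \<in> D"
      using eq permutes_inverses[OF F] permutes_inj[OF F'] by (metis injD)
    finally show ?thesis .
  qed
  define c where "c = F d"
  define c' where "c' = F' d'"
  obtain b where b: "b \<in> D" "F b = c'" using img'[of d'] q'(2) c'_def by auto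
  have cI: "c \<in> {1..n}" "c' \<in> {1..n}"
    using d permutes_in_image[OF F] permutes_in_image[OF F'] c_def c'_def by auto
  define q1 where "q1 = q * mv c c'"
  define F1 where "F1 = sw c c' \<circ> F"
  have q1: "path {1..n} d F1 q1"
    using path.step[OF q(1) cI(2)] by (simp only: F1_def q1_def c_def)
  have "e_prod ds * q1 = e_prod ds * q"
  proof (cases "c = c'")
    case True
    then show ?thesis using path_absorb[OF q(1) d(1)] cI c_def by (simp add: q1_def mv_self)
  next
    case False
    have *: "e_prod ds * q * e c = e_prod ds * q" "e_prod ds * q * e c' = e_prod ds * q"
      using e_prod_path_e[OF q(1) d(1), of ds] q b by (auto simp: c_def)
    have "e_prod ds * q * mv c c' = e_prod ds * q * (e c' * mv c c')"
      using * by (simp flip: mult.assoc)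
    also have "\<dots> = e_prod ds * q"
      using * False cI by (simp add: e_mv_cross flip: mult.assoc)
    finally show ?thesis by (simp add: q1_def mult.assoc)
  qed
  have F1: "F1 permutes {1..n}" using path_permutes[OF q1 d(1)] .
  have F1_eq: "F1 a = F' a" if "a \<notin> D" for a
  proof -
    have "F a \<noteq> c" "F a \<noteq> c'" using that img[of a] b img[of d] q(2) by (auto simp: c_def)
    then show ?thesis using eq[OF that] by (simp add: F1_def)
  qed
  \<comment> \<open>F1 and F' agree off D, so p moves only points of D, and it takes the starting
    hole d' to d. A walk for p followed by q1 therefore has the same start and the same permutation
    as q'.\<close>
  define p where "p = inv F1 \<circ> F'"
  have pd: "p d' = d"
    using permutes_inverses[OF F1] by (metis F1_def c'_def c_def comp_apply p_def transpose_apply_first)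
  have "p permutes D"
  proof (rule permutes_superset)
    show "p permutes {1..n}" unfolding p_def using F1 F' by (intro permutes_compose permutes_inv)
    show "p x = x" if "x \<in> {1..n} - D" for x
      using F1_eq[of x] that permutes_inverses[OF F1] by (metis DiffD2 comp_apply p_def)
  qed
  then obtain r where r: "path D d' p r" using path_exists q q' by blast
  have "path {1..n} d' (F1 \<circ> p) (r * q1)"
    using path_comp[of "{1..n}" p d' F1 q1 r] q1 path_mono[OF r] q(3) pd d by auto
  moreover have "F1 \<circ> p = F'"
    using permutes_inverses[OF F1] by (auto simp: p_def fun_eq_iff)
  ultimately have "q' = r * q1" using path_unique q'(1) d by auto
  then have "e_prod ds * q' = e_prod ds * q1"
    using e_prod_path_absorb[OF r] q q' by (simp flip: mult.assoc)
  then show ?thesis using q(5) q'(4) ds \<open>e_prod ds * q1 = _\<close> by simp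
qed

lemma partial_perm_exists:
  assumes "F permutes {1..n}" "D \<subseteq> {1..n}" "D \<noteq> {}"
  shows "\<exists>w. partial_perm D F w"
proof -
  obtain d where d: "d \<in> D" using assms(3) by blast
  have "d \<in> {1..n}" using d assms(2) by blast
  then obtain q where "path {1..n} d F q" using path_exists[OF assms(1)] by blast
  moreover obtain ds where "set ds = D" using assms(2) finite_subset finite_list by (metis finite_atLeastAtMost)
  ultimately show ?thesis using d assms(2) unfolding partial_perm_def by blast
qed

text \<open>Any point of D may serve as the starting hole and any enumeration of D as the list. Thus
  the hole about to be moved can be taken to be the one that the walk follows.\<close>

lemma partial_perm_representation:
  assumes "partial_perm D F w" "d \<in> D" "set ds = D"
  shows "\<exists>q. path {1..n} d F q \<and> w = e_prod ds * q"
proof -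
  have D: "D \<subseteq> {1..n}" and F: "F permutes {1..n}"
    using assms partial_perm_subset partial_perm_permutes by auto
  have "d \<in> {1..n}" using assms(2) D by blast
  then obtain q where q: "path {1..n} d F q" using path_exists[OF F] by blast
  then have "partial_perm D F (e_prod ds * q)" using assms D unfolding partial_perm_def by blast
  then show ?thesis using partial_perm_unique assms(1) q by blast
qed

lemma partial_perm_e:
  assumes "partial_perm D F w" "a \<in> {1..n}"
  shows "e a * w = w * e (F a)"
proof -
  obtain ds d q where q: "path {1..n} d F q" "d \<in> D" "D \<subseteq> {1..n}" "set ds = D" "w = e_prod ds * q"
    using assms(1) unfolding partial_perm_def by blast
  show ?thesis using path_e[OF q(1), of a] q assms(2)
    by (auto simp: mult.assoc mult_eq_assoc[OF e_prod_commute])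
qed

lemma partial_perm_insert:
  assumes "partial_perm D F w" "a \<in> {1..n}"
  shows "partial_perm (insert a D) F (e a * w)"
proof -
  obtain ds d q where "path {1..n} d F q" "d \<in> D" "D \<subseteq> {1..n}" "set ds = D" "w = e_prod ds * q"
    using assms(1) unfolding partial_perm_def by blast
  then show ?thesis using assms(2) unfolding partial_perm_def
    by (intro exI[of _ "a # ds"] exI[of _ d] exI[of _ q]) (simp add: mult.assoc)
qed

lemma partial_perm_absorb:
  assumes "partial_perm D F w" "a \<in> D"
  shows "e a * w = w" "w * e (F a) = w"
proof -
  have a: "a \<in> {1..n}" using assms partial_perm_subset by blast
  show "e a * w = w"
    using partial_perm_unique[OF partial_perm_insert[OF assms(1) a]] assms by (simp add: insert_absorb)
  then show "w * e (F a) = w" using partial_perm_e[OF assms(1) a] by simp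
qed

lemma partial_perm_t:
  assumes "partial_perm D F w" "a \<le> n" "b \<le> n" "a \<notin> D" "b \<notin> D"
  shows "t a b * w = w * t (F a) (F b)"
proof -
  obtain ds d q where q: "path {1..n} d F q" "d \<in> D" "D \<subseteq> {1..n}" "set ds = D" "w = e_prod ds * q"
    using assms(1) unfolding partial_perm_def by blast
  then have "t a b * q = q * t (F a) (F b)" using assms by (intro path_t[OF q(1)]) auto
  then show ?thesis using q assms by (simp add: mult.assoc mult_eq_assoc[OF e_prod_t])
qed

text \<open>With j as starting hole, the move from i to j is prepended to the walk. The remaining
  idempotents avoid i and j and commute past the move, so the hole j is exchanged for i.\<close>

lemma partial_perm_mv_left:
  assumes "partial_perm D F w" "j \<in> D" "i \<in> {1..n} - D"
  shows "partial_perm (insert i (D - {j})) (F \<circ> sw i j) (mv i j * w)"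
proof -
  have D: "D \<subseteq> {1..n}" using assms(1) by (rule partial_perm_subset)
  obtain ds where ds: "set ds = D - {j}"
    using D finite_list[of "D - {j}"] finite_subset by (metis finite_Diff finite_atLeastAtMost)
  then obtain q where q: "path {1..n} j F q" "w = e_prod (j # ds) * q"
    using partial_perm_representation[OF assms(1,2), of "j # ds"] assms(2) by auto
  have ij: "i \<in> {1..n}" "j \<in> {1..n}" using D assms by auto
  have "mv i j * e_prod ds = e_prod ds * mv i j"
    unfolding e_prod_def
  proof (rule prod_list_commute)
    fix y assume "y \<in> set (map e ds)"
    then obtain d where d: "y = e d" "d \<in> set ds" by auto
    then have "d \<noteq> i" "d \<noteq> j" "d \<in> {1..n}" using assms ds D by auto
    then show "mv i j * y = y * mv i j" using e_mv_conj[OF ij, of d] d by simp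
  qed
  then have "mv i j * w = e_prod ds * (e i * mv i j) * q"
    using q(2) ij by (simp add: e_mv mult_eq_assoc[OF mv_e] mult.assoc mult_eq_assoc[of "mv i j" "e_prod ds"])
  then have "mv i j * w = e_prod (ds @ [i]) * (mv i j * q)" by (simp add: mult.assoc)
  moreover have "path {1..n} i (F \<circ> sw i j) (mv i j * q)"
    using path_comp[of "{1..n}" "sw i j" i F q "mv i j"] q(1) path_single[OF ij] ij by simp
  moreover have "set (ds @ [i]) = insert i (D - {j})" using ds by simp
  ultimately show ?thesis unfolding partial_perm_def using ij D by blast
qed

lemma partial_perm_mv_right:
  assumes "partial_perm D F w" "b \<in> D" "k \<in> {1..n}"
  shows "partial_perm D (sw (F b) k \<circ> F) (w * mv (F b) k)"
proof -
  have D: "D \<subseteq> {1..n}" using assms(1) by (rule partial_perm_subset)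
  obtain ds where ds: "set ds = D" using D finite_list finite_subset by (metis finite_atLeastAtMost)
  then obtain q where q: "path {1..n} b F q" "w = e_prod ds * q"
    using partial_perm_representation[OF assms(1,2)] by blast
  show ?thesis unfolding partial_perm_def
    using path.step[OF q(1) assms(3)] q(2) ds D assms(2) by (metis mult.assoc)
qed

end

section \<open>Normal forms\<close>

definition eqv :: "('a \<times> 'a) list \<Rightarrow> ('a \<times> 'a) set" where
  "eqv ps = (set ps \<union> (set ps)\<inverse>)\<^sup>*"

lemma eqv_refl [simp]: "(a, a) \<in> eqv ps"
  by (simp add: eqv_def)

lemma eqv_member: "(a, b) \<in> set ps \<Longrightarrow> (a, b) \<in> eqv ps"
  by (auto simp: eqv_def)

lemma eqv_sym: "(a, b) \<in> eqv ps \<Longrightarrow> (b, a) \<in> eqv ps"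
  unfolding eqv_def by (rule symD[OF sym_rtrancl]) (auto intro: symI)

lemma eqv_trans: "(a, b) \<in> eqv ps \<Longrightarrow> (b, c) \<in> eqv ps \<Longrightarrow> (a, c) \<in> eqv ps"
  unfolding eqv_def by (rule rtrancl_trans)

lemma eqv_member_iff: "(a, b) \<in> set ps \<Longrightarrow> (c, a) \<in> eqv ps \<longleftrightarrow> (c, b) \<in> eqv ps"
  by (meson eqv_member eqv_sym eqv_trans)

lemma eqv_in:
  assumes "(a, b) \<in> eqv ps" "set ps \<subseteq> V \<times> V" "a \<in> V"
  shows "b \<in> V"
  using assms(1) unfolding eqv_def by (induction rule: rtrancl_induct) (use assms in auto)

text \<open>Equivalently, X is a union of classes of \<open>eqv ps\<close>.\<close>

definition saturated :: "('a \<times> 'a) list \<Rightarrow> 'a set \<Rightarrow> bool" where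
  "saturated ps X \<longleftrightarrow> (\<forall>(a, b) \<in> set ps. a \<in> X \<longleftrightarrow> b \<in> X)"

lemma saturated_eqv:
  assumes "saturated ps X" "(a, b) \<in> eqv ps"
  shows "a \<in> X \<longleftrightarrow> b \<in> X"
  using assms(2) unfolding eqv_def
  by (induction rule: rtrancl_induct) (use assms(1) in \<open>auto simp: saturated_def\<close>)

context rook_relations
begin

section \<open>Products of joins and the equivalences they generate\<close>

definition t_prod :: "(nat \<times> nat) list \<Rightarrow> 'm" where
  "t_prod ps = prod_list (map (\<lambda>(a, b). t a b) ps)"

lemma t_prod_simps [simp]:
  "t_prod [] = 1" "t_prod ((a, b) # ps) = t a b * t_prod ps"
  "t_prod (ps @ qs) = t_prod ps * t_prod qs"
  by (simp_all add: t_prod_def)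

lemma t_prod_commute:
  "set ps \<subseteq> {..n} \<times> {..n} \<Longrightarrow> a \<le> n \<Longrightarrow> b \<le> n \<Longrightarrow> t a b * t_prod ps = t_prod ps * t a b"
  unfolding t_prod_def by (rule prod_list_commute) (auto intro: t_comm)

lemma t_prod_absorb_member:
  assumes "set ps \<subseteq> {..n} \<times> {..n}" "(a, b) \<in> set ps"
  shows "t_prod ps * t a b = t_prod ps"
  unfolding t_prod_def
proof (rule prod_list_member_absorb)
  show "y * z = z * y" if "y \<in> set (map (\<lambda>(a, b). t a b) ps)" "z \<in> set (map (\<lambda>(a, b). t a b) ps)" for y z
    using that assms(1) by (auto intro!: t_comm)
  show "t a b \<in> set (map (\<lambda>(a, b). t a b) ps)" using assms(2) by force
  show "t a b * t a b = t a b" using assms by (intro t_idem) auto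
qed

text \<open>Absorption travels along a path of edges: a product that absorbs \<open>t a b\<close>
  and \<open>t b c\<close> absorbs \<open>t a b * t b c\<close>, which \<open>t_chain\<close>
  rewrites so that \<open>t c a\<close> is the last factor.\<close>

lemma t_prod_absorb:
  assumes "set ps \<subseteq> {..n} \<times> {..n}" "(a, b) \<in> eqv ps" "a \<le> n"
  shows "t_prod ps * t a b = t_prod ps"
  using assms(2) unfolding eqv_def
proof (induction rule: rtrancl_induct)
  case base
  then show ?case using assms(3) by (simp add: t_refl)
next
  case (step b c)
  have bc: "b \<le> n" "c \<le> n" using step.hyps(2) assms(1) by auto
  have bcT: "t_prod ps * t b c = t_prod ps"
    using step.hyps(2) by (metis UnE converseD t_prod_absorb_member[OF assms(1)] t_sym[OF bc])
  have "t_prod ps = t_prod ps * (t a b * t b c)"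
    using step.IH bcT by (simp flip: mult.assoc)
  also have "t a b * t b c = t b c * t c a" using bc assms(3) by (intro t_chain)
  also have "t_prod ps * (t b c * t c a) = t_prod ps * t c a"
    using bcT by (simp flip: mult.assoc)
  finally have "t_prod ps * t c a = t_prod ps" by (rule sym)
  then show ?case using t_sym[of a c] bc assms(3) by simp
qed

lemma t_prod_cong:
  assumes "set ps \<subseteq> {..n} \<times> {..n}" "set qs \<subseteq> {..n} \<times> {..n}"
    "set ps \<subseteq> eqv qs" "set qs \<subseteq> eqv ps"
  shows "t_prod ps = t_prod qs"
  unfolding t_prod_def
proof (rule prod_list_eqI, goal_cases)
  case (1 x y)
  then show ?case using assms(1,2) by (auto intro!: t_comm)
next
  case (2 y)
  then obtain a b where y: "y = t a b" "(a, b) \<in> set qs" by auto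
  then have "(a, b) \<in> eqv ps" "a \<le> n" using assms by auto
  then show ?case using y(1) t_prod_absorb[OF assms(1)] by (simp add: t_prod_def)
next
  case (3 y)
  then obtain a b where y: "y = t a b" "(a, b) \<in> set ps" by auto
  then have "(a, b) \<in> eqv qs" "a \<le> n" using assms by auto
  then show ?case using y(1) t_prod_absorb[OF assms(2)] by (simp add: t_prod_def)
qed

lemma t_prod_e:
  assumes "set ps \<subseteq> ({..n} - {k}) \<times> ({..n} - {k})" "k \<in> {1..n}"
  shows "e k * t_prod ps = t_prod ps * e k"
  unfolding t_prod_def
proof (rule prod_list_commute)
  fix y assume "y \<in> set (map (\<lambda>(a, b). t a b) ps)"
  then obtain a b where y: "y = t a b" "(a, b) \<in> set ps" by auto
  then have "a \<le> n" "b \<le> n" "k \<noteq> a" "k \<noteq> b" using assms(1) by blast+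
  then show "e k * y = y * e k" using y assms(2) e_t_comm by simp
qed

text \<open>An equivalence has a spanning forest in which k is isolated or a leaf. In that form
  \<open>e k\<close> commutes with all factors but at most one, which prepares multiplication by
  \<open>e k\<close>.\<close>

lemma t_prod_detach:
  assumes "set qs \<subseteq> {..n} \<times> {..n}" "k \<le> n"
  shows "\<exists>qs'. set qs' \<subseteq> ({..n} - {k}) \<times> ({..n} - {k}) \<and>
    (t_prod qs = t_prod qs' \<or> (\<exists>j\<le>n. j \<noteq> k \<and> t_prod qs = t k j * t_prod qs'))"
  using assms(1)
proof (induction qs)
  case Nil
  show ?case by (intro exI[of _ "[]"]) simp
next
  case (Cons p qs)
  obtain a b where p: "p = (a, b)" by force
  then have ab: "a \<le> n" "b \<le> n" using Cons.prems by auto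
  obtain qs' where qs': "set qs' \<subseteq> ({..n} - {k}) \<times> ({..n} - {k})"
    "t_prod qs = t_prod qs' \<or> (\<exists>j\<le>n. j \<noteq> k \<and> t_prod qs = t k j * t_prod qs')"
    using Cons by auto
  have edge: ?case if T: "t a b = t k b'" and b': "b' \<noteq> k" "b' \<le> n" for b'
    using qs'(2)
  proof (elim disjE exE conjE)
    assume "t_prod qs = t_prod qs'"
    then have "t_prod (p # qs) = t k b' * t_prod qs'" using p T by simp
    then show ?thesis using qs' b' by blast
  next
    fix j assume j: "j \<le> n" "j \<noteq> k" "t_prod qs = t k j * t_prod qs'"
    \<comment> \<open>Two edges at k: one is kept, and the other is shifted to the far end j of the
      first, where it no longer meets k.\<close>
    have "t k b' * t k j = t k j * t j b'"
      using t_chain[of b' k j] t_sym[of b' k] assms(2) b' j by simp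
    from mult_eq_assoc[OF this] have "t_prod (p # qs) = t k j * t_prod ((j, b') # qs')"
      using p T j(3) by (simp add: mult.assoc)
    moreover have "set ((j, b') # qs') \<subseteq> ({..n} - {k}) \<times> ({..n} - {k})" using qs' j b' by auto
    ultimately show ?thesis using j by blast
  qed
  consider "a = k" "b = k" | "a = k" "b \<noteq> k" | "a \<noteq> k" "b = k" | "a \<noteq> k" "b \<noteq> k" by blast
  then show ?case
  proof cases
    case 1
    then have "t_prod (p # qs) = t_prod qs" using p ab by (simp add: t_refl)
    then show ?thesis using qs' by auto
  next
    case 2
    then show ?thesis using edge[of b] ab by simp
  next
    case 3
    then show ?thesis using edge[of a] ab t_sym[of a b] by simp
  next
    case 4
    have "set ((a, b) # qs') \<subseteq> ({..n} - {k}) \<times> ({..n} - {k})" using qs' ab 4 by auto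
    moreover have "t_prod (p # qs) = t_prod ((a, b) # qs') \<or>
        (\<exists>j\<le>n. j \<noteq> k \<and> t_prod (p # qs) = t k j * t_prod ((a, b) # qs'))"
      using qs'(2)
    proof (elim disjE exE conjE)
      fix j assume j: "j \<le> n" "j \<noteq> k" "t_prod qs = t k j * t_prod qs'"
      have "t a b * t k j = t k j * t a b" using ab assms(2) j by (intro t_comm)
      from mult_eq_assoc[OF this] have "t_prod (p # qs) = t k j * t_prod ((a, b) # qs')"
        using p j(3) by (simp add: mult.assoc)
      then show ?thesis using j by blast
    qed (simp add: p)
    ultimately show ?thesis by blast
  qed
qed

section \<open>Existence of normal forms\<close>

definition normal_form :: "(nat \<times> nat) list \<Rightarrow> nat set \<Rightarrow> (nat \<Rightarrow> nat) \<Rightarrow> (nat \<times> nat) list \<Rightarrow> 'm \<Rightarrow> bool" where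
  "normal_form ps D F qs z \<longleftrightarrow> set ps \<subseteq> {..n} \<times> {..n} \<and> set qs \<subseteq> {..n} \<times> {..n} \<and>
     (\<exists>w. partial_perm D F w \<and> z = t_prod ps * w * t_prod qs)"

text \<open>The identity is left out because every normal form has at least one hole. Products grow
  on the right only, so closure of normal forms has to be checked for single letters.\<close>

inductive generated :: "'m \<Rightarrow> bool" where
  gen_e: "i \<in> {1..n} \<Longrightarrow> generated (e i)"
| gen_t: "i \<le> n \<Longrightarrow> j \<le> n \<Longrightarrow> i \<noteq> j \<Longrightarrow> generated (t i j)"
| gen_mult_e: "generated z \<Longrightarrow> i \<in> {1..n} \<Longrightarrow> generated (z * e i)"
| gen_mult_t: "generated z \<Longrightarrow> i \<le> n \<Longrightarrow> j \<le> n \<Longrightarrow> i \<noteq> j \<Longrightarrow> generated (z * t i j)"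

lemma generated_mult: "generated y \<Longrightarrow> generated x \<Longrightarrow> generated (x * y)"
  by (induction rule: generated.induct) (auto intro: generated.intros simp flip: mult.assoc)

lemma permutes_le: "F permutes {1..n} \<Longrightarrow> F a \<le> n \<longleftrightarrow> a \<le> n"
  using permutes_subset[of F "{1..n}" "{..n}"] permutes_in_image[of F "{..n}" a] by auto

lemma permutes_zero: "F permutes {1..n} \<Longrightarrow> F 0 = 0"
  by (auto intro: permutes_not_in)

lemma permutes_range: "F permutes {1..n} \<Longrightarrow> F a \<in> {1..n} \<longleftrightarrow> a \<in> {1..n}"
  by (rule permutes_in_image)

text \<open>If \<open>k\<close> is in the range of \<open>w\<close>, then either \<open>j\<close> is free and can replace \<open>k\<close>, or \<open>k\<close> and \<open>j\<close>
  are both used and their join can be copied to the top.\<close>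

lemma partial_perm_free_column:
  assumes w: "partial_perm D F w" and k: "k \<in> {1..n}" and j: "j \<le> n" "j \<noteq> k"
  shows "\<exists>ps D' F' w'. set ps \<subseteq> {..n} \<times> {..n} \<and> partial_perm D' F' w' \<and>
    w * t k j = t_prod ps * w' * t k j \<and> w' * e k = w'"
proof -
  have F: "F permutes {1..n}" using w by (rule partial_perm_permutes)
  define a where "a = inv F k"
  define b where "b = inv F j"
  have Fab: "F a = k" "F b = j" using permutes_inverses[OF F] by (simp_all add: a_def b_def)
  have a: "a \<in> {1..n}" using permutes_range[OF F, of a] k Fab by simp
  have b: "b \<le> n" using permutes_le[OF F, of b] j Fab by simp
  have ab: "a \<noteq> b" using Fab j by auto
  consider "a \<in> D" | "a \<notin> D" "b \<in> D" | "a \<notin> D" "b \<notin> D" by blast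
  then show ?thesis
  proof cases
    case 1
    then show ?thesis using w partial_perm_absorb(2)[OF w 1] Fab
      by (intro exI[of _ "[]"] exI[of _ D] exI[of _ F] exI[of _ w]) simp
  next
    case 2
    have "b \<in> {1..n}" using 2 w partial_perm_subset by blast
    then have jI: "j \<in> {1..n}" using permutes_range[OF F, of b] Fab by simp
    have "w * mv j k * t k j = w * e j * (t k j * e k * t k j)"
      using t_sym[of k j] k j by (simp add: mv_def mult.assoc)
    also have "\<dots> = w * t k j"
      using tet[of k j] k j partial_perm_absorb(2)[OF w 2(2)] Fab by simp
    finally have "w * t k j = t_prod [] * (w * mv j k) * t k j" by simp
    moreover have "partial_perm D (sw j k \<circ> F) (w * mv j k)"
      using partial_perm_mv_right[OF w 2(2) k] Fab by simp
    moreover have "w * mv j k * e k = w * mv j k" using k by (simp add: mult.assoc mv_e)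
    moreover have "set [] \<subseteq> {..n} \<times> {..n}" by simp
    ultimately show ?thesis by blast
  next
    case 3
    have tw: "t a b * w = w * t k j" using partial_perm_t[OF w _ b 3] a Fab by simp
    have "w * t k j = t a b * e a * t a b * w" using tw tet[OF a b ab] by simp
    also have "\<dots> = t_prod [(a, b)] * (e a * w) * t k j" using tw by (simp add: mult.assoc)
    finally have "w * t k j = t_prod [(a, b)] * (e a * w) * t k j" .
    moreover have "partial_perm (insert a D) F (e a * w)" using w a by (rule partial_perm_insert)
    moreover have "e a * w * e k = e a * w"
      using partial_perm_e[OF w a] Fab e_idem[OF k] by (simp add: mult.assoc)
    moreover have "set [(a, b)] \<subseteq> {..n} \<times> {..n}" using a b by simp
    ultimately show ?thesis by blast
  qed
qed

text \<open>First k is made isolated or a leaf on the right. If it is isolated, \<open>e k\<close>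
  reaches the middle and deletes the point sent to k. If k hangs on j, the middle is changed so that
  it absorbs \<open>e k\<close>, and then \<open>ete\<close> removes the edge.\<close>

lemma normal_form_mult_e:
  assumes "normal_form ps D F qs z" "k \<in> {1..n}"
  shows "\<exists>ps' D' F' qs'. normal_form ps' D' F' qs' (z * e k)"
proof -
  obtain w where w: "partial_perm D F w" and z: "z = t_prod ps * w * t_prod qs"
    and ok: "set ps \<subseteq> {..n} \<times> {..n}" "set qs \<subseteq> {..n} \<times> {..n}"
    using assms(1) unfolding normal_form_def by blast
  have F: "F permutes {1..n}" using w by (rule partial_perm_permutes)
  obtain qs' where qs': "set qs' \<subseteq> ({..n} - {k}) \<times> ({..n} - {k})"
    "t_prod qs = t_prod qs' \<or> (\<exists>j\<le>n. j \<noteq> k \<and> t_prod qs = t k j * t_prod qs')"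
    using t_prod_detach[OF ok(2), of k] assms(2) by auto
  have ok': "set qs' \<subseteq> {..n} \<times> {..n}" using qs'(1) by auto
  have comm: "t_prod qs' * e k = e k * t_prod qs'" using t_prod_e[OF qs'(1) assms(2)] by simp
  from qs'(2) show ?thesis
  proof (elim disjE exE conjE)
    assume eq: "t_prod qs = t_prod qs'"
    define a where "a = inv F k"
    have "F a = k" using permutes_inverses[OF F] by (simp add: a_def)
    then have a: "a \<in> {1..n}" using permutes_range[OF F, of a] assms(2) by simp
    have "z * e k = t_prod ps * (e a * w) * t_prod qs'"
      using partial_perm_e[OF w a] \<open>F a = k\<close> by (simp add: z eq mult.assoc comm)
    then show ?thesis using partial_perm_insert[OF w a] ok ok' unfolding normal_form_def by blast
  next
    fix j assume j: "j \<le> n" "j \<noteq> k" "t_prod qs = t k j * t_prod qs'"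
    obtain ps1 D' F' w' where w': "set ps1 \<subseteq> {..n} \<times> {..n}" "partial_perm D' F' w'"
      "w * t k j = t_prod ps1 * w' * t k j" "w' * e k = w'"
      using partial_perm_free_column[OF w assms(2) j(1,2)] by blast
    have "z * e k = t_prod ps * (w * t k j) * (e k * t_prod qs')"
      by (simp add: z j(3) mult.assoc comm)
    also have "\<dots> = t_prod ps * t_prod ps1 * w' * (e k * t k j * e k) * t_prod qs'"
      using mult_eq_assoc[OF w'(4)] by (simp add: w'(3) mult.assoc)
    also have "\<dots> = t_prod (ps @ ps1) * w' * t_prod qs'"
      using ete[OF assms(2) j(1)] j(2) w'(4) by (simp add: mult.assoc mult_eq_assoc[OF w'(4)])
    finally have "z * e k = t_prod (ps @ ps1) * w' * t_prod qs'" .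
    moreover have "set (ps @ ps1) \<subseteq> {..n} \<times> {..n}" using ok w'(1) by simp
    ultimately show ?thesis using w'(2) ok' unfolding normal_form_def by blast
  qed
qed

lemma normal_form_mult_t:
  assumes "normal_form ps D F qs z" "i \<le> n" "j \<le> n"
  shows "normal_form ps D F (qs @ [(i, j)]) (z * t i j)"
  using assms unfolding normal_form_def by (auto simp: mult.assoc)

lemma normal_form_e: "i \<in> {1..n} \<Longrightarrow> normal_form [] {i} id [] (e i)"
proof -
  assume i: "i \<in> {1..n}"
  then have "partial_perm {i} id (e_prod [i] * e i)"
    unfolding partial_perm_def using path.start[of "{1..n}" i]
    by (intro exI[of _ "[i]"] exI[of _ i] exI[of _ "e i"]) auto
  then show ?thesis unfolding normal_form_def using i by (intro conjI exI[of _ "e i"]) (simp_all add: e_idem)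
qed

lemma generated_normal_form: "generated z \<Longrightarrow> \<exists>ps D F qs. normal_form ps D F qs z"
proof (induction rule: generated.induct)
  case (gen_e i)
  then show ?case using normal_form_e by blast
next
  case (gen_t i j)
  \<comment> \<open>A letter \<open>t i j\<close> shows no hole; \<open>tet\<close> supplies one at
    a non-zero index, and distinct i and j are not both 0.\<close>
  have *: "\<exists>ps D F qs. normal_form ps D F qs (t i j)" if ij: "i \<in> {1..n}" "j \<le> n" "i \<noteq> j" for i j
  proof -
    obtain w where "partial_perm {i} id w" "e i = w"
      using normal_form_e[OF ij(1)] unfolding normal_form_def by auto
    then show ?thesis using tet[OF ij] ij unfolding normal_form_def
      by (intro exI[of _ "[(i, j)]"] exI[of _ "{i}"] exI[of _ id]) auto
  qed
  consider "i \<in> {1..n}" | "j \<in> {1..n}" using gen_t by fastforce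
  then show ?case using *[of i j] *[of j i] gen_t t_sym[of i j] by cases auto
next
  case (gen_mult_e z i)
  then show ?case using normal_form_mult_e by blast
next
  case (gen_mult_t z i j)
  then show ?case using normal_form_mult_t by blast
qed

text \<open>The points compared include 0, which for a normal form lies outside D and is fixed by F.
  So besides separating the used points from one another, the condition keeps them and their values
  out of the classes of 0.\<close>

definition independent :: "(nat \<times> nat) list \<Rightarrow> nat set \<Rightarrow> (nat \<Rightarrow> nat) \<Rightarrow> (nat \<times> nat) list \<Rightarrow> bool" where
  "independent ps D F qs \<longleftrightarrow> (\<forall>a\<in>{..n} - D. \<forall>b\<in>{..n} - D.
     ((a, b) \<in> eqv ps \<longrightarrow> a = b) \<and> ((F a, F b) \<in> eqv qs \<longrightarrow> a = b))"

text \<open>A join of two used points acts on both sides of the middle. If one side already contains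
  it, it can be recorded on the other side too, and then \<open>tet\<close> allows one of the points
  to become a hole. That point is chosen non-zero because there is no \<open>e 0\<close>.\<close>

lemma normal_form_shrink:
  assumes "normal_form ps D F qs z" "\<not> independent ps D F qs"
  shows "\<exists>ps' a qs'. a \<in> {1..n} - D \<and> normal_form ps' (insert a D) F qs' z"
proof -
  obtain w where w: "partial_perm D F w" and z: "z = t_prod ps * w * t_prod qs"
    and ok: "set ps \<subseteq> {..n} \<times> {..n}" "set qs \<subseteq> {..n} \<times> {..n}"
    using assms(1) unfolding normal_form_def by blast
  have F: "F permutes {1..n}" using w by (rule partial_perm_permutes)
  obtain a b where ab: "a \<le> n" "a \<notin> D" "b \<le> n" "b \<notin> D" "a \<noteq> b"
      "(a, b) \<in> eqv ps \<or> (F a, F b) \<in> eqv qs" "a \<noteq> 0"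
  proof -
    obtain a b where ab: "a \<in> {..n} - D" "b \<in> {..n} - D" "a \<noteq> b"
        "(a, b) \<in> eqv ps \<or> (F a, F b) \<in> eqv qs"
      using assms(2) unfolding independent_def by blast
    then have "(b, a) \<in> eqv ps \<or> (F b, F a) \<in> eqv qs" by (blast intro: eqv_sym)
    then show ?thesis using that[of a b] that[of b a] ab by (cases "a = 0") simp_all
  qed
  have a: "a \<in> {1..n}" using ab by simp
  have Fab: "F a \<le> n" "F b \<le> n" using permutes_le[OF F] ab by auto
  have tw: "t a b * w = w * t (F a) (F b)" using partial_perm_t[OF w ab(1,3,2,4)] .
  have tw': "t a b * w = t a b * (e a * w) * t (F a) (F b)"
  proof -
    have "t a b * w = t a b * e a * (t a b * w)" using tet[OF a ab(3,5)] by (simp flip: mult.assoc)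
    then show ?thesis using tw by (simp add: mult.assoc)
  qed
  note ins = partial_perm_insert[OF w a]
  from ab(6) show ?thesis
  proof
    assume "(a, b) \<in> eqv ps"
    then have abs: "t_prod ps * t a b = t_prod ps" using t_prod_absorb[OF ok(1)] ab by simp
    have "z = t_prod ps * (t a b * w) * t_prod qs" using abs by (simp add: z flip: mult.assoc)
    also have "\<dots> = t_prod ps * (e a * w) * t_prod ((F a, F b) # qs)"
      unfolding tw' by (simp add: mult.assoc mult_eq_assoc[OF abs])
    finally show ?thesis using ins ok Fab a ab unfolding normal_form_def
      by (intro exI[of _ ps] exI[of _ a] exI[of _ "(F a, F b) # qs"]) auto
  next
    assume "(F a, F b) \<in> eqv qs"
    then have abs: "t (F a) (F b) * t_prod qs = t_prod qs"
      using t_prod_absorb[OF ok(2)] t_prod_commute[OF ok(2)] Fab by simp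
    have "z = t_prod ps * (t a b * w) * t_prod qs" unfolding tw by (simp add: z abs mult.assoc)
    also have "\<dots> = t_prod (ps @ [(a, b)]) * (e a * w) * t_prod qs"
      unfolding tw' by (simp add: mult.assoc abs)
    finally show ?thesis using ins ok a ab unfolding normal_form_def
      by (intro exI[of _ "ps @ [(a, b)]"] exI[of _ a] exI[of _ qs]) auto
  qed
qed

lemma normal_form_independent:
  assumes "normal_form ps D F qs z"
  shows "\<exists>ps D F qs. normal_form ps D F qs z \<and> independent ps D F qs"
  using assms
proof (induction "card ({1..n} - D)" arbitrary: ps D qs rule: less_induct)
  case less
  show ?case
  proof (cases "independent ps D F qs")
    case True
    then show ?thesis using less.prems by blast
  next
    case False
    obtain ps' a qs' where a: "a \<in> {1..n} - D" "normal_form ps' (insert a D) F qs' z"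
      using normal_form_shrink[OF less.prems False] by blast
    have "{1..n} - insert a D \<subset> {1..n} - D" using a(1) by blast
    then have "card ({1..n} - insert a D) < card ({1..n} - D)"
      by (rule psubset_card_mono[rotated]) simp
    then show ?thesis by (rule less.hyps[OF _ a(2)])
  qed
qed

text \<open>A used point a and a hole a' of the same class are interchangeable representatives:
  \<open>t_prod ps\<close> absorbs \<open>t a a'\<close>, and expanding this factor by
  \<open>tet\<close> exposes the move \<open>mv a a'\<close>.\<close>

lemma normal_form_swap_left:
  assumes "normal_form ps D F qs z" "independent ps D F qs"
    and a: "a \<in> {1..n} - D" and a': "a' \<in> D" and eq: "(a, a') \<in> eqv ps"
  shows "normal_form ps (insert a (D - {a'})) (F \<circ> sw a a') qs z"
    and "independent ps (insert a (D - {a'})) (F \<circ> sw a a') qs"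
proof -
  obtain w where w: "partial_perm D F w" and z: "z = t_prod ps * w * t_prod qs"
    and ok: "set ps \<subseteq> {..n} \<times> {..n}" "set qs \<subseteq> {..n} \<times> {..n}"
    using assms(1) unfolding normal_form_def by blast
  have a'I: "a' \<in> {1..n}" using a' w partial_perm_subset by blast
  have ne: "a \<noteq> a'" using a a' by auto
  have abs: "t_prod ps * t a a' = t_prod ps" using t_prod_absorb[OF ok(1) eq] a by simp
  have "t_prod ps * w = t_prod ps * (t a a' * e a * t a a') * w"
    using tet[of a a'] a a'I ne by (simp add: abs)
  also have "\<dots> = t_prod ps * e a * t a a' * (e a' * w)"
    using partial_perm_absorb(1)[OF w a'] by (simp add: mult.assoc mult_eq_assoc[OF abs])
  also have "\<dots> = t_prod ps * (mv a a' * w)" by (simp add: mv_def mult.assoc)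
  finally have "z = t_prod ps * (mv a a' * w) * t_prod qs" using z by simp
  then show "normal_form ps (insert a (D - {a'})) (F \<circ> sw a a') qs z"
    using partial_perm_mv_left[OF w a' a] ok unfolding normal_form_def by blast
  show "independent ps (insert a (D - {a'})) (F \<circ> sw a a') qs"
    unfolding independent_def
  proof (intro ballI)
    fix x y assume xy: "x \<in> {..n} - insert a (D - {a'})" "y \<in> {..n} - insert a (D - {a'})"
    have dom: "sw a a' v \<in> {..n} - D" if "v \<in> {..n} - insert a (D - {a'})" for v
      using that a ne by (auto simp: Transposition.transpose_def)
    have cls: "(v, sw a a' v) \<in> eqv ps" for v
      using eq eqv_sym[OF eq] by (auto simp: Transposition.transpose_def)
    have "sw a a' x = sw a a' y \<Longrightarrow> x = y" by (metis transpose_involutory)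
    moreover have "(x, y) \<in> eqv ps \<Longrightarrow> (sw a a' x, sw a a' y) \<in> eqv ps"
      using cls eqv_sym eqv_trans by metis
    ultimately show "((x, y) \<in> eqv ps \<longrightarrow> x = y) \<and> (((F \<circ> sw a a') x, (F \<circ> sw a a') y) \<in> eqv qs \<longrightarrow> x = y)"
      using assms(2) dom[OF xy(1)] dom[OF xy(2)] unfolding independent_def by auto
  qed
qed

text \<open>The counterpart on the range: the domain stays, and the value at a is replaced by the
  equivalent value of the hole b.\<close>

lemma normal_form_swap_right:
  assumes "normal_form ps D F qs z" "independent ps D F qs"
    and a: "a \<in> {1..n} - D" and b: "b \<in> D" and eq: "(F b, F a) \<in> eqv qs"
  shows "normal_form ps D (sw (F b) (F a) \<circ> F) qs z"
    and "independent ps D (sw (F b) (F a) \<circ> F) qs"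
proof -
  obtain w where w: "partial_perm D F w" and z: "z = t_prod ps * w * t_prod qs"
    and ok: "set ps \<subseteq> {..n} \<times> {..n}" "set qs \<subseteq> {..n} \<times> {..n}"
    using assms(1) unfolding normal_form_def by blast
  have F: "F permutes {1..n}" using w by (rule partial_perm_permutes)
  have "b \<in> {1..n}" using b w partial_perm_subset by blast
  then have Fb: "F b \<in> {1..n}" using permutes_range[OF F] by blast
  have Fa: "F a \<in> {1..n}" using a permutes_range[OF F] by blast
  have ne: "F a \<noteq> F b" using a b permutes_inj[OF F] by (auto dest: injD)
  have abs: "t (F a) (F b) * t_prod qs = t_prod qs"
    using t_prod_absorb[OF ok(2) eqv_sym[OF eq]] t_prod_commute[OF ok(2)] Fa Fb by simp
  have tt: "t (F a) (F b) * (e (F a) * (t (F a) (F b) * y)) = t (F a) (F b) * y" for y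
    using tet[of "F a" "F b"] Fa Fb ne by (simp flip: mult.assoc)
  have "w * mv (F b) (F a) * t_prod qs = w * e (F b) * t (F a) (F b) * e (F a) * (t (F a) (F b) * t_prod qs)"
    using t_sym[of "F a" "F b"] Fa Fb abs by (simp add: mv_def mult.assoc)
  also have "\<dots> = w * e (F b) * (t (F a) (F b) * t_prod qs)"
    by (simp only: mult.assoc tt)
  also have "\<dots> = w * t_prod qs"
    by (simp only: abs partial_perm_absorb(2)[OF w b])
  finally have "z = t_prod ps * (w * mv (F b) (F a)) * t_prod qs" using z by (simp add: mult.assoc)
  then show "normal_form ps D (sw (F b) (F a) \<circ> F) qs z"
    using partial_perm_mv_right[OF w b Fa] ok unfolding normal_form_def by blast
  show "independent ps D (sw (F b) (F a) \<circ> F) qs"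
    unfolding independent_def
  proof (intro ballI)
    fix x y assume xy: "x \<in> {..n} - D" "y \<in> {..n} - D"
    have cls: "(F v, sw (F b) (F a) (F v)) \<in> eqv qs" for v
      using eq eqv_sym[OF eq] by (auto simp: Transposition.transpose_def)
    have "(sw (F b) (F a) (F x), sw (F b) (F a) (F y)) \<in> eqv qs \<Longrightarrow> (F x, F y) \<in> eqv qs"
      using cls eqv_sym eqv_trans by metis
    then show "((x, y) \<in> eqv ps \<longrightarrow> x = y) \<and>
        (((sw (F b) (F a) \<circ> F) x, (sw (F b) (F a) \<circ> F) y) \<in> eqv qs \<longrightarrow> x = y)"
      using assms(2) xy unfolding independent_def by auto
  qed
qed

end

section \<open>The relation of a normal form determines its value\<close>

definition e_rel :: "nat \<Rightarrow> nat \<Rightarrow> nat set rel" where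
  "e_rel n i = {(X, Y). X \<subseteq> {1..n} \<and> Y \<subseteq> {1..n} \<and> X - {i} = Y - {i}}"

text \<open>Since 0 lies in no subset of 1..n, \<open>t_rel n 0 i\<close> consists of the pairs (X,
  X) with i not in X; this is the relation of the letter o at i.\<close>

definition t_rel :: "nat \<Rightarrow> nat \<Rightarrow> nat \<Rightarrow> nat set rel" where
  "t_rel n i j = {(X, Y). X \<subseteq> {1..n} \<and> Y = X \<and> (i \<in> X \<longleftrightarrow> j \<in> X)}"

text \<open>Points of D, and values of F on D, may be chosen freely: they correspond to singleton
  blocks, in contrast to rook dots, which are forbidden.\<close>

definition perm_rel :: "nat \<Rightarrow> nat set \<Rightarrow> (nat \<Rightarrow> nat) \<Rightarrow> nat set rel" where
  "perm_rel n D F = {(X, Y). X \<subseteq> {1..n} \<and> Y \<subseteq> {1..n} \<and> (\<forall>a\<in>{1..n} - D. a \<in> X \<longleftrightarrow> F a \<in> Y)}"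

definition normal_rel ::
  "nat \<Rightarrow> (nat \<times> nat) list \<Rightarrow> nat set \<Rightarrow> (nat \<Rightarrow> nat) \<Rightarrow> (nat \<times> nat) list \<Rightarrow> nat set rel" where
  "normal_rel n ps D F qs = {(X, Y) \<in> perm_rel n D F. saturated ps X \<and> saturated qs Y}"

lemma e_rel_eq: "e_rel n i = perm_rel n {i} id"
  unfolding e_rel_def perm_rel_def by auto

lemma mv_rel:
  assumes "i \<in> {1..n}" "j \<in> {1..n}" "i \<noteq> j"
  shows "e_rel n i O t_rel n i j O e_rel n j = perm_rel n {i} (sw i j)"
proof (rule equalityI; rule subrelI)
  fix X Y assume "(X, Y) \<in> e_rel n i O t_rel n i j O e_rel n j"
  then obtain Z where Z: "X \<subseteq> {1..n}" "Y \<subseteq> {1..n}" "X - {i} = Z - {i}" "i \<in> Z \<longleftrightarrow> j \<in> Z" "Z - {j} = Y - {j}"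
    by (auto simp: e_rel_def t_rel_def)
  have "a \<in> X \<longleftrightarrow> a \<in> Z" if "a \<noteq> i" for a
    using eqset_imp_iff[OF Z(3), of a] that by simp
  moreover have "a \<in> Z \<longleftrightarrow> a \<in> Y" if "a \<noteq> j" for a
    using eqset_imp_iff[OF Z(5), of a] that by simp
  ultimately have "a \<in> X \<longleftrightarrow> sw i j a \<in> Y" if "a \<noteq> i" for a
    using Z(4) that assms(3) by (cases "a = j") auto
  then show "(X, Y) \<in> perm_rel n {i} (sw i j)" using Z unfolding perm_rel_def by blast
next
  fix X Y assume XY: "(X, Y) \<in> perm_rel n {i} (sw i j)"
  then have sub: "X \<subseteq> {1..n}" "Y \<subseteq> {1..n}" and
    iff: "\<And>a. a \<in> {1..n} \<Longrightarrow> a \<noteq> i \<Longrightarrow> a \<in> X \<longleftrightarrow> sw i j a \<in> Y"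
    unfolding perm_rel_def by auto
  \<comment> \<open>Off j the intermediate set must agree with Y, and at j it must follow i; this
    determines it.\<close>
  define Z where "Z = (if i \<in> Y then insert j Y else Y - {j})"
  have Z: "Z \<subseteq> {1..n}" using sub assms by (auto simp: Z_def)
  have "a \<in> X \<longleftrightarrow> a \<in> Z" if "a \<noteq> i" for a
  proof (cases "a \<in> {1..n}")
    case True
    then show ?thesis using iff[OF True that] that assms(3)
      by (cases "a = j") (auto simp: Z_def)
  qed (use sub Z in blast)
  then have "X - {i} = Z - {i}" by auto
  moreover have "Z - {j} = Y - {j}" by (auto simp: Z_def)
  moreover have "i \<in> Z \<longleftrightarrow> j \<in> Z" using assms(3) by (auto simp: Z_def)
  ultimately have "(X, Z) \<in> e_rel n i" "(Z, Z) \<in> t_rel n i j" "(Z, Y) \<in> e_rel n j"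
    using sub Z by (simp_all add: e_rel_def t_rel_def)
  then show "(X, Y) \<in> e_rel n i O t_rel n i j O e_rel n j" by blast
qed

lemma perm_rel_comp:
  assumes F: "F permutes {1..n}" and D: "D \<subseteq> {1..n}"
  shows "perm_rel n D F O perm_rel n (F ` D) G = perm_rel n D (G \<circ> F)"
proof (rule equalityI; rule subrelI)
  fix X Y assume "(X, Y) \<in> perm_rel n D F O perm_rel n (F ` D) G"
  then obtain Z where "(X, Z) \<in> perm_rel n D F" "(Z, Y) \<in> perm_rel n (F ` D) G" by blast
  then have XY: "X \<subseteq> {1..n}" "Y \<subseteq> {1..n}"
    and 1: "\<And>a. a \<in> {1..n} - D \<Longrightarrow> a \<in> X \<longleftrightarrow> F a \<in> Z"
    and 2: "\<And>a. a \<in> {1..n} - F ` D \<Longrightarrow> a \<in> Z \<longleftrightarrow> G a \<in> Y"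
    unfolding perm_rel_def by auto
  have "a \<in> X \<longleftrightarrow> G (F a) \<in> Y" if a: "a \<in> {1..n} - D" for a
  proof -
    have "F a \<in> {1..n} - F ` D" using a permutes_in_image[OF F] permutes_inj[OF F] by (auto dest: injD)
    then show ?thesis using 1[OF a] 2 by blast
  qed
  then show "(X, Y) \<in> perm_rel n D (G \<circ> F)" using XY unfolding perm_rel_def by simp
next
  fix X Y assume "(X, Y) \<in> perm_rel n D (G \<circ> F)"
  then have XY: "X \<subseteq> {1..n}" "Y \<subseteq> {1..n}"
    and iff: "\<And>a. a \<in> {1..n} - D \<Longrightarrow> a \<in> X \<longleftrightarrow> G (F a) \<in> Y"
    unfolding perm_rel_def by auto
  have FX: "F a \<in> F ` X \<longleftrightarrow> a \<in> X" for a using permutes_inj[OF F] by (auto dest: injD)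
  have sub: "F ` X \<subseteq> {1..n}" using XY(1) permutes_in_image[OF F] by blast
  have "b \<in> F ` X \<longleftrightarrow> G b \<in> Y" if b: "b \<in> {1..n} - F ` D" for b
  proof -
    obtain a where a: "b = F a" using permutes_surj[OF F] by blast
    then have "a \<in> {1..n} - D" using b permutes_in_image[OF F] by auto
    then show ?thesis using iff a FX by simp
  qed
  then have "(F ` X, Y) \<in> perm_rel n (F ` D) G" using XY sub unfolding perm_rel_def by blast
  moreover have "(X, F ` X) \<in> perm_rel n D F" using XY sub FX unfolding perm_rel_def by blast
  ultimately show "(X, Y) \<in> perm_rel n D F O perm_rel n (F ` D) G" by blast
qed

lemma e_rel_perm_rel:
  assumes "a \<in> {1..n}" "F permutes {1..n}"
  shows "e_rel n a O perm_rel n D F = perm_rel n (insert a D) F"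
proof (rule equalityI; rule subrelI)
  fix X Y assume "(X, Y) \<in> e_rel n a O perm_rel n D F"
  then obtain Z where "(X, Z) \<in> e_rel n a" "(Z, Y) \<in> perm_rel n D F" by blast
  then have XY: "X \<subseteq> {1..n}" "Y \<subseteq> {1..n}" "X - {a} = Z - {a}" "\<forall>c\<in>{1..n} - D. c \<in> Z \<longleftrightarrow> F c \<in> Y"
    by (simp_all add: e_rel_def perm_rel_def)
  have "c \<in> X \<longleftrightarrow> F c \<in> Y" if "c \<in> {1..n} - insert a D" for c
    using eqset_imp_iff[OF XY(3), of c] XY(4) that by simp
  then show "(X, Y) \<in> perm_rel n (insert a D) F" using XY by (simp add: perm_rel_def)
next
  fix X Y assume XY: "(X, Y) \<in> perm_rel n (insert a D) F"
  \<comment> \<open>The idempotent may change the entry a at will, so a is put into Z exactly when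
    its image lies in Y.\<close>
  define Z where "Z = (if F a \<in> Y then insert a X else X - {a})"
  have "(X, Z) \<in> e_rel n a" using XY assms(1) unfolding e_rel_def perm_rel_def Z_def by auto
  moreover have "(Z, Y) \<in> perm_rel n D F" using XY assms(1) unfolding perm_rel_def Z_def by auto
  ultimately show "(X, Y) \<in> e_rel n a O perm_rel n D F" by blast
qed

text \<open>Reversal exchanges the two sides, so that statements about ps transfer to qs.\<close>

lemma normal_rel_converse:
  assumes F: "F permutes {1..n}"
  shows "normal_rel n qs (F ` D) (inv F) ps = (normal_rel n ps D F qs)\<inverse>"
proof -
  have "(\<forall>a\<in>{1..n} - D. a \<in> X \<longleftrightarrow> F a \<in> Y) \<longleftrightarrow> (\<forall>b\<in>{1..n} - F ` D. b \<in> Y \<longleftrightarrow> inv F b \<in> X)" for X Y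
  proof -
    have "{1..n} - F ` D = F ` ({1..n} - D)"
      using permutes_inj[OF F] permutes_image[OF F] by (simp add: image_set_diff)
    then show ?thesis using permutes_inverses[OF F] by auto
  qed
  then show ?thesis unfolding normal_rel_def perm_rel_def by auto
qed

locale rook_model = rook_relations n e t
  for n :: nat and e :: "nat \<Rightarrow> 'm::monoid_mult" and t :: "nat \<Rightarrow> nat \<Rightarrow> 'm" +
  fixes sem :: "'m \<Rightarrow> nat set rel"
  assumes sem_one: "sem 1 = Id"
    and sem_mult: "sem (x * y) = sem x O sem y"
    and sem_e: "i \<in> {1..n} \<Longrightarrow> sem (e i) = e_rel n i"
    and sem_t: "i \<le> n \<Longrightarrow> j \<le> n \<Longrightarrow> i \<noteq> j \<Longrightarrow> sem (t i j) = t_rel n i j"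
begin

lemma sem_mv:
  assumes "i \<in> {1..n}" "j \<in> {1..n}"
  shows "sem (mv i j) = perm_rel n {i} (sw i j)"
proof (cases "i = j")
  case True
  then show ?thesis using assms by (simp add: mv_self sem_e e_rel_eq)
next
  case False
  then show ?thesis using assms mv_rel[OF assms False]
    by (simp add: mv_def sem_mult sem_e sem_t O_assoc)
qed

lemma sem_path:
  assumes "path {1..n} d F w" "d \<in> {1..n}"
  shows "sem w = perm_rel n {d} F"
  using assms(1)
proof (induction rule: path.induct)
  case start
  then show ?case using sem_e[OF assms(2)] by (simp add: e_rel_eq id_def)
next
  case (step F w k)
  have F: "F permutes {1..n}" using step.hyps(1) assms(2) by (rule path_permutes)
  then have Fd: "F d \<in> {1..n}" using assms(2) permutes_range by blast
  have "sem (w * mv (F d) k) = perm_rel n {d} F O perm_rel n (F ` {d}) (sw (F d) k)"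
    using sem_mv[OF Fd step.hyps(2)] step.IH by (simp add: sem_mult)
  also have "\<dots> = perm_rel n {d} (sw (F d) k \<circ> F)"
    using perm_rel_comp[OF F, of "{d}"] assms(2) by blast
  finally show ?case by (simp add: comp_def)
qed

lemma sem_partial_perm:
  assumes "partial_perm D F w"
  shows "sem w = perm_rel n D F"
proof -
  obtain ds d q where q: "path {1..n} d F q" "d \<in> D" "D \<subseteq> {1..n}" "set ds = D" "w = e_prod ds * q"
    using assms unfolding partial_perm_def by blast
  have F: "F permutes {1..n}" using assms by (rule partial_perm_permutes)
  have "d \<in> {1..n}" using q by blast
  have "set ds \<subseteq> {1..n} \<Longrightarrow> sem (e_prod ds * q) = perm_rel n (insert d (set ds)) F"
  proof (induction ds)
    case Nil
    then show ?case using sem_path[OF q(1) \<open>d \<in> {1..n}\<close>] by simp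
  next
    case (Cons c ds)
    then show ?case using e_rel_perm_rel[OF _ F, of c] insert_commute[of d c]
      by (simp add: sem_mult sem_e mult.assoc O_assoc)
  qed
  then show ?thesis using q by (simp add: insert_absorb)
qed

lemma sem_t_prod:
  assumes "set ps \<subseteq> {..n} \<times> {..n}" "X \<subseteq> {1..n}"
  shows "(X, Y) \<in> sem (t_prod ps) \<longleftrightarrow> Y = X \<and> saturated ps X"
    and "(Y, X) \<in> sem (t_prod ps) \<longleftrightarrow> Y = X \<and> saturated ps X"
proof -
  have "((X, Y) \<in> sem (t_prod ps) \<longleftrightarrow> Y = X \<and> saturated ps X) \<and>
    ((Y, X) \<in> sem (t_prod ps) \<longleftrightarrow> Y = X \<and> saturated ps X)"
    using assms
  proof (induction ps)
    case Nil
    then show ?case by (auto simp: sem_one saturated_def)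
  next
    case (Cons p ps)
    obtain a b where p: "p = (a, b)" by force
    then have ab: "a \<le> n" "b \<le> n" using Cons.prems by auto
    show ?case
    proof (cases "a = b")
      case True
      then show ?thesis using Cons p ab by (simp add: t_refl saturated_def)
    next
      case False
      then show ?thesis using Cons p sem_t[OF ab False]
        by (auto simp: sem_mult t_rel_def saturated_def relcomp_unfold)
    qed
  qed
  then show "(X, Y) \<in> sem (t_prod ps) \<longleftrightarrow> Y = X \<and> saturated ps X"
    "(Y, X) \<in> sem (t_prod ps) \<longleftrightarrow> Y = X \<and> saturated ps X" by auto
qed

lemma sem_normal_form:
  assumes "normal_form ps D F qs z"
  shows "sem z = normal_rel n ps D F qs"
proof -
  obtain w where w: "partial_perm D F w" and z: "z = t_prod ps * w * t_prod qs"
    and ok: "set ps \<subseteq> {..n} \<times> {..n}" "set qs \<subseteq> {..n} \<times> {..n}"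
    using assms(1) unfolding normal_form_def by blast
  have sub: "(X, Y) \<in> sem w \<Longrightarrow> X \<subseteq> {1..n} \<and> Y \<subseteq> {1..n}" for X Y
    unfolding sem_partial_perm[OF w] perm_rel_def by auto
  have "(X, Y) \<in> sem z \<longleftrightarrow> (X, Y) \<in> sem w \<and> saturated ps X \<and> saturated qs Y" for X Y
  proof
    assume "(X, Y) \<in> sem z"
    then obtain X' Y' where XY: "(X, X') \<in> sem (t_prod ps)" "(X', Y') \<in> sem w" "(Y', Y) \<in> sem (t_prod qs)"
      unfolding z sem_mult by blast
    then show "(X, Y) \<in> sem w \<and> saturated ps X \<and> saturated qs Y"
      using sem_t_prod(2)[OF ok(1), of X' X] sem_t_prod(1)[OF ok(2), of Y' Y] sub[OF XY(2)] by auto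
  next
    assume XY: "(X, Y) \<in> sem w \<and> saturated ps X \<and> saturated qs Y"
    then have "(X, X) \<in> sem (t_prod ps)" "(Y, Y) \<in> sem (t_prod qs)"
      using sem_t_prod(1)[OF ok(1)] sem_t_prod(1)[OF ok(2)] sub by auto
    then show "(X, Y) \<in> sem z" using XY unfolding z sem_mult by blast
  qed
  then show ?thesis unfolding normal_rel_def sem_partial_perm[OF w] by auto
qed

section \<open>Recovering a normal form from its relation\<close>

lemma independent_converse:
  assumes ind: "independent ps D F qs" and F: "F permutes {1..n}"
  shows "independent qs (F ` D) (inv F) ps"
  unfolding independent_def
proof (intro ballI)
  fix x y assume "x \<in> {..n} - F ` D" "y \<in> {..n} - F ` D"
  moreover obtain a b where ab: "x = F a" "y = F b" using permutes_surj[OF F] by (metis surjD)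
  ultimately have "a \<in> {..n} - D" "b \<in> {..n} - D" using permutes_le[OF F] by auto
  then show "((x, y) \<in> eqv qs \<longrightarrow> x = y) \<and> ((inv F x, inv F y) \<in> eqv ps \<longrightarrow> x = y)"
    using ind permutes_inverses[OF F] ab unfolding independent_def by auto
qed

text \<open>The partner of X is the union of the right-hand classes of the values at used points of
  X. Independence ensures that it captures no value of a used point outside X.\<close>

lemma normal_rel_extend:
  assumes ind: "independent ps D F qs" and F: "F permutes {1..n}" and D: "D \<subseteq> {1..n}"
    and ok: "set qs \<subseteq> {..n} \<times> {..n}" and X: "X \<subseteq> {1..n}" "saturated ps X"
  shows "(X, {y. \<exists>x\<in>X - D. (F x, y) \<in> eqv qs}) \<in> normal_rel n ps D F qs"
proof -
  let ?Y = "{y. \<exists>x\<in>X - D. (F x, y) \<in> eqv qs}"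
  have Y: "F a \<in> ?Y \<longleftrightarrow> a \<in> X" if "a \<in> {..n} - D" for a
  proof
    assume "F a \<in> ?Y"
    then obtain x where "x \<in> X - D" "(F x, F a) \<in> eqv qs" by blast
    moreover from this have "x \<in> {..n} - D" using X by auto
    ultimately show "a \<in> X" using ind that unfolding independent_def by blast
  next
    assume "a \<in> X"
    then show "F a \<in> ?Y" using that by (intro CollectI bexI[of _ a]) auto
  qed
  have "?Y \<subseteq> {1..n}"
  proof
    fix y assume y: "y \<in> ?Y"
    then obtain x where x: "x \<in> X" "(F x, y) \<in> eqv qs" by blast
    then have "F x \<in> {..n}" using permutes_le[OF F, of x] X(1) by auto
    then have "y \<le> n" using eqv_in[OF x(2) ok] by simp
    \<comment> \<open>The equivalence \<open>Y\<close> holds at the index 0 as well, which F fixes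
      and X does not contain.\<close>
    moreover have "y \<noteq> 0"
      using Y[of 0] y permutes_zero[OF F] D X(1) by force
    ultimately show "y \<in> {1..n}" by simp
  qed
  moreover have "saturated qs ?Y"
    unfolding saturated_def using eqv_member_iff by fastforce
  ultimately show ?thesis using X Y unfolding normal_rel_def perm_rel_def by auto
qed

lemma eqv_class_saturated: "saturated ps (eqv ps `` {a})"
  unfolding saturated_def using eqv_member_iff by fastforce

lemma eqv_class_subset:
  assumes "set ps \<subseteq> {..n} \<times> {..n}" "a \<le> n" "(a, 0) \<notin> eqv ps"
  shows "eqv ps `` {a} \<subseteq> {1..n}"
proof
  fix x assume "x \<in> eqv ps `` {a}"
  then have x: "(a, x) \<in> eqv ps" by simp
  then have "x \<in> {..n}" using eqv_in[OF x assms(1)] assms(2) by simp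
  moreover have "x \<noteq> 0" using x assms(3) by metis
  ultimately show "x \<in> {1..n}" by simp
qed

lemma eqv_iff_normal_rel:
  assumes ind: "independent ps D F qs" and F: "F permutes {1..n}" and D: "D \<subseteq> {1..n}"
    and ok: "set ps \<subseteq> {..n} \<times> {..n}" "set qs \<subseteq> {..n} \<times> {..n}" and ab: "a \<le> n" "b \<le> n"
  shows "(a, b) \<in> eqv ps \<longleftrightarrow> (\<forall>X Y. (X, Y) \<in> normal_rel n ps D F qs \<longrightarrow> (a \<in> X \<longleftrightarrow> b \<in> X))"
proof
  assume "(a, b) \<in> eqv ps"
  then show "\<forall>X Y. (X, Y) \<in> normal_rel n ps D F qs \<longrightarrow> (a \<in> X \<longleftrightarrow> b \<in> X)"
    by (auto simp: normal_rel_def saturated_eqv)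
next
  assume R: "\<forall>X Y. (X, Y) \<in> normal_rel n ps D F qs \<longrightarrow> (a \<in> X \<longleftrightarrow> b \<in> X)"
  have cls: "b \<in> eqv ps `` {c} \<longleftrightarrow> a \<in> eqv ps `` {c}" if "c \<le> n" "(c, 0) \<notin> eqv ps" for c
    using R normal_rel_extend[OF ind F D ok(2) eqv_class_subset[OF ok(1) that] eqv_class_saturated] by blast
  consider "(a, 0) \<notin> eqv ps" | "(b, 0) \<notin> eqv ps" | "(a, 0) \<in> eqv ps" "(b, 0) \<in> eqv ps" by blast
  then show "(a, b) \<in> eqv ps"
  proof cases
    case 1 then show ?thesis using cls[of a] ab by simp
  next
    case 2 then show ?thesis using cls[of b] ab eqv_sym[of b a ps] by simp
  next
    case 3 then show ?thesis by (rule eqv_trans[OF _ eqv_sym])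
  qed
qed

lemma normal_form_props:
  assumes "normal_form ps D F qs z"
  shows "F permutes {1..n}" "D \<subseteq> {1..n}" "set ps \<subseteq> {..n} \<times> {..n}" "set qs \<subseteq> {..n} \<times> {..n}"
  using assms partial_perm_permutes partial_perm_subset unfolding normal_form_def by blast+

lemma normal_form_eqv:
  assumes "normal_form ps D F qs z" "independent ps D F qs"
    "normal_form ps' D' F' qs' z'" "independent ps' D' F' qs'" "sem z = sem z'"
  shows "set ps \<subseteq> eqv ps'" "set qs \<subseteq> eqv qs'"
proof -
  note p = normal_form_props[OF assms(1)] and p' = normal_form_props[OF assms(3)]
  have R: "normal_rel n ps D F qs = normal_rel n ps' D' F' qs'"
    using assms sem_normal_form by metis
  show "set ps \<subseteq> eqv ps'"
  proof (clarify)
    fix a b assume ab: "(a, b) \<in> set ps"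
    then have "a \<le> n" "b \<le> n" using p by auto
    then show "(a, b) \<in> eqv ps'"
      using eqv_iff_normal_rel[OF assms(2) p] eqv_iff_normal_rel[OF assms(4) p'] R eqv_member[OF ab] by simp
  qed
  have Rc: "normal_rel n qs (F ` D) (inv F) ps = normal_rel n qs' (F' ` D') (inv F') ps'"
    using R by (simp add: normal_rel_converse[OF p(1)] normal_rel_converse[OF p'(1)])
  have q: "inv F permutes {1..n}" "F ` D \<subseteq> {1..n}" "inv F' permutes {1..n}" "F' ` D' \<subseteq> {1..n}"
    using p p' permutes_inv permutes_image by blast+
  show "set qs \<subseteq> eqv qs'"
  proof (clarify)
    fix a b assume ab: "(a, b) \<in> set qs"
    then have "a \<le> n" "b \<le> n" using p by auto
    then show "(a, b) \<in> eqv qs'"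
      using eqv_iff_normal_rel[OF independent_converse[OF assms(2) p(1)] q(1,2) p(4,3)]
        eqv_iff_normal_rel[OF independent_converse[OF assms(4) p'(1)] q(3,4) p'(4,3)]
        Rc eqv_member[OF ab] by simp
  qed
qed

text \<open>The class of a, together with the partner built from the second form, lies in the common
  relation. Read in the first form, this pair puts \<open>F a\<close> into the partner, and the used
  point of the second form responsible for that is a'.\<close>

lemma normal_form_match:
  assumes nf: "normal_form ps D F qs z" and ind: "independent ps D F qs"
    and nf': "normal_form ps D' F' qs z'" and ind': "independent ps D' F' qs"
    and "sem z = sem z'" and a: "a \<in> {1..n} - D"
  obtains a' where "a' \<in> {1..n} - D'" "(a, a') \<in> eqv ps" "(F a, F' a') \<in> eqv qs"
proof -
  note p = normal_form_props[OF nf] and p' = normal_form_props[OF nf']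
  have R: "normal_rel n ps D F qs = normal_rel n ps D' F' qs"
    using assms sem_normal_form by metis
  have "0 \<in> {..n} - D" "a \<in> {..n} - D" "a \<noteq> 0" using p(2) a by auto
  then have "(a, 0) \<notin> eqv ps" using ind unfolding independent_def by blast
  then have X: "eqv ps `` {a} \<subseteq> {1..n}" using eqv_class_subset[OF p(3)] a by simp
  have "(eqv ps `` {a}, {y. \<exists>x\<in>eqv ps `` {a} - D'. (F' x, y) \<in> eqv qs}) \<in> normal_rel n ps D F qs"
    unfolding R using normal_rel_extend[OF ind' p'(1,2,4) X eqv_class_saturated] .
  then have "F a \<in> {y. \<exists>x\<in>eqv ps `` {a} - D'. (F' x, y) \<in> eqv qs}"
    using a unfolding normal_rel_def perm_rel_def by auto
  then obtain x where x: "x \<in> eqv ps `` {a} - D'" "(F' x, F a) \<in> eqv qs" by blast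
  show ?thesis
    by (rule that[OF _ _ eqv_sym[OF x(2)]]) (use x(1) X in auto)
qed

text \<open>A point of D' outside D is used by the first form and matched with a point used by the
  second. By independence the latter is a hole of the first form, so a swap on the left brings D
  closer to D'.\<close>

lemma normal_form_domain:
  assumes "normal_form ps D F qs z" "independent ps D F qs"
    and nf': "normal_form ps D' F' qs z'" and ind': "independent ps D' F' qs" and "sem z = sem z'"
  shows "\<exists>F. normal_form ps D' F qs z \<and> independent ps D' F qs"
  using assms(1,2)
proof (induction "card (D' - D)" arbitrary: D F rule: less_induct)
  case less
  note p = normal_form_props[OF less.prems(1)] and p' = normal_form_props[OF nf']
  show ?case
  proof (cases "D' \<subseteq> D")
    case True
    have "D \<subseteq> D'"
    proof
      fix a assume a: "a \<in> D"
      show "a \<in> D'"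
      proof (rule ccontr)
        assume "a \<notin> D'"
        then have "a \<in> {1..n} - D'" using a p by blast
        then obtain b where b: "b \<in> {1..n} - D" "(a, b) \<in> eqv ps"
          using normal_form_match[OF nf' ind' less.prems assms(5)[symmetric]] by blast
        then have "a \<in> {..n} - D'" "b \<in> {..n} - D'" using \<open>a \<in> {1..n} - D'\<close> True by auto
        then have "a = b" using ind' b(2) unfolding independent_def by blast
        then show False using a b by blast
      qed
    qed
    then have "D = D'" using True by blast
    then show ?thesis using less.prems by blast
  next
    case False
    then obtain a where a: "a \<in> D'" "a \<notin> D" by blast
    then have aD: "a \<in> {1..n} - D" using p' by blast
    then obtain b where b: "b \<in> {1..n} - D'" "(a, b) \<in> eqv ps"
      using normal_form_match[OF less.prems nf' ind' assms(5)] by blast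
    have bD: "b \<in> D"
    proof (rule ccontr)
      assume "b \<notin> D"
      then have "a \<in> {..n} - D" "b \<in> {..n} - D" using aD b by auto
      then have "a = b" using less.prems(2) b(2) unfolding independent_def by blast
      then show False using a b by blast
    qed
    note swap = normal_form_swap_left[OF less.prems aD bD b(2)]
    have "D' - insert a (D - {b}) \<subset> D' - D" using a b by blast
    moreover have "finite (D' - D)" using p' finite_subset by blast
    ultimately have "card (D' - insert a (D - {b})) < card (D' - D)" by (rule psubset_card_mono[rotated])
    then show ?thesis by (rule less.hyps[OF _ swap])
  qed
qed

text \<open>Where F and F' differ at a used point a, the two values lie in one right-hand class, and
  by independence the point b that F sends to \<open>F' a\<close> is a hole. A swap on the right
  corrects the value at a and leaves all other used points alone.\<close>

lemma normal_form_unique_permutation: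
  assumes "normal_form ps D F qs z" "independent ps D F qs"
    and nf': "normal_form ps D F' qs z'" and ind': "independent ps D F' qs" and "sem z = sem z'"
  shows "z = z'"
  using assms(1,2)
proof (induction "card {a \<in> {1..n} - D. F a \<noteq> F' a}" arbitrary: F rule: less_induct)
  case less
  show ?case
  proof (cases "\<exists>a\<in>{1..n} - D. F a \<noteq> F' a")
    case False
    obtain w where w: "partial_perm D F w" "z = t_prod ps * w * t_prod qs"
      using less.prems(1) unfolding normal_form_def by blast
    obtain w' where w': "partial_perm D F' w'" "z' = t_prod ps * w' * t_prod qs"
      using nf' unfolding normal_form_def by blast
    have "w = w'" using False by (intro partial_perm_unique[OF w(1) w'(1)]) blast
    then show ?thesis using w w' by simp
  next
    case True
    then obtain a where a: "a \<in> {1..n} - D" "F a \<noteq> F' a" by blast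
    have F: "F permutes {1..n}" using normal_form_props[OF less.prems(1)] by blast
    have inj: "F x = F y \<Longrightarrow> x = y" for x y using permutes_inj[OF F] by (rule injD)
    obtain a' where a': "a' \<in> {1..n} - D" "(a, a') \<in> eqv ps" "(F a, F' a') \<in> eqv qs"
      using normal_form_match[OF less.prems nf' ind' assms(5) a(1)] by blast
    have "a \<in> {..n} - D" "a' \<in> {..n} - D" using a a' by auto
    then have "a' = a" using a'(2) ind' unfolding independent_def by blast
    then have rel: "(F a, F' a) \<in> eqv qs" using a' by simp
    obtain b where b: "F b = F' a" using permutes_surj[OF F] by (metis surjD)
    have F': "F' permutes {1..n}" using normal_form_props[OF nf'] by blast
    have "F' a \<in> {1..n}" using permutes_range[OF F'] a by blast
    then have bI: "b \<in> {1..n}" using permutes_range[OF F, of b] b by simp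
    have bD: "b \<in> D"
    proof (rule ccontr)
      assume "b \<notin> D"
      then have "a \<in> {..n} - D" "b \<in> {..n} - D" using a bI by auto
      then have "a = b" using less.prems(2) rel b unfolding independent_def by metis
      then show False using a b by simp
    qed
    have "(F b, F a) \<in> eqv qs" using rel b eqv_sym by metis
    note swap = normal_form_swap_right[OF less.prems a(1) bD this]
    let ?G = "sw (F b) (F a) \<circ> F"
    have "?G x = F x" if "x \<notin> D" "x \<noteq> a" for x
      using that bD inj[of x b] inj[of x a] by (auto simp: Transposition.transpose_def)
    moreover have "?G a = F' a" using b by simp
    ultimately have "{x \<in> {1..n} - D. ?G x \<noteq> F' x} \<subseteq> {x \<in> {1..n} - D. F x \<noteq> F' x} - {a}"
      by (smt (verit, best) DiffI DiffD2 mem_Collect_eq singletonD subsetI DiffD1)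
    then have "{x \<in> {1..n} - D. ?G x \<noteq> F' x} \<subset> {x \<in> {1..n} - D. F x \<noteq> F' x}" using a by blast
    then have "card {x \<in> {1..n} - D. ?G x \<noteq> F' x} < card {x \<in> {1..n} - D. F x \<noteq> F' x}"
      by (rule psubset_card_mono[rotated]) simp
    then show ?thesis by (rule less.hyps[OF _ swap])
  qed
qed

theorem sem_inj:
  assumes "generated y" "generated z" "sem y = sem z"
  shows "y = z"
proof -
  obtain ps D F qs where y: "normal_form ps D F qs y" "independent ps D F qs"
    using generated_normal_form[OF assms(1)] normal_form_independent by blast
  obtain ps' D' F' qs' where z: "normal_form ps' D' F' qs' z" "independent ps' D' F' qs'"
    using generated_normal_form[OF assms(2)] normal_form_independent by blast
  note py = normal_form_props[OF y(1)] and pz = normal_form_props[OF z(1)]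
  have ps: "set ps \<subseteq> eqv ps'" "set qs \<subseteq> eqv qs'"
    using normal_form_eqv[OF y z assms(3)] by auto
  have ps': "set ps' \<subseteq> eqv ps" "set qs' \<subseteq> eqv qs"
    using normal_form_eqv[OF z y assms(3)[symmetric]] by auto
  have "t_prod ps' = t_prod ps" "t_prod qs' = t_prod qs"
    using py pz ps ps' by (intro t_prod_cong; simp)+
  then have z': "normal_form ps D' F' qs z" using z(1) py unfolding normal_form_def by simp
  have eqv_mono: "eqv rs \<subseteq> eqv rs'" if "set rs \<subseteq> eqv rs'" for rs rs' :: "(nat \<times> nat) list"
  proof -
    have "set rs \<union> (set rs)\<inverse> \<subseteq> eqv rs'" using that by (auto intro: eqv_sym)
    then have "eqv rs \<subseteq> (eqv rs')\<^sup>*" unfolding eqv_def[of rs] by (rule rtrancl_mono)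
    then show ?thesis by (simp add: eqv_def)
  qed
  have "eqv ps' = eqv ps" "eqv qs' = eqv qs" using eqv_mono ps ps' by blast+
  then have ind: "independent ps D' F' qs" using z(2) unfolding independent_def by simp
  obtain G where "normal_form ps D' G qs y" "independent ps D' G qs"
    using normal_form_domain[OF y z' ind assms(3)] by blast
  then show ?thesis using normal_form_unique_permutation z' ind assms(3) by blast
qed

section \<open>Realising relations by products of letters\<close>

lemma generated_path:
  assumes "path {1..n} d F w" "d \<in> {1..n}"
  shows "generated w"
  using assms(1)
proof (induction rule: path.induct)
  case start
  show ?case using assms(2) by (rule gen_e)
next
  case (step F w k)
  have c: "F d \<in> {1..n}" using path_permutes[OF step.hyps(1) assms(2)] assms(2) permutes_range by blast
  have "generated (mv (F d) k)"
  proof (cases "F d = k")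
    case True
    then show ?thesis using c step.hyps(2) by (simp add: mv_self gen_e)
  next
    case False
    then show ?thesis unfolding mv_def using c step.hyps(2)
      by (intro gen_mult_e gen_mult_t gen_e) auto
  qed
  then show ?case using step.IH generated_mult by blast
qed

lemma normal_rel_realised:
  assumes "F permutes {1..n}" "D \<subseteq> {1..n}" "D \<noteq> {}"
    and ps: "set ps \<subseteq> {..n} \<times> {..n}" and qs: "set qs \<subseteq> {..n} \<times> {..n}"
  shows "\<exists>z. generated z \<and> sem z = normal_rel n ps D F qs"
proof -
  obtain w where w: "partial_perm D F w" using partial_perm_exists[OF assms(1-3)] by blast
  obtain ds d q where q: "path {1..n} d F q" "d \<in> D" "D \<subseteq> {1..n}" "set ds = D" "w = e_prod ds * q"
    using w unfolding partial_perm_def by blast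
  have "generated (e_prod ds * q)" if "set ds \<subseteq> {1..n}" for ds
    using that
  proof (induction ds)
    case Nil
    then show ?case using generated_path[OF q(1)] q by auto
  next
    case (Cons c ds)
    then show ?case by (simp add: mult.assoc generated_mult gen_e)
  qed
  then have "generated w" using q by simp
  moreover have "generated (t_prod ps * v)" if "generated v" for v
    using ps that
  proof (induction ps)
    case (Cons p ps)
    then show ?case by (cases p; cases "fst p = snd p") (auto simp: mult.assoc t_refl intro!: generated_mult gen_t)
  qed simp
  moreover have "generated (v * t_prod qs)" if "generated v" for v
    using qs that
  proof (induction qs arbitrary: v)
    case (Cons p qs)
    obtain a b where p: "p = (a, b)" by force
    have "generated (v * t a b)"
      using Cons.prems p by (cases "a = b") (auto simp: t_refl intro: gen_mult_t)
    then show ?case using Cons.IH[of "v * t a b"] Cons.prems p by (simp add: mult.assoc)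
  qed simp
  ultimately have "generated (t_prod ps * w * t_prod qs)" by blast
  moreover have "normal_form ps D F qs (t_prod ps * w * t_prod qs)"
    using w ps qs unfolding normal_form_def by blast
  ultimately show ?thesis using sem_normal_form by blast
qed

end

section \<open>Rook partitions as relations\<close>

text \<open>The inclusion in the union of the blocks excludes rook dots. This distinguishes a dot,
  which lies in no such set, from a singleton block, which is one.\<close>

definition block_union :: "'a set set \<Rightarrow> 'a set \<Rightarrow> bool" where
  "block_union A S \<longleftrightarrow> S \<subseteq> \<Union>A \<and> (\<forall>C\<in>A. \<forall>x\<in>C. \<forall>y\<in>C. x \<in> S \<longrightarrow> y \<in> S)"

lemma block_unionD:
  "block_union A S \<Longrightarrow> C \<in> A \<Longrightarrow> x \<in> C \<Longrightarrow> x \<in> S \<Longrightarrow> y \<in> C \<Longrightarrow> y \<in> S"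
  by (auto simp: block_union_def)

definition block_rel :: "nat \<Rightarrow> vertex set set \<Rightarrow> nat set rel" where
  "block_rel n A = {(X, Y). X \<subseteq> {1..n} \<and> Y \<subseteq> {1..n} \<and> block_union A (Upper ` X \<union> Lower ` Y)}"

lemma points_iff [simp]:
  "Upper i \<in> points n \<longleftrightarrow> i \<in> {1..n}" "Lower i \<in> points n \<longleftrightarrow> i \<in> {1..n}" "Mid i \<notin> points n"
  by (auto simp: points_def)

lemma rook_partitionsD:
  assumes "A \<in> rook_partitions n"
  shows "C \<in> A \<Longrightarrow> C \<subseteq> points n" "{} \<notin> A"
    "C \<in> A \<Longrightarrow> D \<in> A \<Longrightarrow> x \<in> C \<Longrightarrow> x \<in> D \<Longrightarrow> C = D"
  using assms unfolding rook_partitions_def disjoint_def by blast+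

lemma block_union_iff_block_rel:
  assumes "S \<subseteq> points n"
  shows "block_union A S \<longleftrightarrow> ({i. Upper i \<in> S}, {i. Lower i \<in> S}) \<in> block_rel n A"
proof -
  have "S = Upper ` {i. Upper i \<in> S} \<union> Lower ` {i. Lower i \<in> S}" (is "S = ?T")
  proof (rule set_eqI)
    fix x show "x \<in> S \<longleftrightarrow> x \<in> ?T" using assms by (cases x) auto
  qed
  moreover have "{i. Upper i \<in> S} \<subseteq> {1..n}" "{i. Lower i \<in> S} \<subseteq> {1..n}"
    using assms points_iff by blast+
  ultimately show ?thesis unfolding block_rel_def by simp
qed

text \<open>Blocks are the minimal non-empty unions of blocks: a block C of A is a union of blocks
  of B and contains a block D of B, which in turn is a union of blocks of A meeting C, hence
  contains C.\<close>

lemma block_rel_inj: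
  assumes A: "A \<in> rook_partitions n" and B: "B \<in> rook_partitions n"
    and eq: "block_rel n A = block_rel n B"
  shows "A = B"
proof -
  have *: "A \<subseteq> B" if A: "A \<in> rook_partitions n" and B: "B \<in> rook_partitions n"
    and eq: "block_rel n A = block_rel n B" for A B
  proof
    note RA = rook_partitionsD[OF A] and RB = rook_partitionsD[OF B]
    have iff: "block_union A S \<longleftrightarrow> block_union B S" if "S \<subseteq> points n" for S
      using eq block_union_iff_block_rel[OF that] by metis
    fix C assume C: "C \<in> A"
    have "block_union A C" unfolding block_union_def using C RA(3) by blast
    then have BC: "block_union B C" using iff RA(1) C by blast
    obtain c where c: "c \<in> C" using C RA(2) by (metis ex_in_conv)
    then obtain D where D: "D \<in> B" "c \<in> D" using BC unfolding block_union_def by blast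
    have "D \<subseteq> C" using BC D c unfolding block_union_def by blast
    have "block_union B D" unfolding block_union_def using D RB(3) by blast
    then have "block_union A D" using iff RB(1) D by blast
    then have "C \<subseteq> D" using C c D unfolding block_union_def by blast
    then show "C \<in> B" using \<open>D \<subseteq> C\<close> D by simp
  qed
  show ?thesis using *[OF A B eq] *[OF B A eq[symmetric]] by blast
qed

section \<open>The product as composition of relations\<close>

lemma product_adj_sym: "sym ((product_adj A B)\<^sup>*)"
  by (rule sym_rtrancl) (auto simp: sym_def product_adj_def)

lemma product_dots_class:
  assumes "(x, y) \<in> (product_adj A B)\<^sup>*" "x \<in> points n" "y \<in> points n"
  shows "x \<in> product_dots n A B \<longleftrightarrow> y \<in> product_dots n A B"
  using assms symD[OF product_adj_sym assms(1)] unfolding product_dots_def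
  by (blast intro: rtrancl_trans)

lemma rp_mult_in_rook_partitions: "rp_mult n A B \<in> rook_partitions n"
proof -
  let ?R = "(product_adj A B)\<^sup>*"
  let ?P = "points n - product_dots n A B"
  let ?c = "\<lambda>x. {y \<in> ?P. (x, y) \<in> ?R}"
  have mult: "rp_mult n A B = ?c ` ?P" unfolding rp_mult_def by blast
  have "?c x = ?c x'" if "z \<in> ?c x" "z \<in> ?c x'" for x x' z
    using that symD[OF product_adj_sym] by (blast intro: rtrancl_trans)
  then have "disjoint (?c ` ?P)" unfolding disjoint_def by blast
  moreover have "{} \<notin> ?c ` ?P" by blast
  moreover have "?c ` ?P \<subseteq> Pow (points n)" by blast
  ultimately show ?thesis unfolding rook_partitions_def mult by blast
qed

text \<open>The intermediate set consists of the middle vertices connected to the given outer set.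
  The connected closure T adds no outer point, because the outer set is a union of product blocks,
  and it meets no white vertex, because the outer set contains no dots of the product.\<close>

lemma block_rel_rp_mult_subset:
  assumes A: "A \<in> rook_partitions n" and B: "B \<in> rook_partitions n"
  shows "block_rel n (rp_mult n A B) \<subseteq> block_rel n A O block_rel n B"
proof (rule subrelI)
  note RA = rook_partitionsD[OF A] and RB = rook_partitionsD[OF B]
  let ?R = "(product_adj A B)\<^sup>*"
  fix X Z assume XZ: "(X, Z) \<in> block_rel n (rp_mult n A B)"
  define S where "S = Upper ` X \<union> Lower ` Z"
  have sub: "X \<subseteq> {1..n}" "Z \<subseteq> {1..n}" and S: "block_union (rp_mult n A B) S"
    using XZ by (auto simp: block_rel_def S_def)
  have SP: "s \<in> points n" if "s \<in> S" for s using that sub by (auto simp: S_def)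
  have Sdots: "s \<notin> product_dots n A B" if "s \<in> S" for s
    using S that unfolding block_union_def rp_mult_def by blast
  define T where "T = ?R `` S"
  have ST: "S \<subseteq> T" by (auto simp: T_def)
  have white: "w \<notin> T" if "w \<in> white_vertices n A B" for w
    using that Sdots SP unfolding T_def product_dots_def by blast
  have closed: "y \<in> T" if "x \<in> T" "(x, y) \<in> product_adj A B" for x y
    using that unfolding T_def by (blast intro: rtrancl_into_rtrancl)
  have TP: "p \<in> S" if p: "p \<in> T" "p \<in> points n" for p
  proof -
    obtain s where s: "s \<in> S" "(s, p) \<in> ?R" using p(1) unfolding T_def by blast
    have nd: "p \<notin> product_dots n A B" using product_dots_class[OF s(2) SP[OF s(1)] p(2)] Sdots[OF s(1)] by blast
    let ?C = "{y \<in> points n - product_dots n A B. (s, y) \<in> ?R}"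
    have "?C \<in> rp_mult n A B" using SP[OF s(1)] Sdots[OF s(1)] unfolding rp_mult_def by blast
    moreover have "s \<in> ?C" "p \<in> ?C" using SP[OF s(1)] Sdots[OF s(1)] p s nd by auto
    ultimately show ?thesis using block_unionD[OF S _ _ s(1)] by blast
  qed
  define Y where "Y = {i \<in> {1..n}. Mid i \<in> T}"
  have low: "v \<in> Upper ` X \<union> Lower ` Y \<longleftrightarrow> lower_to_mid v \<in> T" if v: "v \<in> points n" for v
  proof (cases v)
    case (Upper i)
    then have "lower_to_mid v \<in> T \<longleftrightarrow> v \<in> S" using TP[of v] ST v by auto
    then show ?thesis using Upper by (auto simp: S_def)
  qed (use v in \<open>auto simp: Y_def\<close>)
  have up: "v \<in> Upper ` Y \<union> Lower ` Z \<longleftrightarrow> upper_to_mid v \<in> T" if v: "v \<in> points n" for v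
  proof (cases v)
    case (Lower i)
    then have "upper_to_mid v \<in> T \<longleftrightarrow> v \<in> S" using TP[of v] ST v by auto
    then show ?thesis using Lower by (auto simp: S_def)
  qed (use v in \<open>auto simp: Y_def\<close>)
  have Y: "Y \<subseteq> {1..n}" by (auto simp: Y_def)
  have "block_union A (Upper ` X \<union> Lower ` Y)"
    unfolding block_union_def
  proof (intro conjI subsetI ballI impI)
    fix v assume v: "v \<in> Upper ` X \<union> Lower ` Y"
    then have vP: "v \<in> points n" using sub Y by auto
    then have "lower_to_mid v \<notin> white_vertices n A B" using low v white by blast
    then show "v \<in> \<Union>A" using vP unfolding white_vertices_def rook_dots_def by blast
  next
    fix C x y assume C: "C \<in> A" "x \<in> C" "y \<in> C" "x \<in> Upper ` X \<union> Lower ` Y"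
    then have "(lower_to_mid x, lower_to_mid y) \<in> product_adj A B" unfolding product_adj_def by blast
    then show "y \<in> Upper ` X \<union> Lower ` Y" using C low closed RA(1) by blast
  qed
  moreover have "block_union B (Upper ` Y \<union> Lower ` Z)"
    unfolding block_union_def
  proof (intro conjI subsetI ballI impI)
    fix v assume v: "v \<in> Upper ` Y \<union> Lower ` Z"
    then have vP: "v \<in> points n" using sub Y by auto
    then have "upper_to_mid v \<notin> white_vertices n A B" using up v white by blast
    then show "v \<in> \<Union>B" using vP unfolding white_vertices_def rook_dots_def by blast
  next
    fix C x y assume C: "C \<in> B" "x \<in> C" "y \<in> C" "x \<in> Upper ` Y \<union> Lower ` Z"
    then have "(upper_to_mid x, upper_to_mid y) \<in> product_adj A B" unfolding product_adj_def by blast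
    then show "y \<in> Upper ` Y \<union> Lower ` Z" using C up closed RB(1) by blast
  qed
  ultimately show "(X, Z) \<in> block_rel n A O block_rel n B"
    using sub Y unfolding block_rel_def by blast
qed

text \<open>An intermediate set Y glues the two unions of blocks into one set T of vertices that is
  closed under adjacency and free of white vertices, so no path leaves T and none from T reaches a
  white vertex.\<close>

lemma block_rel_rp_mult_supset:
  assumes A: "A \<in> rook_partitions n" and B: "B \<in> rook_partitions n"
  shows "block_rel n A O block_rel n B \<subseteq> block_rel n (rp_mult n A B)"
proof (rule subrelI)
  note RA = rook_partitionsD[OF A] and RB = rook_partitionsD[OF B]
  let ?R = "(product_adj A B)\<^sup>*"
  fix X Z assume "(X, Z) \<in> block_rel n A O block_rel n B"
  then obtain Y where sub: "X \<subseteq> {1..n}" "Y \<subseteq> {1..n}" "Z \<subseteq> {1..n}"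
    and bA: "block_union A (Upper ` X \<union> Lower ` Y)" and bB: "block_union B (Upper ` Y \<union> Lower ` Z)"
    unfolding block_rel_def by blast
  define T where "T = Upper ` X \<union> Mid ` Y \<union> Lower ` Z"
  have low: "v \<in> Upper ` X \<union> Lower ` Y \<longleftrightarrow> lower_to_mid v \<in> T" if "v \<in> points n" for v
    using that by (cases v) (auto simp: T_def)
  have up: "v \<in> Upper ` Y \<union> Lower ` Z \<longleftrightarrow> upper_to_mid v \<in> T" if "v \<in> points n" for v
    using that by (cases v) (auto simp: T_def)
  have step: "y \<in> T" if adj: "(x, y) \<in> product_adj A B" and x: "x \<in> T" for x y
    using adj unfolding product_adj_def
  proof (clarify, elim disjE bexE conjE imageE)
    fix C x' y' assume C: "C \<in> A" "x = lower_to_mid x'" "x' \<in> C" "y = lower_to_mid y'" "y' \<in> C"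
    then have P: "x' \<in> points n" "y' \<in> points n" using RA(1) by blast+
    then have "x' \<in> Upper ` X \<union> Lower ` Y" using low C x by blast
    then have "y' \<in> Upper ` X \<union> Lower ` Y" using bA C unfolding block_union_def by blast
    then show "y \<in> T" using low[OF P(2)] C by blast
  next
    fix C x' y' assume C: "C \<in> B" "x = upper_to_mid x'" "x' \<in> C" "y = upper_to_mid y'" "y' \<in> C"
    then have P: "x' \<in> points n" "y' \<in> points n" using RB(1) by blast+
    then have "x' \<in> Upper ` Y \<union> Lower ` Z" using up C x by blast
    then have "y' \<in> Upper ` Y \<union> Lower ` Z" using bB C unfolding block_union_def by blast
    then show "y \<in> T" using up[OF P(2)] C by blast
  qed
  have reach: "y \<in> T" if "(x, y) \<in> ?R" "x \<in> T" for x y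
    using that by (induction rule: rtrancl_induct) (auto intro: step)
  have white: "w \<notin> T" if w: "w \<in> white_vertices n A B" for w
    using w unfolding white_vertices_def
  proof
    assume "w \<in> lower_to_mid ` rook_dots n A"
    then obtain v where v: "w = lower_to_mid v" "v \<in> points n" "v \<notin> \<Union>A"
      unfolding rook_dots_def by blast
    then have "v \<notin> Upper ` X \<union> Lower ` Y" using bA unfolding block_union_def by blast
    then show ?thesis using low[OF v(2)] v(1) by blast
  next
    assume "w \<in> upper_to_mid ` rook_dots n B"
    then obtain v where v: "w = upper_to_mid v" "v \<in> points n" "v \<notin> \<Union>B"
      unfolding rook_dots_def by blast
    then have "v \<notin> Upper ` Y \<union> Lower ` Z" using bB unfolding block_union_def by blast
    then show ?thesis using up[OF v(2)] v(1) by blast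
  qed
  let ?S = "Upper ` X \<union> Lower ` Z"
  have ST: "v \<in> ?S \<longleftrightarrow> v \<in> T" if "v \<in> points n" for v using that by (cases v) (auto simp: T_def)
  have "block_union (rp_mult n A B) ?S"
    unfolding block_union_def
  proof (intro conjI subsetI ballI impI)
    fix v assume v: "v \<in> ?S"
    then have vP: "v \<in> points n" using sub by auto
    have "v \<notin> product_dots n A B" using ST[OF vP] v reach white unfolding product_dots_def by blast
    then show "v \<in> \<Union>(rp_mult n A B)" using vP unfolding rp_mult_def by blast
  next
    fix C x y assume C: "C \<in> rp_mult n A B" "x \<in> C" "y \<in> C" "x \<in> ?S"
    then obtain c where c: "(c, x) \<in> ?R" "(c, y) \<in> ?R" "x \<in> points n" "y \<in> points n"
      unfolding rp_mult_def by blast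
    then have "(x, y) \<in> ?R" using symD[OF product_adj_sym c(1)] by (blast intro: rtrancl_trans)
    then show "y \<in> ?S" using reach ST c C(4) by blast
  qed
  then show "(X, Z) \<in> block_rel n (rp_mult n A B)" using sub unfolding block_rel_def by blast
qed

lemma block_rel_rp_mult:
  "A \<in> rook_partitions n \<Longrightarrow> B \<in> rook_partitions n \<Longrightarrow>
    block_rel n (rp_mult n A B) = block_rel n A O block_rel n B"
  by (intro equalityI block_rel_rp_mult_subset block_rel_rp_mult_supset)

section \<open>Units and the singular part\<close>

lemma transversal_choice:
  assumes A: "A \<in> rook_partitions n"
  obtains u l where
    "\<forall>C\<in>{C \<in> A. transversal C}. Upper (u C) \<in> C \<and> Lower (l C) \<in> C"
    "inj_on u {C \<in> A. transversal C}" "inj_on l {C \<in> A. transversal C}"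
    "u ` {C \<in> A. transversal C} \<subseteq> {1..n}" "l ` {C \<in> A. transversal C} \<subseteq> {1..n}"
proof -
  note RA = rook_partitionsD[OF A]
  define u where "u C = (SOME i. Upper i \<in> C)" for C
  define l where "l C = (SOME i. Lower i \<in> C)" for C
  have ul: "Upper (u C) \<in> C \<and> Lower (l C) \<in> C" if "transversal C" for C
    using that unfolding transversal_def u_def l_def by (metis someI_ex)
  have "inj_on u {C \<in> A. transversal C}" "inj_on l {C \<in> A. transversal C}"
    by (auto intro!: inj_onI) (metis ul RA(3))+
  moreover have "u C \<in> {1..n}" "l C \<in> {1..n}" if "C \<in> A" "transversal C" for C
    using ul[OF that(2)] RA(1)[OF that(1)] points_iff by blast+
  then have "u ` {C \<in> A. transversal C} \<subseteq> {1..n}" "l ` {C \<in> A. transversal C} \<subseteq> {1..n}"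
    by blast+
  ultimately show ?thesis by (intro that[of u l]) (use ul in blast)+
qed

text \<open>By counting, n transversal blocks use up all upper and all lower points, one of each per
  block. Totality and trivial kernel are the traces of invertibility that a left factor inherits
  from a product.\<close>

lemma unit_block_rel:
  assumes A: "A \<in> rp_units n"
  shows "X \<subseteq> {1..n} \<Longrightarrow> \<exists>Y. (X, Y) \<in> block_rel n A"
    and "(X, {}) \<in> block_rel n A \<Longrightarrow> X = {}"
proof -
  have Arp: "A \<in> rook_partitions n" and card: "card {C \<in> A. transversal C} = n"
    using A by (auto simp: rp_units_def)
  note RA = rook_partitionsD[OF Arp]
  let ?Tr = "{C \<in> A. transversal C}"
  obtain u l where ul: "\<forall>C\<in>?Tr. Upper (u C) \<in> C \<and> Lower (l C) \<in> C"
    "inj_on u ?Tr" "inj_on l ?Tr" "u ` ?Tr \<subseteq> {1..n}" "l ` ?Tr \<subseteq> {1..n}"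
    by (rule transversal_choice[OF Arp]) (rule that)
  have "card (u ` ?Tr) = card {1..n}" "card (l ` ?Tr) = card {1..n}"
    using card_image[OF ul(2)] card_image[OF ul(3)] card by simp_all
  then have surj: "u ` ?Tr = {1..n}" "l ` ?Tr = {1..n}"
    using card_subset_eq[OF finite_atLeastAtMost ul(4)] card_subset_eq[OF finite_atLeastAtMost ul(5)]
    by blast+
  have surj_u: "\<exists>C\<in>?Tr. i = u C" if "i \<in> {1..n}" for i
    using that unfolding surj(1)[symmetric] by (simp only: image_iff)
  have surj_l: "\<exists>C\<in>?Tr. i = l C" if "i \<in> {1..n}" for i
    using that unfolding surj(2)[symmetric] by (simp only: image_iff)
  have upper: "\<exists>C\<in>?Tr. Upper i \<in> C" if "i \<in> {1..n}" for i
    using surj_u[OF that] ul(1) by metis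
  have uniq_u: "i = u C" if C: "C \<in> ?Tr" "Upper i \<in> C" for C i
  proof -
    have "i \<in> {1..n}" using C RA(1)[of C] points_iff(1) by blast
    then obtain C' where "C' \<in> ?Tr" "i = u C'" using surj_u by blast
    then show ?thesis using RA(3)[of C C' "Upper i"] C ul(1) by auto
  qed
  have uniq_l: "i = l C" if C: "C \<in> ?Tr" "Lower i \<in> C" for C i
  proof -
    have "i \<in> {1..n}" using C RA(1)[of C] points_iff(2) by blast
    then obtain C' where "C' \<in> ?Tr" "i = l C'" using surj_l by blast
    then show ?thesis using RA(3)[of C C' "Lower i"] C ul(1) by auto
  qed
  show "X = {}" if "(X, {}) \<in> block_rel n A"
  proof (rule ccontr)
    assume "X \<noteq> {}"
    then obtain i where i: "i \<in> X" by blast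
    have X: "X \<subseteq> {1..n}" "block_union A (Upper ` X \<union> Lower ` {})"
      using that by (simp_all add: block_rel_def)
    then obtain C where C: "C \<in> ?Tr" "Upper i \<in> C" using upper i by blast
    moreover from this have "Lower (l C) \<in> C" using ul(1) by blast
    ultimately have "Lower (l C) \<in> Upper ` X \<union> Lower ` {}"
      using block_unionD[OF X(2), of C "Upper i"] i by blast
    then show False by blast
  qed
  show "\<exists>Y. (X, Y) \<in> block_rel n A" if X: "X \<subseteq> {1..n}"
  proof -
    define Y where "Y = l ` {C \<in> ?Tr. u C \<in> X}"
    let ?S = "Upper ` X \<union> Lower ` Y"
    have Y: "Y \<subseteq> {1..n}" using ul(5) by (auto simp: Y_def)
    have S: "v \<in> ?S \<longleftrightarrow> u C \<in> X" if C: "C \<in> ?Tr" "v \<in> C" for v C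
    proof (cases v)
      case (Upper i)
      then show ?thesis using uniq_u[OF C(1), of i] C by auto
    next
      case (Lower i)
      then have "i = l C" using uniq_l[OF C(1), of i] C by auto
      then show ?thesis using Lower C(1) ul(3) unfolding Y_def inj_on_def by auto
    next
      case (Mid i)
      then show ?thesis using RA(1)[of C] C points_iff(3) by blast
    qed
    have cover: "\<exists>C\<in>?Tr. v \<in> C" if v: "v \<in> points n" for v
    proof (cases v)
      case (Upper i)
      then show ?thesis using upper v by auto
    next
      case (Lower i)
      then obtain C where "C \<in> ?Tr" "i = l C" using v surj_l[of i] by auto
      then show ?thesis using ul(1) Lower by blast
    qed (use v in auto)
    have "block_union A ?S"
      unfolding block_union_def
    proof (intro conjI subsetI ballI impI)
      fix v assume "v \<in> ?S"
      then have "v \<in> points n" using X Y by auto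
      then show "v \<in> \<Union>A" using cover by blast
    next
      fix C x y assume C: "C \<in> A" "x \<in> C" "y \<in> C" "x \<in> ?S"
      then obtain C' where "C' \<in> ?Tr" "x \<in> C'" using cover RA(1) by blast
      then have "C \<in> ?Tr" using RA(3) C by blast
      then show "y \<in> ?S" using S C by blast
    qed
    then show ?thesis using X Y unfolding block_rel_def by blast
  qed
qed

text \<open>A partner for {i} shows that the block of i has no other upper point. Without a lower
  point the block would be the singleton of i, and {i} would lie in the kernel. So each i owns a
  transversal block.\<close>

lemma unit_if_block_rel:
  assumes A: "A \<in> rook_partitions n"
    and total: "\<And>X. X \<subseteq> {1..n} \<Longrightarrow> \<exists>Y. (X, Y) \<in> block_rel n A"
    and kernel: "\<And>X. (X, {}) \<in> block_rel n A \<Longrightarrow> X = {}"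
  shows "A \<in> rp_units n"
proof -
  note RA = rook_partitionsD[OF A]
  have "\<exists>C. C \<in> A \<and> Upper i \<in> C \<and> transversal C \<and> (\<forall>j. Upper j \<in> C \<longrightarrow> j = i)" if i: "i \<in> {1..n}" for i
  proof -
    obtain Y where Y: "({i}, Y) \<in> block_rel n A" using total[of "{i}"] i by blast
    then have bu: "block_union A (Upper ` {i} \<union> Lower ` Y)" by (simp add: block_rel_def)
    then obtain C where C: "C \<in> A" "Upper i \<in> C" unfolding block_union_def by blast
    then have sub: "C \<subseteq> Upper ` {i} \<union> Lower ` Y" using bu unfolding block_union_def by blast
    have "transversal C"
    proof (rule ccontr)
      assume "\<not> transversal C"
      then have "C \<subseteq> Upper ` {i}" using sub C unfolding transversal_def by blast
      then have "C = Upper ` {i}" using C by blast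
      then have "block_union A (Upper ` {i} \<union> Lower ` {})"
        using C RA(3) unfolding block_union_def by blast
      then have "({i}, {}) \<in> block_rel n A" using i by (simp add: block_rel_def)
      then show False using kernel by blast
    qed
    then show ?thesis using C sub by blast
  qed
  then obtain c where c: "\<And>i. i \<in> {1..n} \<Longrightarrow> c i \<in> A \<and> Upper i \<in> c i \<and> transversal (c i) \<and>
      (\<forall>j. Upper j \<in> c i \<longrightarrow> j = i)" by metis
  have "bij_betw c {1..n} {C \<in> A. transversal C}"
  proof (rule bij_betw_imageI)
    show "inj_on c {1..n}" using c by (intro inj_onI) metis
    show "c ` {1..n} = {C \<in> A. transversal C}"
    proof (rule equalityI; rule subsetI)
      fix C assume C: "C \<in> {C \<in> A. transversal C}"
      then obtain j where j: "Upper j \<in> C" unfolding transversal_def by blast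
      then have "j \<in> {1..n}" using RA(1)[of C] C points_iff(1) by blast
      then show "C \<in> c ` {1..n}" using RA(3)[of C "c j" "Upper j"] C j c by blast
    qed (use c in blast)
  qed
  then have "card {C \<in> A. transversal C} = n" using bij_betw_same_card by fastforce
  then show ?thesis using A by (simp add: rp_units_def)
qed

lemma rp_mult_singular:
  assumes A: "A \<in> rook_partitions n" "A \<notin> rp_units n" and B: "B \<in> rook_partitions n"
  shows "rp_mult n A B \<notin> rp_units n"
proof
  assume U: "rp_mult n A B \<in> rp_units n"
  have R: "block_rel n (rp_mult n A B) = block_rel n A O block_rel n B"
    using A(1) B by (rule block_rel_rp_mult)
  \<comment> \<open>Through this pair, kernel elements of A become kernel elements of the
    product.\<close>
  have "({}, {}) \<in> block_rel n B" by (simp add: block_rel_def block_union_def)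
  then have "A \<in> rp_units n"
    using unit_block_rel[OF U] unfolding R by (intro unit_if_block_rel[OF A(1)]) blast+
  then show False using A(2) by blast
qed

text \<open>K is \<open>Upper\<close> or \<open>Lower\<close>. The pairs generate the equivalence
  whose classes on that side are the traces of the blocks, with all rook dots gathered in the class
  of 0.\<close>

definition side_pairs :: "nat \<Rightarrow> (nat \<Rightarrow> vertex) \<Rightarrow> vertex set set \<Rightarrow> (nat \<times> nat) set" where
  "side_pairs n K A = {(a, b) \<in> {1..n} \<times> {1..n}. \<exists>C\<in>A. K a \<in> C \<and> K b \<in> C} \<union>
     {0} \<times> {b \<in> {1..n}. K b \<notin> \<Union>A}"

lemma side_pairs_subset: "side_pairs n K A \<subseteq> {..n} \<times> {..n}"
  by (auto simp: side_pairs_def)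

lemma saturated_side_pairs:
  assumes "set ps = side_pairs n K A" "X \<subseteq> {1..n}"
  shows "saturated ps X \<longleftrightarrow> (\<forall>a\<in>X. K a \<in> \<Union>A) \<and>
    (\<forall>C\<in>A. \<forall>a\<in>{1..n}. \<forall>b\<in>{1..n}. K a \<in> C \<longrightarrow> K b \<in> C \<longrightarrow> a \<in> X \<longrightarrow> b \<in> X)" (is "_ \<longleftrightarrow> ?dots \<and> ?blocks")
proof -
  have zero: "0 \<notin> X" using assms(2) by auto
  have mem: "(a, b) \<in> set ps \<longleftrightarrow>
      a \<in> {1..n} \<and> b \<in> {1..n} \<and> (\<exists>C\<in>A. K a \<in> C \<and> K b \<in> C) \<or> a = 0 \<and> b \<in> {1..n} \<and> K b \<notin> \<Union>A" for a b
    unfolding assms(1) side_pairs_def by simp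
  have sat: "saturated ps X \<longleftrightarrow> (\<forall>a b. (a, b) \<in> set ps \<longrightarrow> (a \<in> X \<longleftrightarrow> b \<in> X))"
    unfolding saturated_def by blast
  show ?thesis
  proof (intro iffI conjI)
    assume S: "saturated ps X"
    show ?dots
    proof (intro ballI, rule ccontr)
      fix a assume a: "a \<in> X" "K a \<notin> \<Union>A"
      then have "(0, a) \<in> set ps" using assms(2) mem by blast
      then show False using S a(1) zero sat by blast
    qed
    show ?blocks
    proof (intro ballI impI)
      fix C a b assume "C \<in> A" "a \<in> {1..n}" "b \<in> {1..n}" "K a \<in> C" "K b \<in> C" "a \<in> X"
      then have "(a, b) \<in> set ps" using mem by blast
      then show "b \<in> X" using S \<open>a \<in> X\<close> sat by blast
    qed
  next
    assume R: "?dots \<and> ?blocks"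
    show "saturated ps X" unfolding sat
    proof (intro allI impI)
      fix a b assume "(a, b) \<in> set ps"
      then consider C where "a \<in> {1..n}" "b \<in> {1..n}" "C \<in> A" "K a \<in> C" "K b \<in> C"
        | "a = 0" "K b \<notin> \<Union>A" using mem by blast
      then show "a \<in> X \<longleftrightarrow> b \<in> X"
      proof cases
        case 1
        then show ?thesis using conjunct2[OF R] by blast
      next
        case 2
        then show ?thesis using conjunct1[OF R] zero by blast
      qed
    qed
  qed
qed

lemma extend_bij_to_permutation:
  assumes "bij_betw f U L" "U \<subseteq> S" "L \<subseteq> S" "finite S"
  shows "\<exists>F. F permutes S \<and> (\<forall>a\<in>U. F a = f a)"
proof -
  have "card U = card L" using assms(1) by (rule bij_betw_same_card)
  moreover have "finite U" "finite L" using assms finite_subset by blast+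
  ultimately have "card (S - U) = card (S - L)"
    using assms by (simp add: card_Diff_subset)
  then obtain h where h: "bij_betw h (S - U) (S - L)"
    using finite_same_card_bij[of "S - U" "S - L"] assms(4) by auto
  let ?k = "\<lambda>a. if a \<in> U then f a else h a"
  have "bij_betw ?k (U \<union> (S - U)) (L \<union> (S - L))"
    using assms(1) h by (intro bij_betw_disjoint_Un) auto
  moreover have "U \<union> (S - U) = S" "L \<union> (S - L) = S" using assms by auto
  ultimately have k: "bij_betw ?k S S" by simp
  define F where "F a = (if a \<in> S then ?k a else a)" for a
  have "bij_betw F S S" using k by (rule bij_betw_cong[THEN iffD1, rotated]) (simp add: F_def)
  then have "F permutes S" by (rule bij_imp_permutes) (simp add: F_def)
  moreover have "F a = f a" if "a \<in> U" for a using that assms(2) by (auto simp: F_def)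
  ultimately show ?thesis by blast
qed

text \<open>Each transversal block contributes one upper and one lower representative, and F carries
  the former to the latter; elsewhere F is an arbitrary completion to a permutation. The upper
  points not chosen form D, which is non-empty because there are fewer than n transversal
  blocks.\<close>

lemma singular_normal_rel:
  assumes A: "A \<in> rook_partitions n" "A \<notin> rp_units n"
  obtains F D ps qs where "F permutes {1..n}" "D \<subseteq> {1..n}" "D \<noteq> {}"
    "set ps \<subseteq> {..n} \<times> {..n}" "set qs \<subseteq> {..n} \<times> {..n}" "block_rel n A = normal_rel n ps D F qs"
proof -
  note RA = rook_partitionsD[OF A(1)]
  let ?Tr = "{C \<in> A. transversal C}"
  obtain u l where ul: "\<forall>C\<in>?Tr. Upper (u C) \<in> C \<and> Lower (l C) \<in> C"
    "inj_on u ?Tr" "inj_on l ?Tr" "u ` ?Tr \<subseteq> {1..n}" "l ` ?Tr \<subseteq> {1..n}"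
    by (rule transversal_choice[OF A(1)]) (rule that)
  have "bij_betw (l \<circ> inv_into ?Tr u) (u ` ?Tr) (l ` ?Tr)"
    using ul(2,3) by (intro bij_betw_trans[of _ _ ?Tr] bij_betw_inv_into inj_on_imp_bij_betw)
  then obtain F where F: "F permutes {1..n}" "\<forall>a\<in>u ` ?Tr. F a = (l \<circ> inv_into ?Tr u) a"
    using extend_bij_to_permutation[OF _ ul(4,5)] by blast
  have Ful: "F (u C) = l C" if "C \<in> ?Tr" for C
    using F(2) that ul(2) by (simp add: inv_into_f_f)
  define D where "D = {1..n} - u ` ?Tr"
  have "D \<noteq> {}"
  proof
    assume "D = {}"
    then have "u ` ?Tr = {1..n}" using ul(4) unfolding D_def by blast
    then have "card ?Tr = n" using card_image[OF ul(2)] by simp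
    then show False using A by (simp add: rp_units_def)
  qed
  have "finite (side_pairs n K A)" for K
    using side_pairs_subset by (rule finite_subset) simp
  then obtain ps qs where ps: "set ps = side_pairs n Upper A" and qs: "set qs = side_pairs n Lower A"
    using finite_list by metis
  have "(X, Y) \<in> block_rel n A \<longleftrightarrow> (X, Y) \<in> normal_rel n ps D F qs" for X Y
  proof (cases "X \<subseteq> {1..n} \<and> Y \<subseteq> {1..n}")
    case False
    then show ?thesis unfolding block_rel_def normal_rel_def perm_rel_def by blast
  next
    case True
    then have X: "X \<subseteq> {1..n}" and Y: "Y \<subseteq> {1..n}" by auto
    let ?S = "Upper ` X \<union> Lower ` Y"
    have mem: "Upper a \<in> ?S \<longleftrightarrow> a \<in> X" "Lower a \<in> ?S \<longleftrightarrow> a \<in> Y" for a by auto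
    have range: "Upper a \<in> C \<Longrightarrow> a \<in> {1..n}" "Lower a \<in> C \<Longrightarrow> a \<in> {1..n}" if "C \<in> A" for a C
      using RA(1)[OF that] points_iff by blast+
    have "block_union A ?S \<longleftrightarrow>
      saturated ps X \<and> saturated qs Y \<and> (\<forall>a\<in>{1..n} - D. a \<in> X \<longleftrightarrow> F a \<in> Y)"
    proof
      assume bu: "block_union A ?S"
      have "Upper a \<in> \<Union>A" if "a \<in> X" for a using bu that unfolding block_union_def by blast
      then have "saturated ps X"
        unfolding saturated_side_pairs[OF ps X] using block_unionD[OF bu] mem by metis
      moreover have "Lower a \<in> \<Union>A" if "a \<in> Y" for a using bu that unfolding block_union_def by blast
      then have "saturated qs Y"
        unfolding saturated_side_pairs[OF qs Y] using block_unionD[OF bu] mem by metis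
      moreover have "a \<in> X \<longleftrightarrow> F a \<in> Y" if "a \<in> {1..n} - D" for a
      proof -
        obtain C where C: "C \<in> ?Tr" "a = u C" using \<open>a \<in> {1..n} - D\<close> unfolding D_def by blast
        then have "C \<in> A" "Upper a \<in> C" "Lower (F a) \<in> C" using ul(1) Ful by auto
        then show ?thesis using block_unionD[OF bu] mem by metis
      qed
      ultimately show "saturated ps X \<and> saturated qs Y \<and> (\<forall>a\<in>{1..n} - D. a \<in> X \<longleftrightarrow> F a \<in> Y)" by blast
    next
      assume R: "saturated ps X \<and> saturated qs Y \<and> (\<forall>a\<in>{1..n} - D. a \<in> X \<longleftrightarrow> F a \<in> Y)"
      have upper: "\<forall>a\<in>X. Upper a \<in> \<Union>A"
        and UU: "\<And>C a b. C \<in> A \<Longrightarrow> Upper a \<in> C \<Longrightarrow> Upper b \<in> C \<Longrightarrow> a \<in> X \<Longrightarrow> b \<in> X"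
        using R range(1) unfolding saturated_side_pairs[OF ps X] by blast+
      have lower: "\<forall>a\<in>Y. Lower a \<in> \<Union>A"
        and LL: "\<And>C a b. C \<in> A \<Longrightarrow> Lower a \<in> C \<Longrightarrow> Lower b \<in> C \<Longrightarrow> a \<in> Y \<Longrightarrow> b \<in> Y"
        using R range(2) unfolding saturated_side_pairs[OF qs Y] by blast+
      have UL: "a \<in> X \<longleftrightarrow> b \<in> Y" if C: "C \<in> A" "Upper a \<in> C" "Lower b \<in> C" for C a b
      proof -
        have T: "C \<in> ?Tr" using C unfolding transversal_def by blast
        then have "u C \<in> {1..n} - D" using ul(4) unfolding D_def by blast
        then have "u C \<in> X \<longleftrightarrow> l C \<in> Y" using R Ful[OF T] by metis
        moreover have "Upper (u C) \<in> C" "Lower (l C) \<in> C" using ul(1) T by auto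
        ultimately show ?thesis using UU[OF C(1)] LL[OF C(1)] C(2,3) by blast
      qed
      show "block_union A ?S"
        unfolding block_union_def
      proof (intro conjI ballI impI)
        show "?S \<subseteq> \<Union>A" using upper lower by blast
        fix C x y assume C: "C \<in> A" "x \<in> C" "y \<in> C" and x: "x \<in> ?S"
        have y: "y \<in> points n" using RA(1) C by blast
        show "y \<in> ?S"
          using x
        proof
          assume "x \<in> Upper ` X"
          then obtain a where "a \<in> X" "Upper a \<in> C" using C by blast
          then show ?thesis using y C UU[of C a] UL[of C a] mem by (cases y) auto
        next
          assume "x \<in> Lower ` Y"
          then obtain a where "a \<in> Y" "Lower a \<in> C" using C by blast
          then show ?thesis using y C LL[of C a] UL[of C _ a] mem by (cases y) auto
        qed
      qed
    qed
    then show ?thesis using X Y unfolding block_rel_def normal_rel_def perm_rel_def by auto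
  qed
  then have "block_rel n A = normal_rel n ps D F qs" by auto
  moreover have "D \<subseteq> {1..n}" unfolding D_def by blast
  ultimately show ?thesis
    using that[OF F(1) _ \<open>D \<noteq> {}\<close>] ps qs side_pairs_subset by metis
qed

section \<open>The relations of the generators\<close>

lemma e_bar_in: "i \<in> {1..n} \<Longrightarrow> e_bar n i \<in> rook_partitions n"
  unfolding rook_partitions_def e_bar_def disjoint_def by auto

lemma t_bar_in: "i \<in> {1..n} \<Longrightarrow> j \<in> {1..n} \<Longrightarrow> t_bar n i j \<in> rook_partitions n"
  unfolding rook_partitions_def t_bar_def disjoint_def by auto

lemma o_bar_in: "o_bar n i \<in> rook_partitions n"
  unfolding rook_partitions_def o_bar_def disjoint_def by auto

lemma ball_setcompr: "(\<forall>C\<in>{f j | j. P j}. Q C) \<longleftrightarrow> (\<forall>j. P j \<longrightarrow> Q (f j))"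
  by blast

lemma Union_columns:
  "v \<in> \<Union>{{Upper j, Lower j} | j. P j} \<longleftrightarrow> (\<exists>j. P j \<and> (v = Upper j \<or> v = Lower j))"
  by blast

lemma ball_singleton: "(\<forall>x\<in>{a}. P x) \<longleftrightarrow> P a"
  by simp

lemma ball_pair: "(\<forall>x\<in>{a, b}. \<forall>y\<in>{a, b}. x \<in> S \<longrightarrow> y \<in> S) \<longleftrightarrow> (a \<in> S \<longleftrightarrow> b \<in> S)"
  by auto

lemma ball_four:
  "(\<forall>x\<in>{a, b, c, d}. \<forall>y\<in>{a, b, c, d}. x \<in> S \<longrightarrow> y \<in> S) \<longleftrightarrow>
    (a \<in> S \<longleftrightarrow> b \<in> S) \<and> (a \<in> S \<longleftrightarrow> c \<in> S) \<and> (a \<in> S \<longleftrightarrow> d \<in> S)"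
  by (cases "a \<in> S"; cases "b \<in> S"; cases "c \<in> S"; cases "d \<in> S") simp_all

lemma block_rel_e_bar:
  assumes "i \<in> {1..n}"
  shows "block_rel n (e_bar n i) = e_rel n i"
proof -
  have "block_union (e_bar n i) (Upper ` X \<union> Lower ` Y) \<longleftrightarrow> X - {i} = Y - {i}"
    if XY: "X \<subseteq> {1..n}" "Y \<subseteq> {1..n}" for X Y
  proof -
    have "Upper ` X \<union> Lower ` Y \<subseteq> \<Union>(e_bar n i)" using XY unfolding e_bar_def subset_iff Union_Un_distrib Un_iff Union_columns by auto
    then have "block_union (e_bar n i) (Upper ` X \<union> Lower ` Y) \<longleftrightarrow>
        (\<forall>j. j \<in> {1..n} - {i} \<longrightarrow> (j \<in> X \<longleftrightarrow> j \<in> Y))"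
      unfolding block_union_def e_bar_def ball_Un ball_setcompr by auto
    then show ?thesis using XY by (auto simp: set_eq_iff)
  qed
  then show ?thesis unfolding block_rel_def e_rel_def by auto
qed

lemma block_rel_t_bar:
  assumes "i \<in> {1..n}" "j \<in> {1..n}"
  shows "block_rel n (t_bar n i j) = t_rel n i j"
proof -
  have "block_union (t_bar n i j) (Upper ` X \<union> Lower ` Y) \<longleftrightarrow> Y = X \<and> (i \<in> X \<longleftrightarrow> j \<in> X)"
    if XY: "X \<subseteq> {1..n}" "Y \<subseteq> {1..n}" for X Y
  proof -
    have mem: "Upper a \<in> Upper ` X \<union> Lower ` Y \<longleftrightarrow> a \<in> X" "Lower a \<in> Upper ` X \<union> Lower ` Y \<longleftrightarrow> a \<in> Y" for a
      by auto
    have "Upper ` X \<union> Lower ` Y \<subseteq> \<Union>(t_bar n i j)" using XY unfolding t_bar_def subset_iff Union_Un_distrib Un_iff Union_columns by auto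
    then have "block_union (t_bar n i j) (Upper ` X \<union> Lower ` Y) \<longleftrightarrow>
        (\<forall>C\<in>t_bar n i j. \<forall>x\<in>C. \<forall>y\<in>C. x \<in> Upper ` X \<union> Lower ` Y \<longrightarrow> y \<in> Upper ` X \<union> Lower ` Y)"
      by (simp only: block_union_def simp_thms)
    also have "\<dots> \<longleftrightarrow>
        (i \<in> X \<longleftrightarrow> j \<in> X) \<and> (i \<in> X \<longleftrightarrow> i \<in> Y) \<and> (i \<in> X \<longleftrightarrow> j \<in> Y) \<and>
        (\<forall>k. k \<in> {1..n} - {i, j} \<longrightarrow> (k \<in> X \<longleftrightarrow> k \<in> Y))"
      by (simp only: t_bar_def ball_Un ball_setcompr ball_singleton ball_pair ball_four mem conj_assoc)
    also have "\<dots> \<longleftrightarrow> Y = X \<and> (i \<in> X \<longleftrightarrow> j \<in> X)"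
    proof
      assume R: "(i \<in> X \<longleftrightarrow> j \<in> X) \<and> (i \<in> X \<longleftrightarrow> i \<in> Y) \<and> (i \<in> X \<longleftrightarrow> j \<in> Y) \<and>
        (\<forall>k. k \<in> {1..n} - {i, j} \<longrightarrow> (k \<in> X \<longleftrightarrow> k \<in> Y))"
      have "k \<in> Y \<longleftrightarrow> k \<in> X" for k
        using R XY by (cases "k = i \<or> k = j"; cases "k \<in> {1..n}") blast+
      then show "Y = X \<and> (i \<in> X \<longleftrightarrow> j \<in> X)" using R by blast
    qed auto
    finally show ?thesis .
  qed
  then show ?thesis unfolding block_rel_def t_rel_def by auto
qed

lemma block_rel_o_bar: "block_rel n (o_bar n i) = t_rel n 0 i"
proof -
  have "block_union (o_bar n i) (Upper ` X \<union> Lower ` Y) \<longleftrightarrow> Y = X \<and> i \<notin> X"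
    if XY: "X \<subseteq> {1..n}" "Y \<subseteq> {1..n}" for X Y
  proof -
    have "Upper ` X \<union> Lower ` Y \<subseteq> \<Union>(o_bar n i) \<longleftrightarrow> i \<notin> X \<and> i \<notin> Y"
      using XY unfolding o_bar_def subset_iff Un_iff Union_columns by auto
    moreover have "(\<forall>C\<in>o_bar n i. \<forall>x\<in>C. \<forall>y\<in>C. x \<in> Upper ` X \<union> Lower ` Y \<longrightarrow> y \<in> Upper ` X \<union> Lower ` Y) \<longleftrightarrow>
        (\<forall>k. k \<in> {1..n} - {i} \<longrightarrow> (k \<in> X \<longleftrightarrow> k \<in> Y))"
      unfolding o_bar_def ball_setcompr by auto
    ultimately have "block_union (o_bar n i) (Upper ` X \<union> Lower ` Y) \<longleftrightarrow>
        (i \<notin> X \<and> i \<notin> Y) \<and> (\<forall>k. k \<in> {1..n} - {i} \<longrightarrow> (k \<in> X \<longleftrightarrow> k \<in> Y))"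
      by (simp only: block_union_def simp_thms)
    also have "\<dots> \<longleftrightarrow> Y = X \<and> i \<notin> X"
    proof
      assume R: "(i \<notin> X \<and> i \<notin> Y) \<and> (\<forall>k. k \<in> {1..n} - {i} \<longrightarrow> (k \<in> X \<longleftrightarrow> k \<in> Y))"
      have "k \<in> Y \<longleftrightarrow> k \<in> X" for k
        using R XY by (cases "k = i"; cases "k \<in> {1..n}") blast+
      then show "Y = X \<and> i \<notin> X" using R by blast
    qed auto
    finally show ?thesis .
  qed
  then show ?thesis unfolding block_rel_def t_rel_def by auto
qed

section \<open>From letters to the uniform relations\<close>

lemma gt_sym: "gt i j = gt j i"
  by (simp add: gt_def min.commute max.commute)

lemma gt_alphabet: "i \<in> {1..n} \<Longrightarrow> j \<in> {1..n} \<Longrightarrow> i \<noteq> j \<Longrightarrow> gt i j \<in> alphabet n"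
  by (auto simp: gt_def alphabet_def min_def max_def)

text \<open>The index \<open>0\<close> stands for a point to which all rook dots are joined: \<open>o\<^sub>i\<close> becomes \<open>t\<^sub>0\<^sub>i\<close>.\<close>

definition rook_t :: "(letter \<Rightarrow> 'm::monoid_mult) \<Rightarrow> nat \<Rightarrow> nat \<Rightarrow> 'm" where
  "rook_t g i j = (if i = j then 1 else if i = 0 then g (gO j) else if j = 0 then g (gO i) else g (gt i j))"

lemma rook_t_simps [simp]:
  "rook_t g i i = 1" "j \<noteq> 0 \<Longrightarrow> rook_t g 0 j = g (gO j)" "i \<noteq> 0 \<Longrightarrow> rook_t g i 0 = g (gO i)"
  "i \<noteq> j \<Longrightarrow> i \<noteq> 0 \<Longrightarrow> j \<noteq> 0 \<Longrightarrow> rook_t g i j = g (gt i j)"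
  by (auto simp: rook_t_def)

text \<open>With one index 0, \<open>t_chain\<close> follows from the absorption relations and
  commutation, and \<open>tet\<close> and \<open>ete\<close> become \<open>oeo\<close> and
  \<open>eoe\<close>. Chains with two equal indices reduce to symmetry and idempotence.\<close>

lemma rook_relations_letters:
  fixes g :: "letter \<Rightarrow> 'm::monoid_mult"
  assumes rel: "\<And>p q. (p, q) \<in> relations n \<Longrightarrow> prod_list (map g p) = prod_list (map g q)"
  shows "rook_relations n (\<lambda>i. g (gE i)) (rook_t g)"
proof -
  let ?e = "\<lambda>i. g (gE i)" and ?o = "\<lambda>i. g (gO i)" and ?s = "\<lambda>i j. g (gt i j)"
  have ss: "?s i j = ?s j i" for i j by (simp add: gt_sym)
  have ee1: "?e i * ?e i = ?e i" if "i \<in> {1..n}" for i using rel[OF ee_idem] that by simp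
  have ee: "?e i * ?e j = ?e j * ?e i" if "i \<in> {1..n}" "j \<in> {1..n}" for i j
    using rel[OF ee_comm, of i j] that by (cases "i = j") auto
  have tt1: "?s i j * ?s i j = ?s i j" if "i \<in> {1..n}" "j \<in> {1..n}" "i \<noteq> j" for i j
    using rel[OF tt_idem, of i j] that by simp
  have tt: "?s i j * ?s k l = ?s k l * ?s i j"
    if "i \<in> {1..n}" "j \<in> {1..n}" "i \<noteq> j" "k \<in> {1..n}" "l \<in> {1..n}" "k \<noteq> l" for i j k l
    using rel[OF tt_comm, of i j k l] that by simp
  have oo1: "?o i * ?o i = ?o i" if "i \<in> {1..n}" for i using rel[OF oo_idem] that by simp
  have oo: "?o i * ?o j = ?o j * ?o i" if "i \<in> {1..n}" "j \<in> {1..n}" for i j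
    using rel[OF oo_comm, of i j] that by (cases "i = j") auto
  have ot: "?o k * ?s i j = ?s i j * ?o k"
    if "i \<in> {1..n}" "j \<in> {1..n}" "i \<noteq> j" "k \<in> {1..n}" for i j k
    using rel[OF to_comm, of i j k] that by simp
  have to: "?s i j * ?o i = ?o i * ?o j" "?s i j * ?o j = ?o i * ?o j"
    if "i \<in> {1..n}" "j \<in> {1..n}" "i \<noteq> j" for i j
    using rel[OF to_absorb1, of i j] rel[OF to_absorb2, of i j] that by simp_all
  have join: "i = j \<or> (\<exists>a\<in>{1..n}. rook_t g i j = ?o a) \<or>
      (\<exists>a\<in>{1..n}. \<exists>b\<in>{1..n}. a \<noteq> b \<and> rook_t g i j = ?s a b)" if "i \<le> n" "j \<le> n" for i j
  proof -
    consider "i = j" | "i = 0" "j \<in> {1..n}" | "j = 0" "i \<in> {1..n}"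
      | "i \<noteq> j" "i \<in> {1..n}" "j \<in> {1..n}" using \<open>i \<le> n\<close> \<open>j \<le> n\<close> by fastforce
    then show ?thesis
    proof cases
      case 4
      then have "rook_t g i j = ?s i j" by simp
      then show ?thesis using 4 by blast
    qed auto
  qed
  have idem: "rook_t g i j * rook_t g i j = rook_t g i j" if "i \<le> n" "j \<le> n" for i j
    using join[OF that] oo1 tt1 by auto
  have comm: "rook_t g i j * rook_t g k l = rook_t g k l * rook_t g i j"
    if "i \<le> n" "j \<le> n" "k \<le> n" "l \<le> n" for i j k l
    using join[OF that(1,2)] join[OF that(3,4)]
    by (elim disjE bexE conjE) (simp_all add: oo tt ot)
  have sym: "rook_t g i j = rook_t g j i" for i j
    by (simp add: rook_t_def gt_sym)
  show ?thesis
  proof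
    show "?e i * ?e i = ?e i" if "i \<in> {1..n}" for i using ee1 that .
    show "?e i * ?e j = ?e j * ?e i" if "i \<in> {1..n}" "j \<in> {1..n}" for i j using ee that .
    show "rook_t g i j = rook_t g j i" for i j by (rule sym)
    show "rook_t g i i = 1" for i by simp
    show "rook_t g i j * rook_t g i j = rook_t g i j" if "i \<le> n" "j \<le> n" for i j using idem that .
    show "rook_t g i j * rook_t g k l = rook_t g k l * rook_t g i j"
      if "i \<le> n" "j \<le> n" "k \<le> n" "l \<le> n" for i j k l using comm that .
    show "rook_t g i j * rook_t g j k = rook_t g j k * rook_t g k i"
      if ijk: "i \<le> n" "j \<le> n" "k \<le> n" for i j k
    proof -
      consider "i = j" | "j = k" | "i = k" | "distinct [i, j, k]" by auto
      then show ?thesis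
      proof cases
        case 1 then show ?thesis using idem[OF ijk(2,3)] by (simp add: sym[of k j])
      next
        case 2 then show ?thesis by (simp add: sym[of k i])
      next
        case 3 then show ?thesis using idem[OF ijk(1,2)] by (simp add: sym[of k j])
      next
        case 4
        consider "i = 0" | "j = 0" | "k = 0" | "i \<in> {1..n}" "j \<in> {1..n}" "k \<in> {1..n}"
          using ijk by fastforce
        then show ?thesis
        proof cases
          case 1
          then have jk: "j \<in> {1..n}" "k \<in> {1..n}" "j \<noteq> k" using ijk 4 by auto
          then show ?thesis using 1 ot[OF jk jk(1)] to[OF jk] by simp
        next
          case 2
          then have ki: "k \<in> {1..n}" "i \<in> {1..n}" "k \<noteq> i" using ijk 4 by auto
          then show ?thesis using 2 ot[OF ki ki(1)] to[OF ki] oo[OF ki(1,2)] by simp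
        next
          case 3
          then have ij: "i \<in> {1..n}" "j \<in> {1..n}" "i \<noteq> j" using ijk 4 by auto
          then show ?thesis using 3 to[OF ij] oo[OF ij(1,2)] by simp
        next
          case 4
          then show ?thesis using rel[OF tt_chain, of i j k] \<open>distinct [i, j, k]\<close> by auto
        qed
      qed
    qed
    show "?e k * rook_t g i j = rook_t g i j * ?e k"
      if ij: "i \<le> n" "j \<le> n" and k: "k \<in> {1..n}" "k \<noteq> i" "k \<noteq> j" for i j k
    proof -
      have o: "?e k * ?o a = ?o a * ?e k" if "a \<in> {1..n}" "a \<noteq> k" for a
        using rel[OF oe_comm, of a k] that k by simp
      have s: "?e k * ?s a b = ?s a b * ?e k" if "a \<in> {1..n}" "b \<in> {1..n}" "a \<noteq> b" "a \<noteq> k" "b \<noteq> k" for a b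
        using rel[OF te_comm, of a b k] that k by simp
      consider "i = j" | "i = 0" "j \<in> {1..n}" | "j = 0" "i \<in> {1..n}"
        | "i \<noteq> j" "i \<in> {1..n}" "j \<in> {1..n}" using ij by fastforce
      then show ?thesis
        by cases (use k(2,3)[symmetric] o s in simp_all)
    qed
    show "rook_t g i j * ?e i * rook_t g i j = rook_t g i j"
      and "?e i * rook_t g i j * ?e i = ?e i"
      if ij: "i \<in> {1..n}" "j \<le> n" "i \<noteq> j" for i j
      using ij rel[OF oeo, of i] rel[OF eoe, of i] rel[OF tet, of i j i] rel[OF ete, of i j i]
      by (cases "j = 0"; simp add: mult.assoc)+
    show "?e k * rook_t g k i * ?e i * rook_t g i j * ?e j * rook_t g j k * ?e k =
        ?e k * rook_t g k j * ?e j * rook_t g j i * ?e i * rook_t g i k * ?e k"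
      if "{i, j, k} \<subseteq> {1..n}" "distinct [i, j, k]" for i j k
      using rel[OF cycle3[OF that]] that by (auto simp: mult.assoc)
    show "?e k * rook_t g k i * ?e i * rook_t g i j * ?e j * rook_t g j l * ?e l * rook_t g l k * ?e k =
        ?e k * rook_t g k l * ?e l * rook_t g l i * ?e i * rook_t g i j * ?e j * rook_t g j k * ?e k"
      if "{i, j, k, l} \<subseteq> {1..n}" "distinct [i, j, k, l]" for i j k l
      using rel[OF cycle4[OF that]] that by (auto simp: mult.assoc)
  qed
qed

section \<open>The relations hold\<close>

primrec word_rel :: "nat \<Rightarrow> letter list \<Rightarrow> nat set rel" where
  "word_rel n [] = Id"
| "word_rel n (x # w) = block_rel n (letter_value n x) O word_rel n w"

lemma block_rel_gE: "i \<in> {1..n} \<Longrightarrow> block_rel n (letter_value n (gE i)) = e_rel n i"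
  by (simp only: letter_value.simps block_rel_e_bar)

lemma t_rel_sym: "t_rel n i j = t_rel n j i"
  by (auto simp: t_rel_def)

lemma block_rel_gt:
  "i \<in> {1..n} \<Longrightarrow> j \<in> {1..n} \<Longrightarrow> block_rel n (letter_value n (gt i j)) = t_rel n i j"
  by (simp only: gt_def letter_value.simps min_def max_def)
    (metis block_rel_t_bar t_rel_sym)

lemma block_rel_gO: "block_rel n (letter_value n (gO i)) = t_rel n 0 i"
  by (simp add: block_rel_o_bar)

lemma e_rel_e_rel: "i \<in> {1..n} \<Longrightarrow> e_rel n i O perm_rel n D id = perm_rel n (insert i D) id"
  by (rule e_rel_perm_rel) (auto simp: permutes_id)

lemma e_rel_idem: "i \<in> {1..n} \<Longrightarrow> e_rel n i O e_rel n i = e_rel n i"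
  using e_rel_e_rel[of i n "{i}"] by (simp add: e_rel_eq)

lemma e_rel_comm: "i \<in> {1..n} \<Longrightarrow> j \<in> {1..n} \<Longrightarrow> e_rel n i O e_rel n j = e_rel n j O e_rel n i"
  using e_rel_e_rel[of i n "{j}"] e_rel_e_rel[of j n "{i}"] by (simp add: e_rel_eq insert_commute)

lemma t_rel_t_rel:
  "t_rel n i j O t_rel n k l = {(X, Y). X \<subseteq> {1..n} \<and> Y = X \<and> (i \<in> X \<longleftrightarrow> j \<in> X) \<and> (k \<in> X \<longleftrightarrow> l \<in> X)}"
  by (auto simp: t_rel_def)

lemma e_rel_t_rel_comm:
  assumes "k \<noteq> i" "k \<noteq> j"
  shows "e_rel n k O t_rel n i j = t_rel n i j O e_rel n k"
proof -
  have e: "X \<subseteq> {1..n} \<and> Y \<subseteq> {1..n} \<and> ((i \<in> X \<longleftrightarrow> j \<in> X) \<longleftrightarrow> (i \<in> Y \<longleftrightarrow> j \<in> Y))"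
    if "(X, Y) \<in> e_rel n k" for X Y
  proof -
    have XY: "X \<subseteq> {1..n}" "Y \<subseteq> {1..n}" "X - {k} = Y - {k}"
      using that by (simp_all add: e_rel_def)
    have "a \<in> X \<longleftrightarrow> a \<in> Y" if "k \<noteq> a" for a
      using eqset_imp_iff[OF XY(3), of a] that by auto
    then show ?thesis using XY assms by simp
  qed
  show ?thesis unfolding t_rel_def using e by (intro equalityI subrelI) blast+
qed

lemma t_rel_e_rel_t_rel:
  assumes "i \<noteq> j"
  shows "t_rel n i j O e_rel n i O t_rel n i j = t_rel n i j"
proof -
  have "X = Y" if "X - {i} = Y - {i}" "i \<in> X \<longleftrightarrow> j \<in> X" "i \<in> Y \<longleftrightarrow> j \<in> Y" for X Y
  proof (rule set_eqI)
    show "x \<in> X \<longleftrightarrow> x \<in> Y" for x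
      using eqset_imp_iff[OF that(1), of x] eqset_imp_iff[OF that(1), of j] that(2,3) assms
      by (cases "x = i") auto
  qed
  then show ?thesis unfolding e_rel_def t_rel_def by (auto simp: relcomp_unfold)
qed

lemma e_rel_t_rel_e_rel:
  assumes "i \<in> {1..n}" "i \<noteq> j"
  shows "e_rel n i O t_rel n i j O e_rel n i = e_rel n i"
proof (rule equalityI; rule subrelI)
  fix X Y assume XY: "(X, Y) \<in> e_rel n i"
  \<comment> \<open>Only the entry i may change, and it is set to agree with j, as the join
    demands.\<close>
  define Z where "Z = (if j \<in> X then insert i X else X - {i})"
  have "(X, Z) \<in> e_rel n i" "(Z, Z) \<in> t_rel n i j" "(Z, Y) \<in> e_rel n i"
    using XY assms by (auto simp: e_rel_def t_rel_def Z_def)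
  then show "(X, Y) \<in> e_rel n i O t_rel n i j O e_rel n i" by blast
qed (auto simp: e_rel_def t_rel_def)

section \<open>The cycle relations as closed walks of the hole\<close>

lemma mv_rel_comp:
  assumes "F permutes {1..n}" "d \<in> {1..n}" "c = F d" "c \<in> {1..n}" "k \<in> {1..n}" "c \<noteq> k"
  shows "perm_rel n {d} F O t_rel n c k O e_rel n k = perm_rel n {d} (sw c k \<circ> F)"
proof -
  have "perm_rel n {d} F = perm_rel n {d} F O e_rel n c"
    using perm_rel_comp[OF assms(1), of "{d}" id] assms(2,3) by (simp add: e_rel_eq)
  then have "perm_rel n {d} F O t_rel n c k O e_rel n k =
      perm_rel n {d} F O perm_rel n {c} (sw c k)"
    using mv_rel[OF assms(4-6)] by (metis O_assoc)
  then show ?thesis using perm_rel_comp[OF assms(1), of "{d}"] assms(2,3) by simp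
qed

text \<open>Both sides of \<open>cycle3\<close> and of \<open>cycle4\<close> are walks of this kind,
  preceded by an idempotent at the start. Their equality then reduces to comparing two products of
  transpositions pointwise.\<close>

fun walk_rel :: "nat \<Rightarrow> nat \<Rightarrow> nat list \<Rightarrow> nat set rel" where
  "walk_rel n c [] = Id"
| "walk_rel n c (k # ks) = t_rel n c k O e_rel n k O walk_rel n k ks"

fun walk_perm :: "nat \<Rightarrow> nat list \<Rightarrow> (nat \<Rightarrow> nat) \<Rightarrow> nat \<Rightarrow> nat" where
  "walk_perm c [] F = F"
| "walk_perm c (k # ks) F = walk_perm k ks (sw c k \<circ> F)"

lemma perm_rel_walk:
  assumes "F permutes {1..n}" "d \<in> {1..n}" "c = F d" "set (c # ks) \<subseteq> {1..n}" "distinct_adj (c # ks)"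
  shows "perm_rel n {d} F O walk_rel n c ks = perm_rel n {d} (walk_perm c ks F)"
  using assms
proof (induction ks arbitrary: c F)
  case (Cons k ks)
  have "perm_rel n {d} F O walk_rel n c (k # ks) = perm_rel n {d} (sw c k \<circ> F) O walk_rel n k ks"
    using mv_rel_comp[of F n d c k] Cons.prems by (simp flip: O_assoc)
  also have "\<dots> = perm_rel n {d} (walk_perm k ks (sw c k \<circ> F))"
    using Cons.prems by (intro Cons.IH permutes_compose permutes_swap_id) auto
  finally show ?case by simp
qed simp

lemma e_rel_walk_cong:
  assumes "set (c # ks) \<subseteq> {1..n}" "distinct_adj (c # ks)" "set (c # ks') \<subseteq> {1..n}" "distinct_adj (c # ks')"
    and "walk_perm c ks id = walk_perm c ks' id"
  shows "e_rel n c O walk_rel n c ks = e_rel n c O walk_rel n c ks'"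
  using perm_rel_walk[of id n c c ks] perm_rel_walk[of id n c c ks'] assms
  by (simp add: e_rel_eq permutes_id)

lemma word_rel_relations: "(p, q) \<in> relations n \<Longrightarrow> word_rel n p = word_rel n q"
proof (induction rule: relations.induct)
  case (tet i j k)
  from \<open>k \<in> {i, j}\<close> consider "k = i" | "k = j" by blast
  then show ?case using tet.hyps(1,2)
    using t_rel_e_rel_t_rel[of i j n] t_rel_e_rel_t_rel[of j i n] t_rel_sym[of n i j]
    by cases (simp_all del: letter_value.simps add: block_rel_gE block_rel_gt)
next
  case (ete i j k)
  from \<open>k \<in> {i, j}\<close> consider "k = i" | "k = j" by blast
  then show ?case using ete.hyps(1,2)
    using e_rel_t_rel_e_rel[of i n j] e_rel_t_rel_e_rel[of j n i] t_rel_sym[of n i j]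
    by cases (simp_all del: letter_value.simps add: block_rel_gE block_rel_gt)
next
  case (cycle3 i j k)
  have "e_rel n k O walk_rel n k [i, j, k] = e_rel n k O walk_rel n k [j, i, k]"
  proof (rule e_rel_walk_cong)
    have ne: "i \<noteq> j" "i \<noteq> k" "j \<noteq> k" using cycle3.hyps(2) by auto
    show "walk_perm k [i, j, k] id = walk_perm k [j, i, k] id"
    proof
      fix x
      consider "x = i" | "x = j" | "x = k" | "x \<notin> {i, j, k}" by blast
      then show "walk_perm k [i, j, k] id x = walk_perm k [j, i, k] id x"
        using ne ne[symmetric] by cases simp_all
    qed
  qed (use cycle3.hyps in auto)
  then show ?case using cycle3
    by (simp del: letter_value.simps add: block_rel_gE block_rel_gt)
next
  case (cycle4 i j k l)
  have "e_rel n k O walk_rel n k [i, j, l, k] = e_rel n k O walk_rel n k [l, i, j, k]"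
  proof (rule e_rel_walk_cong)
    have ne: "i \<noteq> j" "i \<noteq> k" "i \<noteq> l" "j \<noteq> k" "j \<noteq> l" "k \<noteq> l" using cycle4.hyps(2) by auto
    show "walk_perm k [i, j, l, k] id = walk_perm k [l, i, j, k] id"
    proof
      fix x
      consider "x = i" | "x = j" | "x = k" | "x = l" | "x \<notin> {i, j, k, l}" by blast
      then show "walk_perm k [i, j, l, k] id x = walk_perm k [l, i, j, k] id x"
        using ne ne[symmetric] by cases simp_all
    qed
  qed (use cycle4.hyps in auto)
  then show ?case using cycle4
    by (simp del: letter_value.simps add: block_rel_gE block_rel_gt)
next
  case (te_comm i j k)
  then show ?case using e_rel_t_rel_comm[of k i j n]
    by (simp del: letter_value.simps add: block_rel_gE block_rel_gt)
next
  case (oe_comm i j)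
  then show ?case using e_rel_t_rel_comm[of j 0 i n]
    by (simp del: letter_value.simps add: block_rel_gE block_rel_gO)
next
  case (oeo i)
  then show ?case using t_rel_e_rel_t_rel[of i 0 n] t_rel_sym[of n i 0]
    by (simp del: letter_value.simps add: block_rel_gE block_rel_gO)
next
  case (eoe i)
  then show ?case using e_rel_t_rel_e_rel[of i n 0] t_rel_sym[of n i 0]
    by (simp del: letter_value.simps add: block_rel_gE block_rel_gO)
next
  case (ee_comm i j)
  then show ?case using e_rel_comm[of i n j]
    by (simp del: letter_value.simps add: block_rel_gE)
next
  case (tt_chain i j k)
  then show ?case
    by (simp del: letter_value.simps add: block_rel_gt t_rel_t_rel) blast
next
  case (to_comm i j k)
  then show ?case
    by (simp del: letter_value.simps add: block_rel_gt block_rel_gO t_rel_t_rel) blast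
next
  case (to_absorb1 i j)
  then show ?case
    by (simp del: letter_value.simps add: block_rel_gt block_rel_gO t_rel_t_rel) blast
next
  case (to_absorb2 i j)
  then show ?case
    by (simp del: letter_value.simps add: block_rel_gt block_rel_gO t_rel_t_rel) auto
qed (auto simp del: letter_value.simps
    simp: block_rel_gE block_rel_gt block_rel_gO t_rel_t_rel e_rel_idem t_rel_def)

section \<open>Congruences on free semigroups\<close>

lemma free_semigroup_append:
  "u \<in> free_semigroup X \<Longrightarrow> v \<in> free_semigroup X \<Longrightarrow> u @ v \<in> free_semigroup X"
  by (auto simp: free_semigroup_def)

lemma generated_congruence_is_congruence:
  assumes "R \<subseteq> S \<times> S" "\<And>x y. x \<in> S \<Longrightarrow> y \<in> S \<Longrightarrow> m x y \<in> S"
  shows "is_congruence S m (generated_congruence S m R)"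
proof -
  let ?F = "{r. is_congruence S m r \<and> R \<subseteq> r}"
  \<comment> \<open>The family has to be non-empty, since an empty intersection would be
    \<open>UNIV\<close>; the full relation also confines the intersection to S.\<close>
  have top: "S \<times> S \<in> ?F"
    using assms by (auto simp: is_congruence_def equiv_def refl_on_def sym_on_def trans_on_def)
  have F: "equiv S r" "(x, y) \<in> r \<Longrightarrow> z \<in> S \<Longrightarrow> (m z x, m z y) \<in> r \<and> (m x z, m y z) \<in> r"
    if "r \<in> ?F" for r x y z
    using that by (auto simp: is_congruence_def)
  have "equiv S (\<Inter>?F)"
  proof (rule equivI)
    show "\<Inter>?F \<subseteq> S \<times> S" using top by blast
    show "refl_on S (\<Inter>?F)"
      using F(1) by (auto simp: refl_on_def equiv_def)
    show "sym (\<Inter>?F)" using F(1) by (intro symI InterI) (blast dest: equivE symD)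
    show "trans (\<Inter>?F)" using F(1) by (intro transI InterI) (blast dest: equivE transD)
  qed
  moreover have "\<forall>(x, y)\<in>\<Inter>?F. \<forall>z\<in>S. (m z x, m z y) \<in> \<Inter>?F \<and> (m x z, m y z) \<in> \<Inter>?F"
    using F(2) by blast
  ultimately show ?thesis unfolding is_congruence_def generated_congruence_def by blast
qed

lemma generated_congruence_subset: "R \<subseteq> generated_congruence S m R"
  unfolding generated_congruence_def by blast

lemma generated_congruence_least:
  "is_congruence S m r \<Longrightarrow> R \<subseteq> r \<Longrightarrow> generated_congruence S m R \<subseteq> r"
  unfolding generated_congruence_def by blast

lemma relations_free: "relations n \<subseteq> free_semigroup (alphabet n) \<times> free_semigroup (alphabet n)"
proof (rule subrelI)
  have E: "gE i \<in> alphabet n" and O: "gO i \<in> alphabet n" if "i \<in> {1..n}" for i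
    using that by (auto simp: alphabet_def)
  show "(p, q) \<in> free_semigroup (alphabet n) \<times> free_semigroup (alphabet n)" if "(p, q) \<in> relations n" for p q
    using that
    by (induction rule: relations.induct)
      (auto simp: free_semigroup_def intro!: E O gt_alphabet)
qed

section \<open>Evaluation of words\<close>

text \<open>For \<open>e_bar\<close> the kernel is non-trivial, as {i} is paired with the empty set.
  For \<open>t_bar\<close> and \<open>o_bar\<close> totality fails, as {i} has no partner.\<close>

lemma letter_value_in:
  assumes "x \<in> alphabet n"
  shows "letter_value n x \<in> rook_partitions n - rp_units n"
proof -
  consider i where "x = gE i" "i \<in> {1..n}" | i j where "x = gT i j" "i \<in> {1..n}" "j \<in> {1..n}" "i \<noteq> j"
    | i where "x = gO i" "i \<in> {1..n}"
    using assms unfolding alphabet_def by fastforce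
  then show ?thesis
  proof cases
    case (1 i)
    have "({i}, {}) \<in> block_rel n (e_bar n i)" using 1 by (simp add: block_rel_e_bar e_rel_def)
    then have "e_bar n i \<notin> rp_units n" using unit_block_rel(2) by blast
    then show ?thesis using 1 e_bar_in by simp
  next
    case (2 i j)
    have "({i}, Y) \<notin> block_rel n (t_bar n i j)" for Y
      using 2 by (auto simp: block_rel_t_bar t_rel_def)
    then have "t_bar n i j \<notin> rp_units n" using unit_block_rel(1)[of _ n "{i}"] 2(2) by blast
    then show ?thesis using 2 t_bar_in by simp
  next
    case (3 i)
    have "({i}, Y) \<notin> block_rel n (o_bar n i)" for Y
      using 3 by (auto simp: block_rel_o_bar t_rel_def)
    then have "o_bar n i \<notin> rp_units n" using unit_block_rel(1)[of _ n "{i}"] 3(2) by blast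
    then show ?thesis using 3 o_bar_in by simp
  qed
qed

lemma rp_mult_assoc:
  assumes "A \<in> rook_partitions n" "B \<in> rook_partitions n" "C \<in> rook_partitions n"
  shows "rp_mult n (rp_mult n A B) C = rp_mult n A (rp_mult n B C)"
  by (rule block_rel_inj[of _ n])
    (simp_all add: assms block_rel_rp_mult rp_mult_in_rook_partitions O_assoc)

lemma Phi_Cons: "w \<noteq> [] \<Longrightarrow> Phi n (x # w) = rp_mult n (letter_value n x) (Phi n w)"
  by (cases w) (simp_all add: Phi_def)

lemma Phi_in:
  assumes "w \<in> free_semigroup (alphabet n)"
  shows "Phi n w \<in> rook_partitions n - rp_units n" "block_rel n (Phi n w) = word_rel n w"
proof -
  have "Phi n w \<in> rook_partitions n - rp_units n \<and> block_rel n (Phi n w) = word_rel n w"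
    using assms
  proof (induction w)
    case (Cons x w)
    have x: "letter_value n x \<in> rook_partitions n - rp_units n"
      using Cons.prems by (intro letter_value_in) (simp add: free_semigroup_def)
    show ?case
    proof (cases "w = []")
      case True
      then show ?thesis using x by (simp add: Phi_def)
    next
      case False
      then have "Phi n w \<in> rook_partitions n - rp_units n \<and> block_rel n (Phi n w) = word_rel n w"
        using Cons by (simp add: free_semigroup_def)
      then show ?thesis using x False
        by (simp add: Phi_Cons rp_mult_in_rook_partitions rp_mult_singular block_rel_rp_mult)
    qed
  qed (simp add: free_semigroup_def)
  then show "Phi n w \<in> rook_partitions n - rp_units n" "block_rel n (Phi n w) = word_rel n w" by auto
qed

lemma word_rel_append: "word_rel n (u @ v) = word_rel n u O word_rel n v"
  by (induction u) (simp_all add: O_assoc)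

lemma Phi_append:
  assumes "u \<in> free_semigroup (alphabet n)" "v \<in> free_semigroup (alphabet n)"
  shows "Phi n (u @ v) = rp_mult n (Phi n u) (Phi n v)"
proof (rule block_rel_inj[of _ n])
  have uv: "u @ v \<in> free_semigroup (alphabet n)" using assms by (rule free_semigroup_append)
  show "Phi n (u @ v) \<in> rook_partitions n" using Phi_in[OF uv] by blast
  show "rp_mult n (Phi n u) (Phi n v) \<in> rook_partitions n" by (rule rp_mult_in_rook_partitions)
  show "block_rel n (Phi n (u @ v)) = block_rel n (rp_mult n (Phi n u) (Phi n v))"
    using Phi_in[OF uv] Phi_in[OF assms(1)] Phi_in[OF assms(2)]
    by (simp add: word_rel_append block_rel_rp_mult)
qed

lemma Phi_eq_iff:
  assumes "u \<in> free_semigroup (alphabet n)" "v \<in> free_semigroup (alphabet n)"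
  shows "Phi n u = Phi n v \<longleftrightarrow> word_rel n u = word_rel n v"
  using Phi_in[OF assms(1)] Phi_in[OF assms(2)] block_rel_inj[of "Phi n u" n "Phi n v"] by auto

section \<open>The universal model\<close>

text \<open>The left component of the model is the action of the presented semigroup on words by right
  multiplication, which is faithful; the right component records the rook partition.\<close>

datatype ('a, 'b) rel_pair = Rel_Pair (left_rel: "'a rel") (right_rel: "'b rel")

instantiation rel_pair :: (type, type) monoid_mult
begin

definition one_rel_pair :: "('a, 'b) rel_pair" where
  "1 = Rel_Pair Id Id"

definition times_rel_pair :: "('a, 'b) rel_pair \<Rightarrow> ('a, 'b) rel_pair \<Rightarrow> ('a, 'b) rel_pair" where
  "x * y = Rel_Pair (left_rel x O left_rel y) (right_rel x O right_rel y)"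

instance
  by standard (auto simp: one_rel_pair_def times_rel_pair_def O_assoc)

end

definition word_congruence :: "nat \<Rightarrow> (letter list \<times> letter list) set" where
  "word_congruence n = generated_congruence (free_semigroup (alphabet n)) (@) (relations n)"

text \<open>The source u may be empty: the empty word stands for an adjoined identity, which the
  action sends to the class of w. Using relations on words in place of a quotient gives one monoid
  type for all n.\<close>

definition right_action :: "nat \<Rightarrow> letter list \<Rightarrow> letter list rel" where
  "right_action n w = {(u, v). set u \<subseteq> alphabet n \<and> (u @ w, v) \<in> word_congruence n}"

definition universal_letter :: "nat \<Rightarrow> letter \<Rightarrow> (letter list, nat set) rel_pair" where
  "universal_letter n x = Rel_Pair (right_action n [x]) (block_rel n (letter_value n x))"

definition universal_word :: "nat \<Rightarrow> letter list \<Rightarrow> (letter list, nat set) rel_pair" where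
  "universal_word n w = prod_list (map (universal_letter n) w)"

lemma word_congruence: "is_congruence (free_semigroup (alphabet n)) (@) (word_congruence n)"
  unfolding word_congruence_def
  by (intro generated_congruence_is_congruence relations_free free_semigroup_append)

lemma word_congruence_equiv:
  "(u, v) \<in> word_congruence n \<Longrightarrow> u \<in> free_semigroup (alphabet n) \<and> v \<in> free_semigroup (alphabet n)"
  "u \<in> free_semigroup (alphabet n) \<Longrightarrow> (u, u) \<in> word_congruence n"
  "(u, v) \<in> word_congruence n \<Longrightarrow> (v, u) \<in> word_congruence n"
  "(u, v) \<in> word_congruence n \<Longrightarrow> (v, w) \<in> word_congruence n \<Longrightarrow> (u, w) \<in> word_congruence n"
  using word_congruence[of n] unfolding is_congruence_def equiv_def refl_on_def sym_on_def trans_on_def by blast+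

lemma word_congruence_append:
  assumes "(u, v) \<in> word_congruence n" "set w \<subseteq> alphabet n"
  shows "(w @ u, w @ v) \<in> word_congruence n" "(u @ w, v @ w) \<in> word_congruence n"
proof -
  have "(w @ u, w @ v) \<in> word_congruence n \<and> (u @ w, v @ w) \<in> word_congruence n"
  proof (cases "w = []")
    case False
    then have "w \<in> free_semigroup (alphabet n)" using assms(2) by (simp add: free_semigroup_def)
    then show ?thesis using word_congruence[of n] assms(1) unfolding is_congruence_def by blast
  qed (use assms in simp)
  then show "(w @ u, w @ v) \<in> word_congruence n" "(u @ w, v @ w) \<in> word_congruence n" by auto
qed

lemma right_action_append:
  assumes "u \<in> free_semigroup (alphabet n)" "v \<in> free_semigroup (alphabet n)"
  shows "right_action n (u @ v) = right_action n u O right_action n v"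
proof (rule equalityI; rule subrelI)
  fix x z assume "(x, z) \<in> right_action n (u @ v)"
  then have xz: "set x \<subseteq> alphabet n" "((x @ u) @ v, z) \<in> word_congruence n"
    by (simp_all add: right_action_def)
  have xu: "x @ u \<in> free_semigroup (alphabet n)" using xz(1) assms(1) by (simp add: free_semigroup_def)
  then have "(x, x @ u) \<in> right_action n u"
    using xz(1) word_congruence_equiv(2) by (simp add: right_action_def)
  moreover have "(x @ u, z) \<in> right_action n v"
    using xz(2) xu by (simp add: right_action_def free_semigroup_def)
  ultimately show "(x, z) \<in> right_action n u O right_action n v" by blast
next
  fix x z assume "(x, z) \<in> right_action n u O right_action n v"
  then obtain y where xyz: "set x \<subseteq> alphabet n" "(x @ u, y) \<in> word_congruence n" "(y @ v, z) \<in> word_congruence n"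
    unfolding right_action_def by blast
  have "((x @ u) @ v, y @ v) \<in> word_congruence n"
    using xyz(2) assms(2) by (intro word_congruence_append) (auto simp: free_semigroup_def)
  then have "((x @ u) @ v, z) \<in> word_congruence n" using xyz(3) word_congruence_equiv(4) by blast
  then show "(x, z) \<in> right_action n (u @ v)" using xyz(1) by (simp add: right_action_def)
qed

lemma right_rel_mult: "right_rel (x * y) = right_rel x O right_rel y"
  by (simp add: times_rel_pair_def)

text \<open>Only non-empty words qualify: the empty product has left component \<open>Id\<close>,
  whereas \<open>right_action n []\<close> is the congruence itself.\<close>

lemma universal_word_eq:
  assumes "w \<in> free_semigroup (alphabet n)"
  shows "universal_word n w = Rel_Pair (right_action n w) (word_rel n w)"
  using assms
proof (induction w)
  case (Cons x w)
  show ?case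
  proof (cases "w = []")
    case True
    then show ?thesis by (simp add: universal_word_def universal_letter_def)
  next
    case False
    then have w: "w \<in> free_semigroup (alphabet n)" and x: "[x] \<in> free_semigroup (alphabet n)"
      using Cons.prems by (simp_all add: free_semigroup_def)
    have "universal_word n (x # w) = universal_letter n x * universal_word n w"
      by (simp add: universal_word_def)
    then show ?thesis
      using Cons.IH[OF w] right_action_append[OF x w] by (simp add: times_rel_pair_def universal_letter_def)
  qed
qed (simp add: free_semigroup_def)

lemma universal_word_eqD:
  assumes "u \<in> free_semigroup (alphabet n)" "v \<in> free_semigroup (alphabet n)"
    "universal_word n u = universal_word n v"
  shows "(u, v) \<in> word_congruence n"
proof -
  \<comment> \<open>Evaluation at the empty word recovers the class of the acting word.\<close>
  have "([], v) \<in> right_action n v" using word_congruence_equiv(2)[OF assms(2)] by (simp add: right_action_def)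
  then have "([], v) \<in> right_action n u"
    using assms by (simp add: universal_word_eq)
  then show ?thesis by (simp add: right_action_def)
qed

lemma universal_word_relations:
  assumes "(p, q) \<in> relations n"
  shows "universal_word n p = universal_word n q"
proof -
  have pq: "p \<in> free_semigroup (alphabet n)" "q \<in> free_semigroup (alphabet n)"
    using assms relations_free by auto
  have c: "(p, q) \<in> word_congruence n"
    using assms generated_congruence_subset unfolding word_congruence_def by blast
  have "(u @ p, v) \<in> word_congruence n \<longleftrightarrow> (u @ q, v) \<in> word_congruence n"
    if u: "set u \<subseteq> alphabet n" for u v
    using word_congruence_append(1)[OF c u] word_congruence_equiv(3,4) by blast
  then have "right_action n p = right_action n q" by (auto simp: right_action_def)
  then show ?thesis
    using pq word_rel_relations[OF assms] by (simp add: universal_word_eq)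
qed

text \<open>With the second component as semantics, \<open>universal.sem_inj\<close> becomes the
  completeness statement: generated elements with equal second components also have equal first
  components, which makes the underlying words congruent.\<close>

interpretation universal: rook_model n "\<lambda>i. universal_letter n (gE i)" "rook_t (universal_letter n)" right_rel
  for n
proof -
  interpret rook_relations n "\<lambda>i. universal_letter n (gE i)" "rook_t (universal_letter n)"
    by (rule rook_relations_letters) (use universal_word_relations in \<open>simp add: universal_word_def\<close>)
  show "rook_model n (\<lambda>i. universal_letter n (gE i)) (rook_t (universal_letter n)) right_rel"
  proof
    show "right_rel 1 = Id" by (simp add: one_rel_pair_def)
    show "right_rel (x * y) = right_rel x O right_rel y" for x y by (rule right_rel_mult)
    show "right_rel (universal_letter n (gE i)) = e_rel n i" if "i \<in> {1..n}" for i
      using block_rel_gE[OF that] by (simp add: universal_letter_def)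
    show "right_rel (rook_t (universal_letter n) i j) = t_rel n i j" if ij: "i \<le> n" "j \<le> n" "i \<noteq> j" for i j
    proof -
      have r: "right_rel (universal_letter n x) = block_rel n (letter_value n x)" for x
        by (simp add: universal_letter_def)
      consider "i = 0" "j \<noteq> 0" | "j = 0" "i \<noteq> 0" | "i \<in> {1..n}" "j \<in> {1..n}" using ij by fastforce
      then show ?thesis
      proof cases
        case 1
        then show ?thesis using r[of "gO j"] block_rel_gO[of n j] by simp
      next
        case 2
        then show ?thesis using r[of "gO i"] block_rel_gO[of n i] t_rel_sym[of n 0 i] by simp
      next
        case 3
        then show ?thesis using r[of "gt i j"] block_rel_gt[OF 3] ij(3) by simp
      qed
    qed
  qed
qed

section \<open>Words and the generated elements of the universal model\<close>

lemma generated_universal_letter: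
  assumes "x \<in> alphabet n"
  shows "universal.generated n (universal_letter n x)"
    and "universal.generated n z \<Longrightarrow> universal.generated n (z * universal_letter n x)"
proof -
  consider i where "x = gE i" "i \<in> {1..n}" | i j where "x = gt i j" "i \<in> {1..n}" "j \<in> {1..n}" "i \<noteq> j"
    | i where "x = gO i" "i \<in> {1..n}"
  proof -
    have "gT i j = gt i j" if "i < j" for i j using that by (simp add: gt_def)
    then show ?thesis using assms that unfolding alphabet_def by fastforce
  qed
  then have "universal.generated n (universal_letter n x) \<and>
    (universal.generated n z \<longrightarrow> universal.generated n (z * universal_letter n x))"
  proof cases
    case (1 i)
    then show ?thesis using universal.gen_e universal.gen_mult_e by blast
  next
    case (2 i j)
    then have "universal_letter n x = rook_t (universal_letter n) i j" by simp
    moreover have "i \<le> n" "j \<le> n" using 2 by auto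
    ultimately show ?thesis using universal.gen_t universal.gen_mult_t 2(4) by metis
  next
    case (3 i)
    then have "universal_letter n x = rook_t (universal_letter n) 0 i" by simp
    moreover have "0 \<le> n" "i \<le> n" "0 \<noteq> i" using 3 by auto
    ultimately show ?thesis using universal.gen_t universal.gen_mult_t by metis
  qed
  then show "universal.generated n (universal_letter n x)"
    "universal.generated n z \<Longrightarrow> universal.generated n (z * universal_letter n x)" by auto
qed

lemma generated_universal_word:
  assumes "w \<in> free_semigroup (alphabet n)"
  shows "universal.generated n (universal_word n w)"
  using assms
proof (induction w rule: rev_induct)
  case (snoc x w)
  then show ?case using generated_universal_letter[of x n]
    by (cases "w = []") (simp_all add: universal_word_def free_semigroup_def)
qed (simp add: free_semigroup_def)

lemma rook_t_letter:
  assumes "i \<le> n" "j \<le> n" "i \<noteq> j"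
  obtains x where "x \<in> alphabet n" "rook_t g i j = g x"
proof -
  consider "i = 0" "j \<in> {1..n}" | "j = 0" "i \<in> {1..n}" | "i \<in> {1..n}" "j \<in> {1..n}" using assms by fastforce
  then show ?thesis
  proof cases
    case 1
    then show ?thesis using that[of "gO j"] by (auto simp: alphabet_def)
  next
    case 2
    then show ?thesis using that[of "gO i"] by (auto simp: alphabet_def)
  next
    case 3
    then show ?thesis using that[OF gt_alphabet[OF 3 assms(3)]] assms(3) by simp
  qed
qed

lemma generated_is_universal_word:
  assumes "universal.generated n z"
  shows "\<exists>w\<in>free_semigroup (alphabet n). z = universal_word n w"
proof -
  have single: "\<exists>w\<in>free_semigroup (alphabet n). universal_letter n x = universal_word n w"
    if "x \<in> alphabet n" for x
    using that by (intro bexI[of _ "[x]"]) (simp_all add: universal_word_def free_semigroup_def)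
  have snoc: "\<exists>w\<in>free_semigroup (alphabet n). universal_word n v * universal_letter n x = universal_word n w"
    if "x \<in> alphabet n" "v \<in> free_semigroup (alphabet n)" for x v
    using that by (intro bexI[of _ "v @ [x]"]) (simp_all add: universal_word_def free_semigroup_def)
  have E: "gE i \<in> alphabet n" if "i \<in> {1..n}" for i using that by (simp add: alphabet_def)
  show ?thesis using assms
  proof (induction rule: universal.generated.induct)
    case (gen_e i)
    then show ?case using single E by blast
  next
    case (gen_t i j)
    then show ?case using single rook_t_letter[OF gen_t, of "universal_letter n"] by metis
  next
    case (gen_mult_e z i)
    then show ?case using snoc E by blast
  next
    case (gen_mult_t z i j)
    then show ?case using snoc rook_t_letter[OF gen_mult_t.hyps(2-4), of "universal_letter n"] by metis
  qed
qed

text \<open>The relation of A is that of a normal form and is realised by a product of letters; the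
  word spelling this product has the same relation as A, and the encoding is injective.\<close>

lemma Phi_surj:
  assumes "A \<in> rook_partitions n" "A \<notin> rp_units n"
  shows "A \<in> Phi n ` free_semigroup (alphabet n)"
proof -
  obtain F D ps qs where A: "F permutes {1..n}" "D \<subseteq> {1..n}" "D \<noteq> {}"
    "set ps \<subseteq> {..n} \<times> {..n}" "set qs \<subseteq> {..n} \<times> {..n}" "block_rel n A = normal_rel n ps D F qs"
    by (rule singular_normal_rel[OF assms]) (rule that)
  obtain z where "universal.generated n z" "right_rel z = normal_rel n ps D F qs"
    using universal.normal_rel_realised[OF A(1-5)] by blast
  then obtain w where w: "w \<in> free_semigroup (alphabet n)" "right_rel (universal_word n w) = normal_rel n ps D F qs"
    using generated_is_universal_word by blast
  then have "block_rel n (Phi n w) = block_rel n A"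
    using A(6) Phi_in[OF w(1)] by (simp add: universal_word_eq)
  then have "Phi n w = A" using Phi_in[OF w(1)] assms(1) by (intro block_rel_inj[of _ n]) auto
  then show ?thesis using w(1) by blast
qed

text \<open>Completeness is injectivity of \<open>right_rel\<close> on generated elements, followed
  by evaluation at the empty word. Soundness is minimality of the generated congruence below the
  kernel of \<open>word_rel\<close>.\<close>

lemma Phi_kernel:
  assumes "u \<in> free_semigroup (alphabet n)" "v \<in> free_semigroup (alphabet n)"
  shows "Phi n u = Phi n v \<longleftrightarrow> (u, v) \<in> word_congruence n"
proof
  assume "Phi n u = Phi n v"
  then have "right_rel (universal_word n u) = right_rel (universal_word n v)"
    using assms by (simp add: universal_word_eq Phi_eq_iff)
  then have "universal_word n u = universal_word n v"
    using universal.sem_inj[OF generated_universal_word generated_universal_word] assms by blast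
  then show "(u, v) \<in> word_congruence n" using assms by (intro universal_word_eqD)
next
  let ?K = "{(u, v) \<in> free_semigroup (alphabet n) \<times> free_semigroup (alphabet n). word_rel n u = word_rel n v}"
  have "is_congruence (free_semigroup (alphabet n)) (@) ?K"
    unfolding is_congruence_def equiv_def refl_on_def sym_on_def trans_on_def
    using free_semigroup_append by (auto simp: word_rel_append)
  moreover have "relations n \<subseteq> ?K" using relations_free word_rel_relations by blast
  ultimately have "word_congruence n \<subseteq> ?K"
    unfolding word_congruence_def by (rule generated_congruence_least)
  then show "(u, v) \<in> word_congruence n \<Longrightarrow> Phi n u = Phi n v" using assms Phi_eq_iff by blast
qed

theorem theorem3p14:
  fixes n :: nat
  shows "semigroup_presentation
           (rook_partitions n - rp_units n) (rp_mult n)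
           (alphabet n) (relations n) (Phi n)"
  unfolding semigroup_presentation_def
proof (intro conjI)
  show "is_semigroup (rook_partitions n - rp_units n) (rp_mult n)"
    unfolding is_semigroup_def
    by (simp add: rp_mult_in_rook_partitions rp_mult_singular rp_mult_assoc)
  show "relations n \<subseteq> free_semigroup (alphabet n) \<times> free_semigroup (alphabet n)"
    by (rule relations_free)
  show "semigroup_hom (free_semigroup (alphabet n)) (@) (rook_partitions n - rp_units n) (rp_mult n) (Phi n)"
    unfolding semigroup_hom_def using Phi_in(1) Phi_append by blast
  show "Phi n ` free_semigroup (alphabet n) = rook_partitions n - rp_units n"
    using Phi_in(1) Phi_surj by blast
  show "{(u, v). u \<in> free_semigroup (alphabet n) \<and> v \<in> free_semigroup (alphabet n) \<and> Phi n u = Phi n v} =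
      generated_congruence (free_semigroup (alphabet n)) (@) (relations n)"
    using Phi_kernel[of _ n] word_congruence_equiv(1)[of _ _ n] unfolding word_congruence_def by blast
qed

end
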